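(* Let $X\subset\mathbb R^2$ be a planar continuum (compact connected subset of the plane). Then every homotopy class (relative to endpoints) of paths in $X$ has an oscillatory geodesic representative which is unique up to reparametrization.
   Context: Let $g:\mathbb R^2\to[-1,1]$ depend only on the first coordinate $x_1$: $g=-1$ if $x_1\le-3$, $g=\frac12(x_1+1)$ if $-3\le x_1\le-1$, $g=0$ if $-1\le x_1\le 1$, $g=\frac12(x_1-1)$ if $1\le x_1\le 3$, $g=1$ if $x_1\ge3$. For a pair $(P,Q)$ of distinct parallel lines, let $h_{(P,Q)}$ be a composition of a dilation, rotation and translation sending $P$ to $\{x_1=-3\}$ and $Q$ to $\{x_1=3\}$, and $g_{(P,Q)}=g\circ h_{(P,Q)}$. For continuous $f:[a,b]\to\mathbb R^2$, $o(f,(P,Q))$ is the supremum of $-\sum_{i=1}^k g_{(P,Q)}(f(a_{i-1}))g_{(P,Q)}(f(a_i))$ over finite collections $a\le a_0\le\dots\le a_k\le b$ (empty sums $=0$). Fix a countable dense set $\{(P_i,Q_i)\}$ in the (separable metric) space of pairs of parallel lines and set $\mathcal T(\alpha)=\sum_i 2^{-i}\frac{o(\alpha,(P_i,Q_i))}{1+o(\alpha,(P_i,Q_i))}$. An oscillatory geodesic is a path with minimal $\mathcal T$ among all paths in $X$ homotopic to it relative to endpoints. Two paths are reparametrizations of each other if they differ by precomposition with monotone surjections of the parameter intervals (collapsing constant subpaths allowed). *)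

theory Defs
  imports "HOL-Analysis.Analysis"
begin

text \<open>The profile function g, as a function of the first coordinate.\<close>
definition gfun :: "real \<Rightarrow> real" where
  "gfun t = (if t \<le> -3 then -1 else if t \<le> -1 then (t + 1) / 2
             else if t \<le> 1 then 0 else if t \<le> 3 then (t - 1) / 2 else 1)"

text \<open>A pair (P,Q) of distinct parallel lines is represented by (u,c1,c2) with
  u a unit normal vector, P = {x. u \<bullet> x = c1}, Q = {x. u \<bullet> x = c2}, c1 \<noteq> c2.
  The triples (u,c1,c2) and (-u,-c1,-c2) represent the same pair.\<close>
type_synonym linepair = "(real^2) \<times> real \<times> real"

definition linepair_space :: "linepair set" where
  "linepair_space = {(u, c1, c2). norm u = 1 \<and> c1 \<noteq> c2}"

definition lp_flip :: "linepair \<Rightarrow> linepair" where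
  "lp_flip L = (case L of (u, c1, c2) \<Rightarrow> (-u, -c1, -c2))"

text \<open>g_{(P,Q)} = g \<circ> h_{(P,Q)}: the first coordinate of h_{(P,Q)} x is the affine
  function of u \<bullet> x sending c1 to -3 and c2 to 3.\<close>
definition gPQ :: "linepair \<Rightarrow> real^2 \<Rightarrow> real" where
  "gPQ L x = (case L of (u, c1, c2) \<Rightarrow> gfun (-3 + 6 * (u \<bullet> x - c1) / (c2 - c1)))"

definition osc :: "(real \<Rightarrow> real^2) \<Rightarrow> linepair \<Rightarrow> real" where
  "osc f L = Sup {- (\<Sum>i\<in>{1..k}. gPQ L (f (a (i - 1))) * gPQ L (f (a i))) | a k.
                 (\<forall>i\<le>k. 0 \<le> a i \<and> a i \<le> 1) \<and> (\<forall>i<k. a i \<le> a (Suc i))}"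

text \<open>The sequence L enumerates (P_1,Q_1),(P_2,Q_2),...; L i corresponds to index i+1.\<close>
definition Tfun :: "(nat \<Rightarrow> linepair) \<Rightarrow> (real \<Rightarrow> real^2) \<Rightarrow> real" where
  "Tfun L f = (\<Sum>i. (1/2) ^ (Suc i) * (osc f (L i) / (1 + osc f (L i))))"

text \<open>Density in the space of pairs of parallel lines (quotient of linepair_space by lp_flip).\<close>
definition dense_linepair_seq :: "(nat \<Rightarrow> linepair) \<Rightarrow> bool" where
  "dense_linepair_seq L \<longleftrightarrow> (\<forall>i. L i \<in> linepair_space) \<and>
     linepair_space \<subseteq> closure (range L \<union> lp_flip ` range L)"

definition osc_geodesic :: "(nat \<Rightarrow> linepair) \<Rightarrow> (real^2) set \<Rightarrow> (real \<Rightarrow> real^2) \<Rightarrow> bool" where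
  "osc_geodesic L X \<gamma> \<longleftrightarrow> path \<gamma> \<and> path_image \<gamma> \<subseteq> X \<and>
     (\<forall>\<beta>. homotopic_paths X \<gamma> \<beta> \<longrightarrow> Tfun L \<gamma> \<le> Tfun L \<beta>)"

definition is_reparametrization :: "(real \<Rightarrow> 'a) \<Rightarrow> (real \<Rightarrow> 'a) \<Rightarrow> bool" where
  "is_reparametrization \<alpha> \<beta> \<longleftrightarrow> (\<exists>\<phi> \<psi> :: real \<Rightarrow> real. mono_on {0..1} \<phi> \<and> \<phi> ` {0..1} = {0..1} \<and>
     mono_on {0..1} \<psi> \<and> \<psi> ` {0..1} = {0..1} \<and> (\<forall>t\<in>{0..1}. \<alpha> (\<phi> t) = \<beta> (\<psi> t)))"

end

theory Submission
  imports Defs "HOL-Complex_Analysis.Great_Picard"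
begin

text \<open>
  Call a path in \<open>X\<close> tight if every subpath that is homotopic in \<open>X\<close> to the chord between its
  endpoints stays on that chord. Replacing a subpath by such a chord does not increase any
  oscillation, and if the path leaves the chord, then it strictly decreases the oscillation
  with respect to some pair of lines of the dense sequence; so oscillatory geodesics are tight.

  The main tool is a cut lemma: if a null-homotopic loop crosses a line, then by unicoherence of the
  square the preimage of the line under a null homotopy contains a continuum joining two boundary
  points, and its image is a segment of the line inside \<open>X\<close> that cuts the loop into two
  null-homotopic loops. The cut lemma survives uniform limits. Cutting a uniform limit of
  null-homotopic loops into ever smaller loops and coning them off gives approximate contractions
  that converge to a contraction in \<open>X\<close>; so homotopy classes of paths in \<open>X\<close> are closed under uniform limits.

  Bounded oscillations bound the number of large jumps of a path, so a minimizing sequence becomes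
  equicontinuous after reparametrization; a limit is a tight path of no larger oscillations. Two
  homotopic tight paths are reparametrizations of each other: between two common points that are
  reached along homotopic paths, the point farthest from a suitable center is another such point.
\<close>

section \<open>Cutting a null-homotopic loop along a line\<close>

text \<open>A continuum may fail to be locally connected, so uniformly close paths in
  \<open>X\<close> need not be homotopic in \<open>X\<close>, and straight-line homotopies leave
  \<open>X\<close>. That homotopy classes survive uniform limits is proved by planar separation; the
  limits of minimizers, of cuts along approaching lines and of meeting times all rest on it.

  The second difficulty is that \<open>Tfun\<close> is bounded, so that a bound on it need not bound
  any single oscillation, and a minimizing sequence in the full homotopy class carries no evident
  compactness. The minimization therefore runs only over the paths whose oscillations are all at
  most those of a given path. A minimizer of this restricted problem is only seen to be tight.
  Global minimality then comes from uniqueness: every competitor dominates, oscillation by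
  oscillation, a tight path of its class, and this one is a reparametrization of the first.\<close>

abbreviation unit_square :: "(real \<times> real) set" where
  "unit_square \<equiv> {0..1} \<times> {0..1}"

lemma unit_square_facts:
  "convex unit_square" "compact unit_square" "closed unit_square" "connected unit_square"
  by (auto intro!: convex_Times compact_Times closed_Times connected_Times)

section \<open>Planar separation in the unit square\<close>

lemma interlaced_path_connected_meet:
  assumes P: "path_connected P" "P \<subseteq> unit_square" and R: "path_connected R" "R \<subseteq> unit_square"
    and pts: "(0, x1) \<in> P" "(0, x2) \<in> R" "(0, x3) \<in> P" "(0, x4) \<in> R"
    and ord: "x1 < x2" "x2 < x3" "x3 < x4"
  shows "P \<inter> R \<noteq> {}"
proof -
  \<comment> \<open>\<open>fashoda_interlace\<close> places the four endpoints on the bottom edge of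
    a box. Here they lie on the left edge, which is time 0 of a homotopy, so the coordinates are
    exchanged.\<close>
  define F :: "real \<times> real \<Rightarrow> real^2" where "F z = (\<chi> i. if i = 1 then snd z else fst z)" for z
  have F1: "F z $ 1 = snd z" and F2: "F z $ 2 = fst z" for z
    by (auto simp: F_def)
  have contF: "continuous_on S F" for S
    unfolding F_def
  proof (intro continuous_on_vec_lambda)
    show "continuous_on S (\<lambda>z. if i = 1 then snd z else fst z)" for i :: 2
      by (cases "i = 1") (auto intro!: continuous_intros)
  qed
  have injF: "F z = F w \<Longrightarrow> z = w" for z w
    by (metis F1 F2 prod_eqI)
  obtain f where f: "path f" "path_image f \<subseteq> P" "pathstart f = (0,x1)" "pathfinish f = (0,x3)"
    using P pts unfolding path_connected_def by meson
  obtain g where g: "path g" "path_image g \<subseteq> R" "pathstart g = (0,x2)" "pathfinish g = (0,x4)"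
    using R pts unfolding path_connected_def by meson
  have box: "F z \<in> cbox 0 (\<chi> i. 1)" if "z \<in> unit_square" for z
    using that by (auto simp: mem_box_cart F_def)
  obtain z where z: "z \<in> path_image (F \<circ> f)" "z \<in> path_image (F \<circ> g)"
  proof (rule fashoda_interlace[of "F \<circ> f" "F \<circ> g" 0 "\<chi> i. 1"])
    show "path (F \<circ> f)" "path (F \<circ> g)"
      using f g contF by (auto intro: path_continuous_image)
    show "path_image (F \<circ> f) \<subseteq> cbox 0 (\<chi> i. 1)" "path_image (F \<circ> g) \<subseteq> cbox 0 (\<chi> i. 1)"
      using f(2) g(2) P(2) R(2) box by (auto simp: path_image_compose)
  qed (use f(3,4) g(3,4) ord in \<open>auto simp: pathstart_compose pathfinish_compose F1 F2\<close>)
  obtain a where "a \<in> path_image f" "z = F a" using z(1) unfolding path_image_compose by (rule imageE)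
  moreover obtain b where "b \<in> path_image g" "z = F b" using z(2) unfolding path_image_compose by (rule imageE)
  ultimately show ?thesis using f(2) g(2) injF[of a b] by blast
qed

lemma locally_path_connected_imp_path_connected:
  fixes S :: "'a::topological_space set"
  assumes "locally path_connected S" "connected S"
  shows "path_connected S"
  using assms
  by (simp add: path_connected_component connected_iff_connected_component
      path_component_eq_connected_component)

text \<open>Interlacing is available for path-connected sets, while separating continua are merely
  connected. Balls around all points of \<open>A\<close>, intersected with \<open>Q\<close>, form a
  connected set that is open in the locally path-connected \<open>Q\<close>, hence
  path-connected.\<close>

lemma connected_subset_open_thickening:
  fixes A :: "'a::euclidean_space set"
  assumes "connected A" "A \<subseteq> Q" "convex Q" "e > 0"
  obtains B where "path_connected B" "A \<subseteq> B" "B \<subseteq> Q" "\<And>x. x \<in> B \<Longrightarrow> \<exists>a\<in>A. dist a x < e"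
proof (cases "A = {}")
  case True
  then show ?thesis using that[of "{}"] by auto
next
  case False
  define B where "B = Q \<inter> (\<Union>a\<in>A. ball a e)"
  have sub: "A \<subseteq> B" using assms by (auto simp: B_def)
  have Beq: "B = \<Union> ((\<lambda>a. A \<union> (ball a e \<inter> Q)) ` A)"
    using assms by (auto simp: B_def)
  have con: "connected (A \<union> (ball a e \<inter> Q))" if "a \<in> A" for a
    by (rule connected_Un) (use assms that in \<open>auto intro!: convex_connected convex_Int\<close>)
  have "connected B"
    unfolding Beq by (rule connected_Union) (use con False in auto)
  moreover have "openin (top_of_set Q) B"
    unfolding B_def by (auto intro: openin_open_Int)
  moreover have "locally path_connected Q"
    using assms convex_imp_locally_path_connected by blast
  ultimately have "path_connected B"
    by (meson locally_open_subset locally_path_connected_imp_path_connected)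
  then show ?thesis using that[of B] sub by (auto simp: B_def)
qed

text \<open>\<open>A\<close> is the component of the sublevel set at \<open>a\<close>, and
  \<open>V\<close> the component of \<open>Q - A\<close> at \<open>b\<close>. The sets
  \<open>Q - V\<close> and \<open>closure V\<close> are connected, closed and cover
  \<open>Q\<close>, so unicoherence of the convex set \<open>Q\<close> makes their intersection, the
  frontier of \<open>V\<close>, connected. The last two conclusions are the maximality of the two
  components.\<close>

lemma separating_continuum:
  fixes f :: "real \<times> real \<Rightarrow> real"
  assumes f: "continuous_on Q f" and Q: "convex Q" "compact Q" and ab: "a \<in> Q" "b \<in> Q" "f a < c" "c < f b"
  obtains A V where "A \<subseteq> Q" "connected A" "closed A" "a \<in> A" "V \<subseteq> Q" "path_connected V"
    "openin (top_of_set Q) V" "b \<in> V" "A \<inter> V = {}" "closure V - V \<subseteq> A" "connected (closure V - V)"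
    "\<And>z. z \<in> A \<Longrightarrow> f z \<le> c" "\<And>z. z \<in> closure V - V \<Longrightarrow> f z = c"
    "\<And>T. connected T \<Longrightarrow> T \<subseteq> Q \<Longrightarrow> T \<inter> A \<noteq> {} \<Longrightarrow> (\<And>z. z \<in> T \<Longrightarrow> f z \<le> c) \<Longrightarrow> T \<subseteq> A"
    "\<And>T. connected T \<Longrightarrow> T \<subseteq> Q \<Longrightarrow> T \<inter> V \<noteq> {} \<Longrightarrow> T \<inter> A = {} \<Longrightarrow> T \<subseteq> V"
proof -
  define D where "D = {z \<in> Q. f z \<le> c}"
  define A where "A = connected_component_set D a"
  define V where "V = connected_component_set (Q - A) b"
  have Qcl: "closed Q" using Q compact_imp_closed by blast
  have clD: "closed D"
    unfolding D_def using continuous_closed_preimage[OF f Qcl closed_atMost[of c]]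
    by (simp add: vimage_def Int_def)
  have aD: "a \<in> D" using ab by (auto simp: D_def)
  have AD: "A \<subseteq> D" unfolding A_def by (rule connected_component_subset)
  have AQ: "A \<subseteq> Q" using AD by (auto simp: D_def)
  have conA: "connected A" by (simp add: A_def)
  have clA: "closed A" unfolding A_def by (rule closed_connected_component[OF clD])
  have aA: "a \<in> A" unfolding A_def using aD by simp
  have bA: "b \<in> Q - A" using AD ab by (auto simp: D_def)
  have Vsub: "V \<subseteq> Q - A" unfolding V_def by (rule connected_component_subset)
  have Vcomp: "V \<in> components (Q - A)" unfolding V_def using bA by (auto simp: components_def)
  have bV: "b \<in> V" unfolding V_def using bA by simp
  have lpc: "locally path_connected Q" using Q convex_imp_locally_path_connected by blast
  have opQA: "openin (top_of_set Q) (Q - A)"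
    using clA by (metis Diff_eq Compl_eq_Diff_UNIV openin_open_Int open_Compl)
  have lpc2: "locally path_connected (Q - A)" using lpc opQA locally_open_subset by blast
  have "openin (top_of_set (Q - A)) V"
    using lpc2 Vcomp by (meson locally_path_connected_imp_locally_connected openin_components_locally_connected)
  then have opV: "openin (top_of_set Q) V" using opQA openin_trans by blast
  have conV: "connected V" using Vcomp in_components_connected by blast
  have pcV: "path_connected V"
    using conV opV lpc by (meson locally_open_subset locally_path_connected_imp_path_connected)
  have clV: "closure V \<subseteq> Q" using Vsub Qcl by (meson Diff_subset closure_minimal subset_trans)
  have frA: "closure V - V \<subseteq> A"
  proof -
    have "closedin (top_of_set (Q - A)) V" using Vcomp closedin_component by blast
    then obtain T where "closed T" "V = (Q - A) \<inter> T" by (auto simp: closedin_closed)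
    then have "(Q - A) \<inter> closure V \<subseteq> V" using closure_minimal[of V T] by auto
    then show ?thesis using clV by auto
  qed
  have con1: "connected (Q - V)"
    by (rule component_diff_connected[OF conA convex_connected[OF Q(1)] AQ Vcomp])
  have con2: "connected (closure V)" using conV connected_imp_connected_closure by blast
  have eq: "(Q - V) \<inter> closure V = closure V - V" using clV by auto
  have conC: "connected (closure V - V)"
    unfolding eq[symmetric]
  proof (rule unicoherentD[OF convex_imp_unicoherent[OF Q(1)] con1 con2])
    show "Q = (Q - V) \<union> closure V" using clV closure_subset by blast
    show "closedin (top_of_set Q) (Q - V)" using opV by auto
    show "closedin (top_of_set Q) (closure V)" using clV closed_closure closed_subset by blast
  qed
  have maxA: "T \<subseteq> A" if m: "connected T" "T \<subseteq> Q" "T \<inter> A \<noteq> {}" "\<And>z. z \<in> T \<Longrightarrow> f z \<le> c" for T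
  proof -
    obtain x where x: "x \<in> T" "x \<in> A" using m by blast
    have "T \<subseteq> connected_component_set D x"
      by (rule connected_component_maximal) (use m x in \<open>auto simp: D_def\<close>)
    then show ?thesis using x(2) unfolding A_def by (metis connected_component_eq)
  qed
  have maxV: "T \<subseteq> V" if m: "connected T" "T \<subseteq> Q" "T \<inter> V \<noteq> {}" "T \<inter> A = {}" for T
  proof -
    obtain x where x: "x \<in> T" "x \<in> V" using m by blast
    have "T \<subseteq> connected_component_set (Q - A) x"
      by (rule connected_component_maximal) (use m x in auto)
    then show ?thesis using x(2) unfolding V_def by (metis connected_component_eq)
  qed
  \<comment> \<open>If \<open>f z < c\<close>, then a whole neighbourhood of \<open>z\<close> in
    \<open>Q\<close> would belong to \<open>A\<close> by maximality, but \<open>z\<close> is a limit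
    of points of \<open>V\<close>.\<close>
  have frc: "f z = c" if z: "z \<in> closure V - V" for z
  proof (rule ccontr)
    assume ne: "f z \<noteq> c"
    have zA: "z \<in> A" using z frA by auto
    then have "f z < c" using AD ne by (auto simp: D_def)
    then obtain d where d: "d > 0" "\<And>y. y \<in> Q \<Longrightarrow> dist y z < d \<Longrightarrow> dist (f y) (f z) < c - f z"
      using f zA AQ unfolding continuous_on_iff by (metis diff_gt_0_iff_gt subsetD)
    have "ball z d \<inter> Q \<subseteq> A"
    proof (rule maxA)
      show "connected (ball z d \<inter> Q)" by (intro convex_connected convex_Int convex_ball Q)
      show "ball z d \<inter> Q \<inter> A \<noteq> {}" using zA AQ d(1) by (metis IntI centre_in_ball empty_iff subsetD)
      fix y assume "y \<in> ball z d \<inter> Q"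
      then have "dist (f y) (f z) < c - f z" using d(2)[of y] by (auto simp: dist_commute)
      then show "f y \<le> c" by (auto simp: dist_real_def)
    qed auto
    moreover obtain v where v: "v \<in> V" "dist v z < d" using z d(1) by (auto simp: closure_approachable)
    moreover have "v \<in> ball z d" using v(2) by (simp add: dist_commute)
    ultimately show False using Vsub by blast
  qed
  show ?thesis
    by (rule that[of A V]) (use AQ conA clA aA Vsub pcV opV bV frA conC AD frc maxA maxV in \<open>auto simp: D_def\<close>)
qed

lemma connected_line_subset_convex:
  fixes u :: "real^2" and J :: "(real^2) set"
  assumes u: "u \<noteq> 0" and J: "connected J" "\<And>x. x \<in> J \<Longrightarrow> u \<bullet> x = c"
  shows "convex J"
proof -
  \<comment> \<open>The quarter turn of \<open>u\<close>: on a line with normal \<open>u\<close> a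
    point is determined by its inner product with \<open>v\<close>, so a connected subset of the
    line corresponds to an interval.\<close>
  define v :: "real^2" where "v = (\<chi> i. if i = 1 then - (u $ 2) else u $ 1)"
  have nz: "(u$1)^2 + (u$2)^2 \<noteq> 0"
    using u by (auto simp: vec_eq_iff forall_2 sum_power2_eq_zero_iff)
  have inj: "x = y" if "u \<bullet> x = u \<bullet> y" "v \<bullet> x = v \<bullet> y" for x y :: "real^2"
  proof -
    define d where "d = x - y"
    have 1: "u$1 * d$1 + u$2 * d$2 = 0" using that(1)
      by (simp add: d_def inner_vec_def sum_2 algebra_simps)
    have 2: "- u$2 * d$1 + u$1 * d$2 = 0" using that(2)
      by (simp add: d_def v_def inner_vec_def sum_2 algebra_simps)
    have "((u$1)^2 + (u$2)^2) * d$1 = u$1 * (u$1 * d$1 + u$2 * d$2) - u$2 * (- u$2 * d$1 + u$1 * d$2)"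
      by (simp add: algebra_simps power2_eq_square)
    then have "((u$1)^2 + (u$2)^2) * d$1 = 0" using 1 2 by simp
    moreover have "((u$1)^2 + (u$2)^2) * d$2 = u$2 * (u$1 * d$1 + u$2 * d$2) + u$1 * (- u$2 * d$1 + u$1 * d$2)"
      by (simp add: algebra_simps power2_eq_square)
    then have "((u$1)^2 + (u$2)^2) * d$2 = 0" using 1 2 by simp
    ultimately have "d$1 = 0" "d$2 = 0" using nz mult_eq_0_iff by blast+
    then have "d = 0" by (simp add: vec_eq_iff forall_2)
    then show ?thesis by (simp add: d_def)
  qed
  have ival: "is_interval ((\<lambda>x. v \<bullet> x) ` J)"
    by (simp add: is_interval_connected_1 connected_continuous_image J(1) continuous_intros)
  show ?thesis
    unfolding convex_alt
  proof (intro ballI allI impI)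
    fix x y t assume xy: "x \<in> J" "y \<in> J" "0 \<le> t \<and> t \<le> (1::real)"
    define z where "z = (1 - t) *\<^sub>R x + t *\<^sub>R y"
    have "convex ((\<lambda>x. v \<bullet> x) ` J)" using ival by (simp add: is_interval_convex_1)
    then have "(1 - t) *\<^sub>R (v \<bullet> x) + t *\<^sub>R (v \<bullet> y) \<in> (\<lambda>x. v \<bullet> x) ` J"
      using xy unfolding convex_alt by blast
    then obtain w where w: "w \<in> J" "v \<bullet> w = v \<bullet> z"
      by (auto simp: z_def inner_right_distrib)
    have "u \<bullet> z = c" using J(2)[OF xy(1)] J(2)[OF xy(2)] by (simp add: z_def inner_right_distrib algebra_simps)
    then have "w = z" using inj w J(2) by auto
    then show "(1 - t) *\<^sub>R x + t *\<^sub>R y \<in> J" using w by (simp add: z_def)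
  qed
qed

text \<open>A path in \<open>V\<close> is compact and disjoint from the closed set \<open>A\<close>,
  so it keeps a positive distance from it. Thickening \<open>A\<close> by this distance gives a
  path-connected set that still misses the path, whereas interlaced path-connected sets have to
  meet.\<close>

lemma interlaced_closed_open_disjoint:
  assumes A: "connected A" "closed A" "A \<subseteq> unit_square"
    and V: "path_connected V" "V \<subseteq> unit_square" and dis: "A \<inter> V = {}"
  shows "\<lbrakk>(0, x1) \<in> A; (0, x2) \<in> V; (0, x3) \<in> A; (0, x4) \<in> V; x1 < x2; x2 < x3; x3 < x4\<rbrakk> \<Longrightarrow> False"
    and "\<lbrakk>(0, x1) \<in> V; (0, x2) \<in> A; (0, x3) \<in> V; (0, x4) \<in> A; x1 < x2; x2 < x3; x3 < x4\<rbrakk> \<Longrightarrow> False"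
proof -
  have *: "\<exists>B K. path_connected B \<and> path_connected K \<and> B \<subseteq> unit_square \<and> K \<subseteq> unit_square \<and>
      A \<subseteq> B \<and> a \<in> K \<and> b \<in> K \<and> B \<inter> K = {}" if ab: "a \<in> V" "b \<in> V" for a b
  proof (cases "A = {}")
    case True
    then show ?thesis using V ab by (intro exI[of _ "{}"] exI[of _ V]) auto
  next
    case False
    obtain g where g: "path g" "path_image g \<subseteq> V" "pathstart g = a" "pathfinish g = b"
      using V(1) ab unfolding path_connected_def by meson
    have cK: "compact (path_image g)" using g(1) compact_path_image by blast
    have "A \<inter> path_image g = {}" using g(2) dis by auto
    then have "setdist A (path_image g) > 0"
      using A(2) cK False g(1) by (metis setdist_eq_0_closed_compact setdist_pos_le antisym_conv1 path_image_nonempty)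
    then obtain B where B: "path_connected B" "A \<subseteq> B" "B \<subseteq> unit_square"
        "\<And>x. x \<in> B \<Longrightarrow> \<exists>a\<in>A. dist a x < setdist A (path_image g)"
      using connected_subset_open_thickening[OF A(1,3) unit_square_facts(1)] by metis
    have "B \<inter> path_image g = {}"
      using B(4) setdist_le_dist[of _ A _ "path_image g"] by fastforce
    moreover have "a \<in> path_image g" "b \<in> path_image g" using g by auto
    moreover have "path_connected (path_image g)" using g(1) path_connected_path_image by blast
    ultimately show ?thesis using B g(2) V(2) by (intro exI[of _ B] exI[of _ "path_image g"]) auto
  qed
  show False if m: "(0, x1) \<in> A" "(0, x2) \<in> V" "(0, x3) \<in> A" "(0, x4) \<in> V" "x1 < x2" "x2 < x3" "x3 < x4"
  proof -
    obtain B K where "path_connected B" "path_connected K" "B \<subseteq> unit_square" "K \<subseteq> unit_square"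
      "A \<subseteq> B" "(0, x2) \<in> K" "(0, x4) \<in> K" "B \<inter> K = {}"
      using *[OF m(2,4)] by auto
    then show False using interlaced_path_connected_meet[of B K x1 x2 x3 x4] m by auto
  qed
  show False if m: "(0, x1) \<in> V" "(0, x2) \<in> A" "(0, x3) \<in> V" "(0, x4) \<in> A" "x1 < x2" "x2 < x3" "x3 < x4"
  proof -
    obtain B K where "path_connected B" "path_connected K" "B \<subseteq> unit_square" "K \<subseteq> unit_square"
      "A \<subseteq> B" "(0, x1) \<in> K" "(0, x3) \<in> K" "B \<inter> K = {}"
      using *[OF m(1,3)] by auto
    then show False using interlaced_path_connected_meet[of K B x1 x2 x3 x4] m by auto
  qed
qed

lemma homotopic_paths_in_convex:
  fixes g g' :: "real \<Rightarrow> 'a::real_normed_vector"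
  assumes "convex J" "J \<subseteq> X" "path g" "path_image g \<subseteq> J" "path g'" "path_image g' \<subseteq> J"
    "pathstart g' = pathstart g" "pathfinish g' = pathfinish g"
  shows "homotopic_paths X g g'"
proof -
  have m: "g t \<in> J" "g' t \<in> J" if "t \<in> {0..1}" for t
    using that assms(4,6) by (auto simp: path_image_def)
  have "closed_segment (g t) (g' t) \<subseteq> X" if "t \<in> {0..1}" for t
    using m[OF that] assms(1,2) closed_segment_subset by blast
  then show ?thesis
    using homotopic_paths_linear[OF assms(3,5,7,8)] by blast
qed

lemma closed_segment_Pair_const:
  fixes a b :: real
  shows "closed_segment (c::real, a) (c, b) = Pair c ` closed_segment a b"
proof -
  have "(1 - t) *\<^sub>R (c, a) + t *\<^sub>R (c, b) = (c, (1 - t) *\<^sub>R a + t *\<^sub>R b)" for t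
    by (simp add: algebra_simps)
  then show ?thesis unfolding closed_segment_def by auto
qed

text \<open>A null homotopy is modified beyond the separating continuum \<open>C\<close> by projecting it to the segment
  \<open>h ` C\<close>; this leaves the part of the loop on one side of \<open>C\<close> unchanged and moves the other part into that segment.\<close>
lemma null_loop_cut_aux:
  fixes X :: "(real^2) set"
  assumes hom: "homotopic_paths X f (linepath (f 0) (f 0))"
    and pq: "0 \<le> p" "p < q" "q \<le> 1" and c: "u \<bullet> f p < c" "c < u \<bullet> f q"
  obtains s t where "0 \<le> s" "s < t" "t \<le> 1" "(p < s \<and> s < q) \<noteq> (p < t \<and> t < q)"
    "u \<bullet> f s = c" "u \<bullet> f t = c" "closed_segment (f s) (f t) \<subseteq> X"
    "homotopic_paths X (subpath s t f) (linepath (f s) (f t))"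
proof -
  let ?Q = unit_square
  note cutI = that
  have u0: "u \<noteq> 0" using c by auto
  have f1: "f 1 = f 0" using homotopic_paths_imp_pathfinish[OF hom] by (simp add: pathfinish_def)
  obtain h where hh: "continuous_on ?Q h" "h \<in> ?Q \<rightarrow> X" "\<forall>x\<in>{0..1}. h (0, x) = f x"
    "\<forall>x\<in>{0..1}. h (1, x) = linepath (f 0) (f 0) x"
    "\<forall>t\<in>{0..1}. pathstart (h \<circ> Pair t) = pathstart f \<and> pathfinish (h \<circ> Pair t) = pathfinish f"
    using hom unfolding homotopic_paths by blast
  have h: "continuous_on ?Q h" "\<And>z. z \<in> ?Q \<Longrightarrow> h z \<in> X"
    and h0: "\<And>x. x \<in> {0..1} \<Longrightarrow> h (0, x) = f x" and h1: "\<And>x. x \<in> {0..1} \<Longrightarrow> h (1, x) = f 0"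
    and hs: "\<And>r. r \<in> {0..1} \<Longrightarrow> h (r, 0) = f 0 \<and> h (r, 1) = f 0"
    using hh f1 by (auto simp: pathstart_def pathfinish_def linepath_refl funcset_mem)
  have sc1: "continuous_on ?Q (\<lambda>z. u \<bullet> h z)" by (intro continuous_intros h(1))
  have sc2: "(0, p) \<in> ?Q" "(0, q) \<in> ?Q" "u \<bullet> h (0, p) < c" "c < u \<bullet> h (0, q)"
    using h0[of p] h0[of q] pq c by auto
  note sc = sc1 unit_square_facts(1,2) sc2
  show thesis
  proof (rule separating_continuum[OF sc])
    fix A V
    assume AV: "A \<subseteq> ?Q" "connected A" "closed A" "(0, p) \<in> A" "V \<subseteq> ?Q" "path_connected V"
      "openin (top_of_set ?Q) V" "(0, q) \<in> V" "A \<inter> V = {}" "closure V - V \<subseteq> A" "connected (closure V - V)"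
      and "\<And>z. z \<in> A \<Longrightarrow> u \<bullet> h z \<le> c" and levC: "\<And>z. z \<in> closure V - V \<Longrightarrow> u \<bullet> h z = c"
      and maxA: "\<And>T. connected T \<Longrightarrow> T \<subseteq> ?Q \<Longrightarrow> T \<inter> A \<noteq> {} \<Longrightarrow> (\<And>z. z \<in> T \<Longrightarrow> u \<bullet> h z \<le> c) \<Longrightarrow> T \<subseteq> A"
      and maxV: "\<And>T. connected T \<Longrightarrow> T \<subseteq> ?Q \<Longrightarrow> T \<inter> V \<noteq> {} \<Longrightarrow> T \<inter> A = {} \<Longrightarrow> T \<subseteq> V"
    define C where "C = closure V - V"
    have CQ: "C \<subseteq> ?Q" using AV by (auto simp: C_def)
    have clVQ: "closure V \<subseteq> ?Q" using AV(5) unit_square_facts(3) closure_minimal by blast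
    note nc = interlaced_closed_open_disjoint[OF AV(2,3,1,6,5,9)]
    \<comment> \<open>The three sides on which the null homotopy is constantly \<open>f 0\<close>.
      Because of the constant value this connected set lies entirely inside or entirely outside each
      of \<open>A\<close> and \<open>V\<close>.\<close>
    define T3 :: "(real \<times> real) set" where "T3 = {0..1} \<times> {0} \<union> ({1} \<times> {0..1} \<union> {0..1} \<times> {1})"
    have T3Q: "T3 \<subseteq> ?Q" by (auto simp: T3_def)
    have T3cor: "(0,1) \<in> T3" "(0,0) \<in> T3" by (auto simp: T3_def)
    have T3h: "h z = f 0" if "z \<in> T3" for z using that h1 hs by (auto simp: T3_def)
    have T3con: "connected T3"
    proof -
      have "(1::real, 0::real) \<in> {0..1} \<times> {0} \<inter> ({1} \<times> {0..1} \<union> {0..1} \<times> {1})"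
        "(1::real, 1::real) \<in> {1} \<times> {0..1} \<inter> {0..1} \<times> {1}" by auto
      then show ?thesis
        unfolding T3_def by (intro connected_Un connected_Times) (simp_all only: connected_Icc connected_sing, blast+)
    qed
    have T3A: "T3 \<subseteq> A \<or> T3 \<inter> A = {}"
    proof (cases "T3 \<inter> A = {}")
      case False
      then obtain z where "z \<in> T3" "z \<in> A" by auto
      then have "u \<bullet> f 0 \<le> c" using \<open>\<And>z. z \<in> A \<Longrightarrow> u \<bullet> h z \<le> c\<close> T3h by metis
      then show ?thesis using maxA[OF T3con T3Q False] T3h by auto
    qed auto
    have T3V: "T3 \<subseteq> V" if "T3 \<inter> V \<noteq> {}"
      using maxV[OF T3con T3Q that] T3A that AV(9) by auto
    define As where "As = {x \<in> {0..1}. (0, x) \<in> A}"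
    have "As = {0..1} \<inter> Pair 0 -` A" by (auto simp: As_def)
    moreover have "closed (Pair (0::real) -` A :: real set)"
      by (intro closed_vimage AV continuous_intros)
    ultimately have cAs: "compact As" using compact_Int_closed by (metis compact_Icc)
    have pAs: "p \<in> As" using AV(4) pq by (auto simp: As_def)
    have qAs: "q \<notin> As" using AV(8,9) by (auto simp: As_def)
    have seg: "Pair 0 ` I \<subseteq> V" if I: "connected I" "I \<subseteq> {0..1}" "q' \<in> I" "(0,q') \<in> V" "I \<inter> As = {}" for I :: "real set" and q'
    proof (rule maxV)
      show "connected (Pair (0::real) ` I)" by (intro connected_continuous_image I continuous_intros)
      show "Pair 0 ` I \<subseteq> ?Q" using I by auto
      show "Pair 0 ` I \<inter> V \<noteq> {}" using I by blast
      show "Pair 0 ` I \<inter> A = {}" using I(2,5) unfolding As_def by blast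
    qed
    have clos: "(0, x) \<in> closure V" if "Pair 0 ` I \<subseteq> V" "x \<in> closure I" for I x
    proof -
      have "Pair 0 ` closure I \<subseteq> closure V"
        by (rule image_closure_subset) (use that closure_subset in \<open>auto intro!: continuous_intros\<close>)
      then show ?thesis using that(2) by auto
    qed
    \<comment> \<open>The last time before \<open>q\<close> at which the left edge meets
      \<open>A\<close>. The edge after it and up to \<open>q\<close> lies in \<open>V\<close>, so
      \<open>(0, s)\<close> is on the frontier \<open>C\<close>.\<close>
    obtain s where s: "s \<in> As" "p \<le> s" "s \<le> q" "\<And>x. x \<in> As \<Longrightarrow> p \<le> x \<Longrightarrow> x \<le> q \<Longrightarrow> x \<le> s"
    proof -
      have "compact (As \<inter> {p..q})" "p \<in> As \<inter> {p..q}" using cAs pAs pq by (auto intro: compact_Int_closed)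
      then obtain s where "s \<in> As \<inter> {p..q}" "\<forall>x\<in>As \<inter> {p..q}. x \<le> s"
        using compact_attains_sup by (metis empty_iff)
      then show thesis using that by auto
    qed
    have sq: "s < q" using s qAs by (metis order_le_less)
    have sV: "Pair 0 ` {s<..q} \<subseteq> V"
    proof (rule seg[of _ q])
      show "{s<..q} \<inter> As = {}" using s(2,4) by fastforce
      show "{s<..q} \<subseteq> {0..1}" using s(2) pq by auto
    qed (simp_all add: sq AV(8))
    have sC: "(0, s) \<in> C"
      using clos[OF sV, of s] sq s(1) AV(9) unfolding C_def As_def by auto
    have s01: "s \<in> {0..1}" using s(1) by (auto simp: As_def)
    have us: "u \<bullet> f s = c" using levC[of "(0,s)"] sC h0[OF s01] by (auto simp: C_def)
    have ps: "p < s" using us c s by (metis order_le_less less_irrefl)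
    define J where "J = h ` C"
    have compC: "compact C"
    proof -
      have "C = closure V \<inter> A" using AV(9,10) by (auto simp: C_def)
      then have "closed C" using AV(3) by auto
      then show ?thesis using CQ unit_square_facts(2) by (metis compact_Int_closed inf.absorb_iff2)
    qed
    have contC: "continuous_on C h" using h(1) CQ continuous_on_subset by blast
    have compJ: "compact J" unfolding J_def using compact_continuous_image[OF contC compC] .
    have conJ: "convex J"
      by (rule connected_line_subset_convex[OF u0, of _ c])
         (use levC AV(11) contC in \<open>auto simp: J_def C_def intro!: connected_continuous_image\<close>)
    have JX: "J \<subseteq> X" unfolding J_def using CQ h(2) by auto
    have J0: "J \<noteq> {}" using sC by (auto simp: J_def)
    define h' where "h' z = (if z \<in> V then h z else closest_point J (h z))" for z
    have h'cl: "h' z = h z" if "z \<in> closure V" for z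
      using that by (auto simp: h'_def J_def C_def closest_point_self)
    have h'J: "h' z \<in> J" if "z \<notin> V" for z
      using that compJ J0 by (simp add: h'_def closest_point_in_set compact_imp_closed)
    have conth': "continuous_on ?Q h'"
    proof -
      have "continuous_on (closure V \<union> (?Q - V)) (\<lambda>z. if z \<in> V then h z else closest_point J (h z))"
      proof (rule continuous_on_cases_local)
        show "closedin (top_of_set (closure V \<union> (?Q - V))) (closure V)" by (auto intro: closed_subset)
        have eq: "closure V \<union> (?Q - V) = ?Q" using clVQ closure_subset by blast
        show "closedin (top_of_set (closure V \<union> (?Q - V))) (?Q - V)"
          unfolding eq using AV(7) by auto
        show "continuous_on (closure V) h" using h(1) clVQ continuous_on_subset by blast
        show "continuous_on (?Q - V) (\<lambda>z. closest_point J (h z))"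
          by (intro continuous_on_compose2[OF continuous_on_closest_point[of J UNIV]])
             (use conJ compJ J0 h(1) in \<open>auto intro: compact_imp_closed continuous_on_subset\<close>)
        show "h z = closest_point J (h z)"
          if "z \<in> closure V \<and> z \<notin> V \<or> z \<in> ?Q - V \<and> z \<in> V" for z
          using that by (auto simp: J_def C_def closest_point_self)
      qed
      moreover have "closure V \<union> (?Q - V) = ?Q" using clVQ closure_subset by blast
      ultimately show ?thesis by (simp add: h'_def[abs_def])
    qed
    have h'X: "h' z \<in> X" if "z \<in> ?Q" for z
      using that h'J[of z] JX h(2) by (cases "z \<in> V") (auto simp: h'_def)
    \<comment> \<open>The points \<open>(0, s')\<close> and \<open>(0, t')\<close> divide the
      boundary of the square into the edge arc between them and the complementary arc through
      \<open>T3\<close>. In both alternatives of \<open>cas\<close>, one of these arcs lies in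
      \<open>closure V\<close> and the other misses \<open>V\<close>.\<close>
    have main: thesis if st: "0 \<le> s'" "s' < t'" "t' \<le> 1" "(p < s' \<and> s' < q) \<noteq> (p < t' \<and> t' < q)"
        "(0, s') \<in> C" "(0, t') \<in> C"
      and cas: "(\<forall>x. s' < x \<and> x < t' \<longrightarrow> (0,x) \<in> V) \<and> (\<forall>x. 0 \<le> x \<and> x < s' \<longrightarrow> (0,x) \<notin> V) \<and> (\<forall>x. t' < x \<and> x \<le> 1 \<longrightarrow> (0,x) \<notin> V) \<and> T3 \<inter> V = {}
        \<or> (\<forall>x. s' < x \<and> x < t' \<longrightarrow> (0,x) \<notin> V) \<and> (\<forall>x. 0 \<le> x \<and> x < s' \<longrightarrow> (0,x) \<in> V) \<and> (\<forall>x. t' < x \<and> x \<le> 1 \<longrightarrow> (0,x) \<in> V) \<and> T3 \<subseteq> V" for s' t'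
    proof -
      have st01: "s' \<in> {0..1}" "t' \<in> {0..1}" using st by auto
      have ust: "u \<bullet> f s' = c" "u \<bullet> f t' = c"
        using levC[of "(0,s')"] levC[of "(0,t')"] st(5,6) h0 st01 by (auto simp: C_def)
      have stJ: "f s' \<in> J" "f t' \<in> J" using st(5,6) h0[OF st01(1)] h0[OF st01(2)] by (auto simp: J_def image_iff) metis+
      then have segJ: "closed_segment (f s') (f t') \<subseteq> J" using conJ closed_segment_subset by blast
      define \<alpha> where "\<alpha> = linepath (0::real, s') (0, t')"
      define \<beta> where "\<beta> = linepath (0::real, s') (0, 0) +++ (linepath (0,0) (1,0) +++ linepath (1,0) (1,1::real) +++ linepath (1,1) (0,1)) +++ linepath (0,1) (0,t')"
      have pim\<alpha>: "path_image \<alpha> \<subseteq> Pair 0 ` {s'..t'}"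
        using st by (simp add: \<alpha>_def closed_segment_Pair_const closed_segment_eq_real_ivl)
      have pim\<beta>: "path_image \<beta> \<subseteq> Pair 0 ` {0..s'} \<union> T3 \<union> Pair 0 ` {t'..1}"
      proof -
        have "path_image \<beta> = closed_segment (0,s') (0,0) \<union> (closed_segment (0,0) (1,0) \<union> closed_segment (1,0) (1,1) \<union> closed_segment (1,1) (0,1)) \<union> closed_segment (0,1) (0,t')"
          unfolding \<beta>_def by (simp add: path_image_join Un_assoc)
        moreover have "closed_segment (0::real,s') (0,0) \<subseteq> Pair 0 ` {0..s'}"
          using st by (simp add: closed_segment_Pair_const closed_segment_eq_real_ivl)
        moreover have "closed_segment (0::real,1) (0,t') \<subseteq> Pair 0 ` {t'..1}"
          using st by (simp add: closed_segment_Pair_const closed_segment_eq_real_ivl)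
        moreover have "closed_segment (0::real,0::real) (1,0) \<subseteq> T3" "closed_segment (1::real,0::real) (1,1) \<subseteq> T3" "closed_segment (1::real,1::real) (0,1) \<subseteq> T3"
          by (auto simp: closed_segment_def T3_def)
        ultimately show ?thesis by blast
      qed
      have p\<alpha>: "path \<alpha>" "path_image \<alpha> \<subseteq> ?Q" using pim\<alpha> st by (auto simp: \<alpha>_def)
      have p\<beta>: "path \<beta>" "path_image \<beta> \<subseteq> ?Q" using pim\<beta> st T3Q by (auto simp: \<beta>_def)
      have ends: "pathstart \<alpha> = (0,s')" "pathfinish \<alpha> = (0,t')" "pathstart \<beta> = (0,s')" "pathfinish \<beta> = (0,t')"
        by (auto simp: \<alpha>_def \<beta>_def)
      have Q\<alpha>\<beta>: "homotopic_paths ?Q \<alpha> \<beta>"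
        by (rule homotopic_paths_in_convex[OF unit_square_facts(1)]) (use p\<alpha> p\<beta> ends in auto)
      have H: "homotopic_paths X (h \<circ> \<alpha>) (h \<circ> \<beta>)"
        using homotopic_paths_continuous_image[OF Q\<alpha>\<beta> h(1)] h(2) by blast
      have H': "homotopic_paths X (h' \<circ> \<alpha>) (h' \<circ> \<beta>)"
        using homotopic_paths_continuous_image[OF Q\<alpha>\<beta> conth'] h'X by blast
      have h's: "h' (0,s') = f s'" "h' (0,t') = f t'"
        using st(5,6) h0[OF st01(1)] h0[OF st01(2)] h'cl by (auto simp: C_def)
      have inV: "path_image \<beta> \<inter> V = {} \<and> path_image \<alpha> \<subseteq> closure V \<or> path_image \<alpha> \<inter> V = {} \<and> path_image \<beta> \<subseteq> closure V"
      proof -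
        have e: "(0,s') \<notin> V" "(0,t') \<notin> V" "(0,s') \<in> closure V" "(0,t') \<in> closure V" using st(5,6) by (auto simp: C_def)
        have i: "x \<in> {s'..t'} \<Longrightarrow> x = s' \<or> x = t' \<or> s' < x \<and> x < t'" "x \<in> {0..s'} \<Longrightarrow> x = s' \<or> 0 \<le> x \<and> x < s'"
          "x \<in> {t'..1} \<Longrightarrow> x = t' \<or> t' < x \<and> x \<le> 1" for x by auto
        have cV: "V \<subseteq> closure V" by (rule closure_subset)
        show ?thesis using cas
        proof
          assume a: "(\<forall>x. s' < x \<and> x < t' \<longrightarrow> (0,x) \<in> V) \<and> (\<forall>x. 0 \<le> x \<and> x < s' \<longrightarrow> (0,x) \<notin> V) \<and> (\<forall>x. t' < x \<and> x \<le> 1 \<longrightarrow> (0,x) \<notin> V) \<and> T3 \<inter> V = {}"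
          have "Pair 0 ` {s'..t'} \<subseteq> closure V" using a e(3,4) i(1) cV by blast
          then have "path_image \<alpha> \<subseteq> closure V" by (rule subset_trans[OF pim\<alpha>])
          moreover have "Pair 0 ` {0..s'} \<union> T3 \<union> Pair 0 ` {t'..1} \<subseteq> - V" using a e(1,2) i(2,3) by blast
          then have "path_image \<beta> \<subseteq> - V" by (rule subset_trans[OF pim\<beta>])
          ultimately show ?thesis by blast
        next
          assume a: "(\<forall>x. s' < x \<and> x < t' \<longrightarrow> (0,x) \<notin> V) \<and> (\<forall>x. 0 \<le> x \<and> x < s' \<longrightarrow> (0,x) \<in> V) \<and> (\<forall>x. t' < x \<and> x \<le> 1 \<longrightarrow> (0,x) \<in> V) \<and> T3 \<subseteq> V"
          have "Pair 0 ` {s'..t'} \<subseteq> - V" using a e(1,2) i(1) by blast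
          then have "path_image \<alpha> \<subseteq> - V" by (rule subset_trans[OF pim\<alpha>])
          moreover have "Pair 0 ` {0..s'} \<union> T3 \<union> Pair 0 ` {t'..1} \<subseteq> closure V" using a e(3,4) i(2,3) cV by blast
          then have "path_image \<beta> \<subseteq> closure V" by (rule subset_trans[OF pim\<beta>])
          ultimately show ?thesis by blast
        qed
      qed
      have pc: "path (h' \<circ> \<alpha>)" "path (h' \<circ> \<beta>)" "path (h \<circ> \<alpha>)"
        using H H' homotopic_paths_imp_path by blast+
      have toline: "homotopic_paths X g (linepath (f s') (f t'))"
        if "path g" "path_image g \<subseteq> J" "pathstart g = f s'" "pathfinish g = f t'" for g
        by (rule homotopic_paths_in_convex[OF conJ JX]) (use that segJ in auto)
      \<comment> \<open>\<open>h'\<close> agrees with \<open>h\<close> on the arc in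
        \<open>closure V\<close> and maps the other arc into the convex segment \<open>J\<close>,
        where it is homotopic to the chord. The two arcs are homotopic in the square, so
        \<open>h\<close> as well as \<open>h'\<close> maps them to homotopic paths.\<close>
      have "homotopic_paths X (h \<circ> \<alpha>) (linepath (f s') (f t'))"
        using inV
      proof
        assume a: "path_image \<beta> \<inter> V = {} \<and> path_image \<alpha> \<subseteq> closure V"
        have 1: "homotopic_paths X (h' \<circ> \<beta>) (linepath (f s') (f t'))"
          by (rule toline) (use pc a h'J ends h's in \<open>auto simp: path_image_compose pathstart_compose pathfinish_compose\<close>)
        have 2: "homotopic_paths X (h \<circ> \<alpha>) (h' \<circ> \<alpha>)"
        proof (rule homotopic_paths_eq[OF pc(3)])
          show "path_image (h \<circ> \<alpha>) \<subseteq> X" using p\<alpha> h(2) by (auto simp: path_image_compose)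
          fix x :: real assume "x \<in> {0..1}"
          then have "\<alpha> x \<in> closure V" using a unfolding path_image_def by blast
          then show "(h \<circ> \<alpha>) x = (h' \<circ> \<alpha>) x" using h'cl by simp
        qed
        show ?thesis using 1 2 H' homotopic_paths_trans by blast
      next
        assume a: "path_image \<alpha> \<inter> V = {} \<and> path_image \<beta> \<subseteq> closure V"
        have 1: "homotopic_paths X (h' \<circ> \<alpha>) (linepath (f s') (f t'))"
          by (rule toline) (use pc a h'J ends h's in \<open>auto simp: path_image_compose pathstart_compose pathfinish_compose\<close>)
        have 2: "homotopic_paths X (h \<circ> \<beta>) (h' \<circ> \<beta>)"
        proof (rule homotopic_paths_eq)
          show "path (h \<circ> \<beta>)" using H homotopic_paths_imp_path by blast
          show "path_image (h \<circ> \<beta>) \<subseteq> X" using p\<beta> h(2) by (auto simp: path_image_compose)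
          fix x :: real assume "x \<in> {0..1}"
          then have "\<beta> x \<in> closure V" using a unfolding path_image_def by blast
          then show "(h \<circ> \<beta>) x = (h' \<circ> \<beta>) x" using h'cl by simp
        qed
        show ?thesis using 1 2 H H' homotopic_paths_trans homotopic_paths_sym by blast
      qed
      moreover have "homotopic_paths X (h \<circ> \<alpha>) (subpath s' t' f)"
      proof (rule homotopic_paths_eq[OF pc(3)])
        show "path_image (h \<circ> \<alpha>) \<subseteq> X" using p\<alpha> h(2) by (auto simp: path_image_compose)
        fix x :: real assume x: "x \<in> {0..1}"
        have "\<alpha> x = (0, (t' - s') * x + s')" by (simp add: \<alpha>_def linepath_def algebra_simps)
        moreover have "\<alpha> x \<in> ?Q" using p\<alpha>(2) x by (auto simp: path_image_def)
        ultimately show "(h \<circ> \<alpha>) x = subpath s' t' f x" using h0 by (auto simp: subpath_def)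
      qed
      ultimately have "homotopic_paths X (subpath s' t' f) (linepath (f s') (f t'))"
        using homotopic_paths_trans homotopic_paths_sym by blast
      then show thesis using cutI[of s' t'] st ust segJ JX by auto
    qed
    show thesis
    \<comment> \<open>If the left edge meets \<open>A\<close> again after \<open>q\<close>, the
      first such time \<open>t\<close> ends the cut. Otherwise \<open>V\<close> contains the edge
      after \<open>s\<close> and, through \<open>T3\<close>, the corner \<open>(0,0)\<close>; then
      the cut runs from the first time in \<open>As\<close> to \<open>s\<close>.\<close>
    proof (cases "As \<inter> {q..1} = {}")
      case False
      then obtain t where t: "t \<in> As" "q \<le> t" "t \<le> 1" "\<And>x. x \<in> As \<Longrightarrow> q \<le> x \<Longrightarrow> x \<le> 1 \<Longrightarrow> t \<le> x"
      proof -
        have "compact (As \<inter> {q..1})" using cAs by (auto intro: compact_Int_closed)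
        then obtain t where "t \<in> As \<inter> {q..1}" "\<forall>x\<in>As \<inter> {q..1}. t \<le> x"
          using compact_attains_inf False by metis
        then show thesis using that by auto
      qed
      have tq: "q < t" using t qAs by (metis order_le_less)
      have tA: "(0,t) \<in> A" and sA: "(0,s) \<in> A" using t(1) s(1) by (auto simp: As_def)
      have tV: "Pair 0 ` {q..<t} \<subseteq> V"
      proof (rule seg[of _ q])
        show "{q..<t} \<inter> As = {}" using t(3,4) by fastforce
        show "{q..<t} \<subseteq> {0..1}" using t(3) pq by auto
      qed (simp_all add: tq AV(8))
      have tC: "(0, t) \<in> C"
        using clos[OF tV, of t] tq tA AV(9) unfolding C_def by auto
      have stV: "(0,x) \<in> V" if "s < x" "x < t" for x
        using sV tV that by (cases "x \<le> q") auto
      \<comment> \<open>A point of \<open>V\<close> before \<open>s\<close> or after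
        \<open>t\<close> would alternate with \<open>s\<close>, \<open>q\<close>, \<open>t\<close>
        between \<open>V\<close> and \<open>A\<close>, which interlacing forbids.\<close>
      have nV1: "(0,x) \<notin> V" if "x < s" for x
        using nc(2)[of x s q t] that sA tA AV(8) sq tq by auto
      have nV2: "(0,x) \<notin> V" if "t < x" for x
        using nc(1)[of s q t x] that sA tA AV(8) sq tq by auto
      have "T3 \<inter> V = {}"
      proof (rule ccontr)
        assume "T3 \<inter> V \<noteq> {}"
        then have "(0,1) \<in> V" using T3V T3cor by blast
        then show False using nV2[of 1] t(3) tA AV(9) by (cases "t = 1") auto
      qed
      then show thesis
        using main[of s t] s01 sq tq t(3) ps sC tC stV nV1 nV2 by auto
    next
      case True
      have V1: "Pair 0 ` {s<..1} \<subseteq> V"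
      proof (rule seg[of _ q])
        show "{s<..1} \<inter> As = {}"
        proof (rule ccontr)
          assume "{s<..1} \<inter> As \<noteq> {}"
          then obtain x where "s < x" "x \<le> 1" "x \<in> As" by auto
          then show False using True s(4)[of x] ps by (cases "x \<le> q") auto
        qed
      qed (use sq s01 pq AV(8) in auto)
      then have "(0,1) \<in> V" using sq pq by auto
      then have T3sub: "T3 \<subseteq> V" using T3V T3cor by blast
      then have V0: "(0,0) \<in> V" using T3cor by blast
      obtain t where t: "t \<in> As" "\<And>x. x \<in> As \<Longrightarrow> t \<le> x"
        using compact_attains_inf[OF cAs] pAs by auto
      have tA: "(0,t) \<in> A" and sA: "(0,s) \<in> A" using t(1) s(1) by (auto simp: As_def)
      have t0: "0 < t" using t(1) tA V0 AV(9) by (cases "t = 0") (auto simp: As_def)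
      have tp: "t \<le> p" using t pAs by auto
      have tV: "Pair 0 ` {0..<t} \<subseteq> V"
      proof (rule seg[of _ 0])
        show "{0..<t} \<inter> As = {}" using t(2) by fastforce
        show "{0..<t} \<subseteq> {0..1}" using tp pq by auto
      qed (simp_all add: t0 V0)
      have tC: "(0, t) \<in> C"
        using clos[OF tV, of t] t0 tA AV(9) unfolding C_def by auto
      have "(0,x) \<notin> V" if "t < x" "x < s" for x
        using nc(1)[of t x s q] that sA tA AV(8) sq by auto
      moreover have "\<forall>x. 0 \<le> x \<and> x < t \<longrightarrow> (0,x) \<in> V" "\<forall>x. s < x \<and> x \<le> 1 \<longrightarrow> (0,x) \<in> V"
        using tV V1 by (auto simp: image_subset_iff)
      ultimately show thesis
        using main[of t s] s01 sq t0 tp ps sC tC T3sub by auto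
    qed
  qed
qed

lemma null_loop_cut:
  fixes X :: "(real^2) set"
  assumes hom: "homotopic_paths X f (linepath (f 0) (f 0))"
    and pq: "0 \<le> p" "p < q" "q \<le> 1" and c: "u \<bullet> f p < c \<and> c < u \<bullet> f q \<or> u \<bullet> f q < c \<and> c < u \<bullet> f p"
  obtains s t where "0 \<le> s" "s < t" "t \<le> 1" "(p < s \<and> s < q) \<noteq> (p < t \<and> t < q)"
    "u \<bullet> f s = c" "u \<bullet> f t = c" "closed_segment (f s) (f t) \<subseteq> X"
    "homotopic_paths X (subpath s t f) (linepath (f s) (f t))"
  using c
proof
  assume "u \<bullet> f p < c \<and> c < u \<bullet> f q"
  then show thesis using null_loop_cut_aux[OF hom pq, of u c] that by blast
next
  assume "u \<bullet> f q < c \<and> c < u \<bullet> f p"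
  then show thesis using null_loop_cut_aux[OF hom pq, of "-u" "-c"] that by auto
qed

section \<open>Uniform limits of null-homotopic loops\<close>

definition clamp01 :: "real \<Rightarrow> real" where
  "clamp01 y = max 0 (min 1 y)"

text \<open>The path \<^term>\<open>f\<close> with its restriction to the interval from \<^term>\<open>s\<close> to \<^term>\<open>t\<close>
  replaced by the chord; the formula avoids case distinctions, so that it is visibly continuous
  in all its arguments.\<close>
definition chord_splice :: "(real \<Rightarrow> 'a::real_normed_vector) \<Rightarrow> real \<Rightarrow> real \<Rightarrow> real \<Rightarrow> 'a" where
  "chord_splice f s t x = f (min x s) + (f (max x t) - f t) + clamp01 ((x - s) / (t - s)) *\<^sub>R (f t - f s)"

definition chord_loop :: "(real \<Rightarrow> 'a::real_normed_vector) \<Rightarrow> real \<Rightarrow> real \<Rightarrow> real \<Rightarrow> 'a" where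
  "chord_loop f s t = subpath s t f +++ linepath (f t) (f s)"

abbreviation null_loop :: "'a::real_normed_vector set \<Rightarrow> (real \<Rightarrow> 'a) \<Rightarrow> bool" where
  "null_loop X f \<equiv> homotopic_paths X f (linepath (f 0) (f 0))"

lemma clamp01_bounds [simp]: "0 \<le> clamp01 y" "clamp01 y \<le> 1"
  by (auto simp: clamp01_def)

lemma clamp01_id: "0 \<le> y \<Longrightarrow> y \<le> 1 \<Longrightarrow> clamp01 y = y"
  by (auto simp: clamp01_def)

lemma clamp01_lipschitz: "\<bar>clamp01 x - clamp01 y\<bar> \<le> \<bar>x - y\<bar>"
  by (auto simp: clamp01_def)

lemma continuous_on_clamp01 [continuous_intros]:
  "continuous_on S g \<Longrightarrow> continuous_on S (\<lambda>x. clamp01 (g x))"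
  unfolding clamp01_def by (intro continuous_intros)

lemma chord_splice_outside:
  assumes "s < t" "x \<le> s \<or> t \<le> x"
  shows "chord_splice f s t x = f x"
proof (cases "x \<le> s")
  case True
  then have "(x - s) / (t - s) \<le> 0" using assms by (intro divide_nonpos_pos) auto
  then have "clamp01 ((x - s) / (t - s)) = 0" by (simp add: clamp01_def)
  then show ?thesis using True assms by (simp add: chord_splice_def min_def max_def)
next
  case False
  then have "clamp01 ((x - s) / (t - s)) = 1" using assms by (auto simp: clamp01_def field_simps min_def max_def)
  then show ?thesis using False assms by (simp add: chord_splice_def min_def max_def)
qed

lemma chord_splice_inside:
  assumes "s < t" "s \<le> x" "x \<le> t"
  shows "chord_splice f s t x = linepath (f s) (f t) ((x - s) / (t - s))"
proof -
  have "clamp01 ((x - s) / (t - s)) = (x - s) / (t - s)"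
    by (rule clamp01_id) (use assms in \<open>auto simp: field_simps\<close>)
  then show ?thesis using assms by (simp add: chord_splice_def linepath_def min_def max_def algebra_simps)
qed

lemma chord_splice_cases:
  assumes "s < t" "x \<in> {0..1}"
  obtains "chord_splice f s t x = f x" | "x \<in> {s..t}" "chord_splice f s t x \<in> closed_segment (f s) (f t)"
proof (cases "x \<le> s \<or> t \<le> x")
  case False
  then have "(x - s) / (t - s) \<in> {0..1}" using assms by (auto simp: field_simps)
  then have "chord_splice f s t x \<in> closed_segment (f s) (f t)"
    using chord_splice_inside[of s t x f] assms False linepath_in_path by fastforce
  then show ?thesis using that(2) False by auto
qed (use chord_splice_outside assms that in blast)

lemma chord_splice_in_convex:
  assumes "convex C" "f ` {0..1} \<subseteq> C" "0 \<le> s" "s < t" "t \<le> 1"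
  shows "chord_splice f s t ` {0..1} \<subseteq> C"
proof
  fix y assume "y \<in> chord_splice f s t ` {0..1}"
  then obtain x where x: "x \<in> {0..1}" "y = chord_splice f s t x" by auto
  have "f s \<in> C" "f t \<in> C" using assms by auto
  then have "closed_segment (f s) (f t) \<subseteq> C" using assms(1) closed_segment_subset by blast
  then show "y \<in> C"
    by (rule_tac chord_splice_cases[OF assms(4) x(1), of f]) (use x assms(2) in auto)
qed

lemma chord_loop_first:
  "x \<le> 1/2 \<Longrightarrow> chord_loop f s t x = f (s + 2 * x * (t - s))"
  by (simp add: chord_loop_def joinpaths_def subpath_def algebra_simps)

lemma chord_loop_second:
  assumes "1/2 \<le> x"
  shows "chord_loop f s t x = linepath (f t) (f s) (2 * x - 1)"
proof (cases "x = 1/2")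
  case True
  have "chord_loop f s t (1/2) = linepath (f t) (f s) (2 * (1/2) - 1)"
    by (simp add: chord_loop_def joinpaths_def subpath_def linepath_def)
  then show ?thesis unfolding True .
qed (use assms in \<open>simp add: chord_loop_def joinpaths_def\<close>)

lemma chord_loop_ends: "chord_loop f s t 0 = f s" "chord_loop f s t 1 = f s" "chord_loop f s t (1/2) = f t"
  by (simp_all add: chord_loop_first chord_loop_second linepath_def)

lemma chord_loop_in_convex:
  assumes "convex C" "f ` {0..1} \<subseteq> C" "0 \<le> s" "s < t" "t \<le> 1"
  shows "chord_loop f s t ` {0..1} \<subseteq> C"
proof
  fix y assume "y \<in> chord_loop f s t ` {0..1}"
  then obtain x where x: "x \<in> {0..1}" "y = chord_loop f s t x" by auto
  have "f s \<in> C" "f t \<in> C" using assms by auto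
  then have seg: "closed_segment (f t) (f s) \<subseteq> C" using assms(1) closed_segment_subset by blast
  show "y \<in> C"
  proof (cases "x \<le> 1/2")
    case True
    define y where "y = 2 * x * (t - s)"
    have "2 * x * (t - s) \<le> 1 * (t - s)" by (rule mult_right_mono) (use True assms in auto)
    then have "y \<le> t - s" by (simp add: y_def)
    moreover have "0 \<le> y" unfolding y_def using x(1) assms(4) by simp
    ultimately have "0 \<le> s + y" "s + y \<le> 1" using assms(3,5) by linarith+
    then have "s + 2 * x * (t - s) \<in> {0..1}" by (simp add: y_def)
    then show ?thesis using chord_loop_first[OF True, of f s t] x assms(2) by (metis image_subset_iff)
  next
    case False
    then have "linepath (f t) (f s) (2 * x - 1) \<in> closed_segment (f t) (f s)"
      using x by (intro linepath_in_path) auto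
    then show ?thesis using chord_loop_second[of x f s t] False x seg by auto
  qed
qed

lemma homotopic_paths_replace_subpath:
  assumes f: "path f" "path_image f \<subseteq> X" and g: "path g" "path_image g \<subseteq> X"
    and st: "0 \<le> s" "s \<le> t" "t \<le> 1"
    and eq: "\<And>x. 0 \<le> x \<Longrightarrow> x \<le> s \<Longrightarrow> g x = f x" "\<And>x. t \<le> x \<Longrightarrow> x \<le> 1 \<Longrightarrow> g x = f x"
    and hom: "homotopic_paths X (subpath s t f) (subpath s t g)"
  shows "homotopic_paths X f g"
proof -
  have st': "0 \<in> {0..1::real}" "s \<in> {0..1}" "t \<in> {0..1}" "1 \<in> {0..1::real}" using st by auto
  have dec: "homotopic_paths X ((subpath 0 s k +++ subpath s t k) +++ subpath t 1 k) k"
    if "path k" "path_image k \<subseteq> X" for k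
  proof -
    have "homotopic_paths X ((subpath 0 s k +++ subpath s t k) +++ subpath t 1 k) (subpath 0 t k +++ subpath t 1 k)"
    proof (rule homotopic_paths_join)
      show "homotopic_paths X (subpath 0 s k +++ subpath s t k) (subpath 0 t k)"
        using homotopic_join_subpaths[OF that st'(1,2,3)] .
      show "homotopic_paths X (subpath t 1 k) (subpath t 1 k)"
        using path_subpath[OF that(1) st'(3,4)] path_image_subpath_subset[OF st'(3,4)] that(2)
        unfolding homotopic_paths_refl by blast
    qed (simp add: pathfinish_def pathstart_def subpath_def joinpaths_def)
    also have "homotopic_paths X \<dots> (subpath 0 1 k)"
      using homotopic_join_subpaths[OF that st'(1,3,4)] .
    finally show ?thesis by simp
  qed
  have e1: "homotopic_paths X (subpath 0 s f) (subpath 0 s g)"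
  proof (rule homotopic_paths_eq)
    show "path (subpath 0 s f)" using f st' path_subpath by blast
    show "path_image (subpath 0 s f) \<subseteq> X" using f st' path_image_subpath_subset by (metis order_trans)
    fix x :: real assume "x \<in> {0..1}"
    then have "0 \<le> s * x" "s * x \<le> s" using st by (auto simp: mult_left_le)
    then show "subpath 0 s f x = subpath 0 s g x" using eq(1) by (simp add: subpath_def)
  qed
  have e2: "homotopic_paths X (subpath t 1 f) (subpath t 1 g)"
  proof (rule homotopic_paths_eq)
    show "path (subpath t 1 f)" using f st' path_subpath by blast
    show "path_image (subpath t 1 f) \<subseteq> X" using f st' path_image_subpath_subset by (metis order_trans)
    fix x :: real assume "x \<in> {0..1}"
    then have "0 \<le> (1 - t) * x" "(1 - t) * x \<le> 1 - t" using st by (auto simp: mult_left_le)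
    then show "subpath t 1 f x = subpath t 1 g x" using eq(2) by (simp add: subpath_def)
  qed
  have "homotopic_paths X ((subpath 0 s f +++ subpath s t f) +++ subpath t 1 f) ((subpath 0 s g +++ subpath s t g) +++ subpath t 1 g)"
    by (intro homotopic_paths_join e1 e2 hom) (simp_all add: pathfinish_def pathstart_def subpath_def joinpaths_def)
  then show ?thesis
    using dec[OF f] dec[OF g] homotopic_paths_trans homotopic_paths_sym by blast
qed

lemma path_chord_splice:
  assumes "path f" "0 \<le> s" "s < t" "t \<le> 1"
  shows "path (chord_splice f s t)"
  unfolding path_def chord_splice_def[abs_def]
proof (intro continuous_intros)
  have c: "continuous_on {0..1} f" using assms by (simp add: path_def)
  show "continuous_on {0..1} (\<lambda>x. f (min x s))" "continuous_on {0..1} (\<lambda>x. f (max x t))"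
    by (rule continuous_on_compose2[OF c]; use assms in \<open>auto intro!: continuous_intros\<close>)+
qed (use assms in auto)

lemma chord_splice_image:
  assumes "f ` {0..1} \<subseteq> X" "s < t" "closed_segment (f s) (f t) \<subseteq> X"
  shows "chord_splice f s t ` {0..1} \<subseteq> X"
proof
  fix y assume "y \<in> chord_splice f s t ` {0..1}"
  then obtain x where x: "x \<in> {0..1}" "y = chord_splice f s t x" by auto
  show "y \<in> X"
    by (rule chord_splice_cases[OF assms(2) x(1), of f]) (use x assms in auto)
qed

lemma homotopic_chord_splice:
  assumes f: "path f" "path_image f \<subseteq> X" and st: "0 \<le> s" "s < t" "t \<le> 1"
    and seg: "closed_segment (f s) (f t) \<subseteq> X"
    and hom: "homotopic_paths X (subpath s t f) (linepath (f s) (f t))"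
  shows "homotopic_paths X f (chord_splice f s t)"
proof (rule homotopic_paths_replace_subpath[OF f])
  show "path (chord_splice f s t)" by (rule path_chord_splice[OF f(1) st])
  show "path_image (chord_splice f s t) \<subseteq> X"
    using chord_splice_image[OF _ st(2) seg] f(2) by (simp add: path_image_def)
  have "homotopic_paths X (linepath (f s) (f t)) (subpath s t (chord_splice f s t))"
  proof (rule homotopic_paths_eq)
    fix x :: real assume x: "x \<in> {0..1}"
    have "0 \<le> (t - s) * x" using x st by simp
    moreover have "(t - s) * x \<le> (t - s) * 1" by (rule mult_left_mono) (use x st in auto)
    ultimately have "s \<le> (t - s) * x + s" "(t - s) * x + s \<le> t" by simp_all
    then have "chord_splice f s t ((t - s) * x + s) = linepath (f s) (f t) (((t - s) * x + s - s) / (t - s))"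
      by (rule chord_splice_inside[OF st(2)])
    then show "linepath (f s) (f t) x = subpath s t (chord_splice f s t) x"
      using st by (simp add: subpath_def)
  qed (use seg in auto)
  then show "homotopic_paths X (subpath s t f) (subpath s t (chord_splice f s t))"
    using hom homotopic_paths_trans by blast
qed (use st chord_splice_outside in auto)

lemma null_loop_chord_splice:
  assumes f: "null_loop X f" and st: "0 \<le> s" "s < t" "t \<le> 1"
    and seg: "closed_segment (f s) (f t) \<subseteq> X"
    and hom: "homotopic_paths X (subpath s t f) (linepath (f s) (f t))"
  shows "null_loop X (chord_splice f s t)"
proof -
  have "homotopic_paths X f (chord_splice f s t)"
    using homotopic_chord_splice[OF homotopic_paths_imp_path[OF f, THEN conjunct1] homotopic_paths_imp_subset[OF f, THEN conjunct1] st seg hom] .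
  moreover have "chord_splice f s t 0 = f 0" using st by (intro chord_splice_outside) auto
  ultimately show ?thesis using f homotopic_paths_trans homotopic_paths_sym by metis
qed

lemma null_loop_chord_loop:
  assumes seg: "closed_segment (f s) (f t) \<subseteq> X"
    and hom: "homotopic_paths X (subpath s t f) (linepath (f s) (f t))"
  shows "null_loop X (chord_loop f s t)"
proof -
  have "homotopic_paths X (chord_loop f s t) (linepath (f s) (f t) +++ linepath (f t) (f s))"
    unfolding chord_loop_def
    by (rule homotopic_paths_join[OF hom]) (use seg in \<open>auto simp: closed_segment_commute\<close>)
  also have "homotopic_paths X \<dots> (linepath (f s) (f s))"
    using homotopic_paths_rinv[of "linepath (f s) (f t)" X] seg by simp
  finally show ?thesis by (simp add: chord_loop_ends)
qed

section \<open>Convergence of cut loops when the loops and the cut times vary together\<close>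

lemma uniform_limit_compose_both:
  fixes f :: "'a::metric_space \<Rightarrow> 'b::metric_space"
  assumes F: "uniform_limit S F f sequentially" and f: "continuous_on S f" "compact S"
    and G: "uniform_limit T G g sequentially" and GS: "\<And>n x. x \<in> T \<Longrightarrow> G n x \<in> S" "\<And>x. x \<in> T \<Longrightarrow> g x \<in> S"
  shows "uniform_limit T (\<lambda>n x. F n (G n x)) (\<lambda>x. f (g x)) sequentially"
proof (rule uniform_limitI)
  fix e :: real assume e: "0 < e"
  obtain d where d: "d > 0" "\<And>x y. x \<in> S \<Longrightarrow> y \<in> S \<Longrightarrow> dist x y < d \<Longrightarrow> dist (f x) (f y) < e/2"
    using compact_uniformly_continuous[OF f] e unfolding uniformly_continuous_on_def
    by (metis half_gt_zero)
  have "\<forall>\<^sub>F n in sequentially. \<forall>x\<in>S. dist (F n x) (f x) < e/2" using uniform_limitD[OF F half_gt_zero[OF e]] .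
  moreover have "\<forall>\<^sub>F n in sequentially. \<forall>x\<in>T. dist (G n x) (g x) < d" using uniform_limitD[OF G d(1)] .
  ultimately show "\<forall>\<^sub>F n in sequentially. \<forall>x\<in>T. dist (F n (G n x)) (f (g x)) < e"
  proof eventually_elim
    case (elim n)
    show ?case
    proof
      fix x assume x: "x \<in> T"
      have "dist (F n (G n x)) (f (G n x)) < e/2" "dist (f (G n x)) (f (g x)) < e/2"
        using elim x GS d(2) by auto
      then show "dist (F n (G n x)) (f (g x)) < e"
        using dist_triangle[of "F n (G n x)" "f (g x)" "f (G n x)"] by simp
    qed
  qed
qed

lemma uniform_limit_dominated:
  fixes f :: "'a \<Rightarrow> 'b::metric_space"
  assumes "\<And>n x. x \<in> S \<Longrightarrow> dist (F n x) (f x) \<le> b n" "b \<longlonglongrightarrow> (0::real)"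
  shows "uniform_limit S F f sequentially"
proof (rule uniform_limitI)
  fix e :: real assume "0 < e"
  then have "\<forall>\<^sub>F n in sequentially. b n < e" using assms(2) by (rule order_tendstoD(2)[rotated])
  then show "\<forall>\<^sub>F n in sequentially. \<forall>x\<in>S. dist (F n x) (f x) < e"
    by eventually_elim (use assms(1) le_less_trans in blast)
qed

lemma uniform_limit_affine:
  fixes a b :: "nat \<Rightarrow> 'a::real_normed_vector"
  assumes "a \<longlonglongrightarrow> a0" "b \<longlonglongrightarrow> b0"
  shows "uniform_limit {0..1} (\<lambda>n x. x *\<^sub>R a n + b n) (\<lambda>x. x *\<^sub>R a0 + b0) sequentially"
proof (rule uniform_limit_dominated)
  show "dist (x *\<^sub>R a n + b n) (x *\<^sub>R a0 + b0) \<le> norm (a n - a0) + norm (b n - b0)" if "x \<in> {0..1}" for n x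
  proof -
    have "x *\<^sub>R a n + b n - (x *\<^sub>R a0 + b0) = x *\<^sub>R (a n - a0) + (b n - b0)" by (simp add: algebra_simps)
    then have "dist (x *\<^sub>R a n + b n) (x *\<^sub>R a0 + b0) \<le> norm (x *\<^sub>R (a n - a0)) + norm (b n - b0)"
      unfolding dist_norm by (metis norm_triangle_ineq)
    also have "norm (x *\<^sub>R (a n - a0)) \<le> norm (a n - a0)" using that by (simp add: mult_left_le_one_le)
    finally show ?thesis by simp
  qed
  have "(\<lambda>n. norm (a n - a0) + norm (b n - b0)) \<longlonglongrightarrow> norm (a0 - a0) + norm (b0 - b0)"
    by (intro tendsto_intros assms)
  then show "(\<lambda>n. norm (a n - a0) + norm (b n - b0)) \<longlonglongrightarrow> 0" by simp
qed

lemma uniform_limit_joinpaths: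
  assumes "uniform_limit {0..1} F f sequentially" "uniform_limit {0..1} G g sequentially"
  shows "uniform_limit {0..1} (\<lambda>n. F n +++ G n) (f +++ g) sequentially"
proof (rule uniform_limitI)
  fix e :: real assume e: "0 < e"
  have "\<forall>\<^sub>F n in sequentially. \<forall>x\<in>{0..1}. dist (F n x) (f x) < e"
    "\<forall>\<^sub>F n in sequentially. \<forall>x\<in>{0..1}. dist (G n x) (g x) < e"
    using uniform_limitD[OF assms(1)] uniform_limitD[OF assms(2)] e by auto
  then show "\<forall>\<^sub>F n in sequentially. \<forall>x\<in>{0..1}. dist ((F n +++ G n) x) ((f +++ g) x) < e"
    by eventually_elim (auto simp: joinpaths_def)
qed

context
  fixes F :: "nat \<Rightarrow> real \<Rightarrow> 'a::real_normed_vector" and f :: "real \<Rightarrow> 'a"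
    and S T :: "nat \<Rightarrow> real" and s t :: real
  assumes F: "uniform_limit {0..1} F f sequentially" and f: "continuous_on {0..1} f"
    and S: "S \<longlonglongrightarrow> s" "\<And>n. S n \<in> {0..1}" and T: "T \<longlonglongrightarrow> t" "\<And>n. T n \<in> {0..1}"
    and st: "s \<in> {0..1}" "t \<in> {0..1}"
begin

lemma tendsto_along: "(\<lambda>n. F n (S n)) \<longlonglongrightarrow> f s"
  \<comment> \<open>A pointwise limit is a uniform limit on a one-point domain.\<close>
  using uniform_limit_compose_both[OF F f compact_Icc, where T = "{0::real}" and G = "\<lambda>n x. S n" and g = "\<lambda>x. s"] S st by simp

lemma tendsto_along': "(\<lambda>n. F n (T n)) \<longlonglongrightarrow> f t"
  using uniform_limit_compose_both[OF F f compact_Icc, where T = "{0::real}" and G = "\<lambda>n x. T n" and g = "\<lambda>x. t"] T st by simp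

lemma uniform_limit_subpath:
  "uniform_limit {0..1} (\<lambda>n. subpath (S n) (T n) (F n)) (subpath s t f) sequentially"
  unfolding subpath_def[abs_def]
proof (rule uniform_limit_compose_both[OF F f compact_Icc])
  have "(\<lambda>n. T n - S n) \<longlonglongrightarrow> t - s" by (intro tendsto_intros S T)
  from uniform_limit_affine[OF this S(1)]
  show "uniform_limit {0..1} (\<lambda>n x. (T n - S n) * x + S n) (\<lambda>x. (t - s) * x + s) sequentially"
    by (simp add: mult.commute)
  have *: "(b - a) * x + a \<in> {0..1}" if "a \<in> {0..1}" "b \<in> {0..1}" "x \<in> {0..1}" for a b x :: real
  proof -
    have "(b - a) * x + a \<in> closed_segment a b"
      using that by (auto simp: closed_segment_def intro!: exI[of _ x] simp: algebra_simps)
    moreover have "closed_segment a b \<subseteq> {0..1}" using that by (intro closed_segment_subset) auto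
    ultimately show ?thesis by blast
  qed
  show "\<And>n x. x \<in> {0..1} \<Longrightarrow> (T n - S n) * x + S n \<in> {0..1}" using * S T by blast
  show "\<And>x. x \<in> {0..1} \<Longrightarrow> (t - s) * x + s \<in> {0..1}" using * st by blast
qed

lemma uniform_limit_linepath_chord:
  "uniform_limit {0..1} (\<lambda>n. linepath (F n (T n)) (F n (S n))) (linepath (f t) (f s)) sequentially"
proof -
  have "uniform_limit {0..1} (\<lambda>n x. x *\<^sub>R (F n (S n) - F n (T n)) + F n (T n)) (\<lambda>x. x *\<^sub>R (f s - f t) + f t) sequentially"
    by (intro uniform_limit_affine tendsto_intros tendsto_along tendsto_along')
  then show ?thesis by (simp add: linepath_def[abs_def] algebra_simps)
qed

lemma uniform_limit_chord_loop:
  "uniform_limit {0..1} (\<lambda>n. chord_loop (F n) (S n) (T n)) (chord_loop f s t) sequentially"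
  unfolding chord_loop_def by (intro uniform_limit_joinpaths uniform_limit_subpath uniform_limit_linepath_chord)

lemma uniform_limit_chord_splice:
  assumes "s < t"
  shows "uniform_limit {0..1} (\<lambda>n. chord_splice (F n) (S n) (T n)) (chord_splice f s t) sequentially"
proof -
  have z: "(\<lambda>n. \<bar>S n - s\<bar>) \<longlonglongrightarrow> 0" "(\<lambda>n. \<bar>T n - t\<bar>) \<longlonglongrightarrow> 0"
    using S(1) T(1) by (simp_all add: LIM_zero tendsto_rabs_zero)
  have 1: "uniform_limit {0..1} (\<lambda>n x. F n (min x (S n))) (\<lambda>x. f (min x s)) sequentially"
    by (rule uniform_limit_compose_both[OF F f compact_Icc uniform_limit_dominated[OF _ z(1)]])
       (use S st in \<open>auto simp: dist_real_def min_def\<close>)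
  have 2: "uniform_limit {0..1} (\<lambda>n x. F n (max x (T n))) (\<lambda>x. f (max x t)) sequentially"
    by (rule uniform_limit_compose_both[OF F f compact_Icc uniform_limit_dominated[OF _ z(2)]])
       (use T st in \<open>auto simp: dist_real_def max_def\<close>)
  have c: "uniform_limit {0..1} (\<lambda>n x. c n) (\<lambda>x. d) sequentially" if "c \<longlonglongrightarrow> d" for c :: "nat \<Rightarrow> 'a" and d
    using tendstoD[OF that] by (simp add: uniform_limit_iff)
  have 3: "uniform_limit {0..1} (\<lambda>n x. clamp01 ((x - S n) / (T n - S n))) (\<lambda>x. clamp01 ((x - s) / (t - s))) sequentially"
  proof (rule uniform_limit_dominated)
    let ?a = "\<lambda>n. 1 / (T n - S n)" and ?b = "\<lambda>n. - S n / (T n - S n)"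
    have a: "?a \<longlonglongrightarrow> 1 / (t - s)" by (intro tendsto_intros S T) (use assms in auto)
    have b: "?b \<longlonglongrightarrow> - s / (t - s)" by (intro tendsto_intros S T) (use assms in auto)
    show "(\<lambda>n. \<bar>?a n - 1 / (t - s)\<bar> + \<bar>?b n - (- s / (t - s))\<bar>) \<longlonglongrightarrow> 0"
      using tendsto_add[OF tendsto_rabs_zero[OF LIM_zero[OF a]] tendsto_rabs_zero[OF LIM_zero[OF b]]] by simp
    fix n and x :: real assume x: "x \<in> {0..1}"
    have "dist (clamp01 ((x - S n) / (T n - S n))) (clamp01 ((x - s) / (t - s))) \<le> \<bar>(x - S n) / (T n - S n) - (x - s) / (t - s)\<bar>"
      unfolding dist_real_def by (rule clamp01_lipschitz)
    also have "\<dots> = \<bar>x * (?a n - 1 / (t - s)) + (?b n - (- s / (t - s)))\<bar>"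
      by (rule arg_cong[where f = abs]) (simp add: diff_divide_distrib algebra_simps)
    also have "\<dots> \<le> \<bar>x * (?a n - 1 / (t - s))\<bar> + \<bar>?b n - (- s / (t - s))\<bar>" by (rule abs_triangle_ineq)
    also have "\<bar>x * (?a n - 1 / (t - s))\<bar> \<le> \<bar>?a n - 1 / (t - s)\<bar>"
      using x by (simp add: abs_mult mult_left_le_one_le)
    finally show "dist (clamp01 ((x - S n) / (T n - S n))) (clamp01 ((x - s) / (t - s))) \<le> \<bar>?a n - 1 / (t - s)\<bar> + \<bar>?b n - (- s / (t - s))\<bar>"
      by simp
  qed
  have 4: "uniform_limit {0..1} (\<lambda>n x. clamp01 ((x - S n) / (T n - S n)) *\<^sub>R (F n (T n) - F n (S n)))
      (\<lambda>x. clamp01 ((x - s) / (t - s)) *\<^sub>R (f t - f s)) sequentially"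
  proof (rule bounded_bilinear.bounded_uniform_limit[OF bounded_bilinear_scaleR 3 c])
    show "(\<lambda>n. F n (T n) - F n (S n)) \<longlonglongrightarrow> f t - f s"
      by (intro tendsto_intros tendsto_along tendsto_along')
    show "bounded ((\<lambda>x. f t - f s) ` {0..1::real})" by (rule boundedI[of _ "norm (f t - f s)"]) auto
    show "bounded ((\<lambda>x. clamp01 ((x - s) / (t - s))) ` {0..1})" by (rule boundedI[of _ 1]) auto
  qed
  show ?thesis
    unfolding chord_splice_def[abs_def]
    by (intro uniform_limit_add uniform_limit_minus 1 2 4 c tendsto_along')
qed

end

text \<open>Cutting is carried out on uniform limits from the start, since nothing is known yet
  about a homotopy of the limit loop. The pieces of a limit cut are limits of the pieces of the
  approximating cuts, so the class is preserved.\<close>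

definition limit_null :: "'a::real_normed_vector set \<Rightarrow> (real \<Rightarrow> 'a) \<Rightarrow> bool" where
  "limit_null X f \<longleftrightarrow> (\<exists>F. (\<forall>n. null_loop X (F n)) \<and> uniform_limit {0..1} F f sequentially)"

lemma limit_null_facts:
  assumes "limit_null X f" "closed X"
  shows "continuous_on {0..1} f" "f ` {0..1} \<subseteq> X" "f 1 = f 0"
proof -
  obtain F where F: "\<And>n. null_loop X (F n)" "uniform_limit {0..1} F f sequentially"
    using assms(1) by (auto simp: limit_null_def)
  have p: "continuous_on {0..1} (F n)" "F n ` {0..1} \<subseteq> X" "F n 1 = F n 0" for n
    using homotopic_paths_imp_path[OF F(1)[of n]] homotopic_paths_imp_subset[OF F(1)[of n]]
      homotopic_paths_imp_pathfinish[OF F(1)[of n]]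
    by (auto simp: path_def path_image_def pathfinish_def)
  show "continuous_on {0..1} f"
    by (rule uniform_limit_theorem[OF _ F(2)]) (use p in auto)
  have lim: "(\<lambda>n. F n x) \<longlonglongrightarrow> f x" if "x \<in> {0..1}" for x
    using tendsto_uniform_limitI[OF F(2) that] .
  show "f ` {0..1} \<subseteq> X"
  proof
    fix y assume "y \<in> f ` {0..1}"
    then obtain x where x: "x \<in> {0..1}" "y = f x" by auto
    have "f x \<in> X" by (rule closed_sequentially[OF assms(2) _ lim[OF x(1)]]) (use p(2) x(1) in blast)
    then show "y \<in> X" using x by simp
  qed
  have "(\<lambda>n. F n 0) \<longlonglongrightarrow> f 1" using lim[of 1] p(3) by simp
  then show "f 1 = f 0" using lim[of 0] LIMSEQ_unique by auto
qed

text \<open>Cuts of the approximating loops accumulate at a cut of the limit. It does not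
  degenerate: its ends lie on the line while \<open>f p\<close> and \<open>f q\<close> do not, so
  one of the times \<open>p\<close>, \<open>q\<close> remains strictly between the cut
  times.\<close>

lemma limit_null_cut:
  fixes X :: "(real^2) set"
  assumes X: "closed X" and f: "limit_null X f"
    and pq: "0 \<le> p" "p < q" "q \<le> 1" and c: "u \<bullet> f p < c \<and> c < u \<bullet> f q \<or> u \<bullet> f q < c \<and> c < u \<bullet> f p"
  obtains s t where "0 \<le> s" "s < t" "t \<le> 1" "p < s \<and> s < q \<and> q < t \<or> s < p \<and> p < t \<and> t < q"
    "u \<bullet> f s = c" "u \<bullet> f t = c" "limit_null X (chord_splice f s t)" "limit_null X (chord_loop f s t)"
    "closed_segment (f s) (f t) \<subseteq> X"
proof -
  obtain F where F: "\<And>n. null_loop X (F n)" "uniform_limit {0..1} F f sequentially"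
    using f by (auto simp: limit_null_def)
  note cf = limit_null_facts(1)[OF f X]
  have lim: "(\<lambda>n. u \<bullet> F n x) \<longlonglongrightarrow> u \<bullet> f x" if "x \<in> {0..1}" for x
    by (intro tendsto_intros tendsto_uniform_limitI[OF F(2) that])
  have "\<forall>\<^sub>F n in sequentially. u \<bullet> F n p < c \<and> c < u \<bullet> F n q \<or> u \<bullet> F n q < c \<and> c < u \<bullet> F n p"
    using c
  proof
    assume "u \<bullet> f p < c \<and> c < u \<bullet> f q"
    then have "\<forall>\<^sub>F n in sequentially. u \<bullet> F n p < c" "\<forall>\<^sub>F n in sequentially. c < u \<bullet> F n q"
      using order_tendstoD[OF lim] pq by auto
    then show ?thesis by eventually_elim auto
  next
    assume "u \<bullet> f q < c \<and> c < u \<bullet> f p"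
    then have "\<forall>\<^sub>F n in sequentially. u \<bullet> F n q < c" "\<forall>\<^sub>F n in sequentially. c < u \<bullet> F n p"
      using order_tendstoD[OF lim] pq by auto
    then show ?thesis by eventually_elim auto
  qed
  then obtain N where N: "\<And>n. n \<ge> N \<Longrightarrow> u \<bullet> F n p < c \<and> c < u \<bullet> F n q \<or> u \<bullet> F n q < c \<and> c < u \<bullet> F n p"
    by (auto simp: eventually_sequentially)
  define G where "G n = F (n + N)" for n
  have G: "null_loop X (G n)" for n using F by (auto simp: G_def)
  have "\<exists>st. 0 \<le> fst st \<and> fst st < snd st \<and> snd st \<le> 1 \<and> (p < fst st \<and> fst st < q) \<noteq> (p < snd st \<and> snd st < q) \<and>
     u \<bullet> G n (fst st) = c \<and> u \<bullet> G n (snd st) = c \<and> closed_segment (G n (fst st)) (G n (snd st)) \<subseteq> X \<and>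
     homotopic_paths X (subpath (fst st) (snd st) (G n)) (linepath (G n (fst st)) (G n (snd st)))" for n
  proof -
    have "u \<bullet> G n p < c \<and> c < u \<bullet> G n q \<or> u \<bullet> G n q < c \<and> c < u \<bullet> G n p"
      using N[of "n + N"] by (simp add: G_def)
    from null_loop_cut[OF G pq this] obtain s t where "0 \<le> s" "s < t" "t \<le> 1" "(p < s \<and> s < q) \<noteq> (p < t \<and> t < q)"
      "u \<bullet> G n s = c" "u \<bullet> G n t = c" "closed_segment (G n s) (G n t) \<subseteq> X"
      "homotopic_paths X (subpath s t (G n)) (linepath (G n s) (G n t))" by metis
    then show ?thesis by (intro exI[of _ "(s, t)"]) simp
  qed
  then obtain st where st: "\<And>n. 0 \<le> fst (st n)" "\<And>n. fst (st n) < snd (st n)" "\<And>n. snd (st n) \<le> 1"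
    "\<And>n. (p < fst (st n) \<and> fst (st n) < q) \<noteq> (p < snd (st n) \<and> snd (st n) < q)"
    "\<And>n. u \<bullet> G n (fst (st n)) = c" "\<And>n. u \<bullet> G n (snd (st n)) = c"
    "\<And>n. closed_segment (G n (fst (st n))) (G n (snd (st n))) \<subseteq> X"
    "\<And>n. homotopic_paths X (subpath (fst (st n)) (snd (st n)) (G n)) (linepath (G n (fst (st n))) (G n (snd (st n))))"
    by metis
  \<comment> \<open>The two possible orders of the cut times relative to \<open>p\<close> and
    \<open>q\<close>, with weak inequalities, so that the set is compact.\<close>
  define C where "C = {p..q} \<times> {q..1} \<union> {0..p} \<times> {p..q}"
  have "compact C" unfolding C_def by (intro compact_Un compact_Times) auto
  moreover have "st n \<in> C" for n
    using st(1,2,3,4)[of n] by (cases "st n") (auto simp: C_def)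
  ultimately obtain l r where l: "l \<in> C" "strict_mono r" "(st \<circ> r) \<longlonglongrightarrow> l"
    unfolding compact_def by metis
  define s t where "s = fst l" and "t = snd l"
  define S T where "S n = fst (st (r n))" and "T n = snd (st (r n))" for n
  define H where "H n = G (r n)" for n
  have ST: "S \<longlonglongrightarrow> s" "T \<longlonglongrightarrow> t"
    using tendsto_fst[OF l(3)] tendsto_snd[OF l(3)] by (simp_all add: S_def[abs_def] T_def[abs_def] s_def t_def o_def)
  have ST01: "S n \<in> {0..1}" "T n \<in> {0..1}" for n
    using st(1,2,3)[of "r n"] by (auto simp: S_def T_def)
  have st01: "s \<in> {0..1}" "t \<in> {0..1}" using l(1) pq by (auto simp: s_def t_def C_def)
  have H: "uniform_limit {0..1} H f sequentially"
  proof -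
    have "filterlim (\<lambda>n. r n + N) at_top sequentially"
      using filterlim_compose[OF filterlim_add_const_nat_at_top filterlim_subseq[OF l(2)]] by simp
    from filterlim_compose[OF F(2) this] show ?thesis by (simp add: H_def[abs_def] G_def)
  qed
  note ls = tendsto_along[OF H cf ST(1) ST01(1) ST(2) ST01(2) st01]
    and lt = tendsto_along'[OF H cf ST(1) ST01(1) ST(2) ST01(2) st01]
  have "(\<lambda>n. u \<bullet> H n (S n)) \<longlonglongrightarrow> u \<bullet> f s" "(\<lambda>n. u \<bullet> H n (T n)) \<longlonglongrightarrow> u \<bullet> f t"
    by (intro tendsto_intros ls lt)+
  then have us: "u \<bullet> f s = c" "u \<bullet> f t = c"
    using st(5,6) by (simp_all add: H_def S_def T_def LIMSEQ_const_iff)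
  have ne: "s \<noteq> p" "s \<noteq> q" "t \<noteq> p" "t \<noteq> q" using us c by auto
  have ord: "p < s \<and> s < q \<and> q < t \<or> s < p \<and> p < t \<and> t < q"
  proof -
    have "p \<le> s \<and> s \<le> q \<and> q \<le> t \<or> s \<le> p \<and> p \<le> t \<and> t \<le> q"
      using l(1) unfolding C_def s_def t_def by auto
    then show ?thesis using ne by linarith
  qed
  then have slt: "s < t" by auto
  have seg: "closed_segment (f s) (f t) \<subseteq> X"
  proof
    fix z assume "z \<in> closed_segment (f s) (f t)"
    then obtain a where a: "0 \<le> a" "a \<le> 1" "z = (1 - a) *\<^sub>R f s + a *\<^sub>R f t" by (auto simp: closed_segment_def)
    have "(1 - a) *\<^sub>R H n (S n) + a *\<^sub>R H n (T n) \<in> closed_segment (H n (S n)) (H n (T n))" for n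
      using a by (auto simp: closed_segment_def)
    then have "(1 - a) *\<^sub>R H n (S n) + a *\<^sub>R H n (T n) \<in> X" for n
      using st(7)[of "r n"] by (auto simp: H_def S_def T_def)
    moreover have "(\<lambda>n. (1 - a) *\<^sub>R H n (S n) + a *\<^sub>R H n (T n)) \<longlonglongrightarrow> z"
      unfolding a(3) by (intro tendsto_intros ls lt)
    ultimately show "z \<in> X" by (rule closed_sequentially[OF X])
  qed
  have "\<forall>n. null_loop X (chord_splice (H n) (S n) (T n))"
  proof
    fix n
    show "null_loop X (chord_splice (H n) (S n) (T n))"
      unfolding H_def S_def T_def by (rule null_loop_chord_splice[OF G st(1,2,3,7,8)])
  qed
  then have 1: "limit_null X (chord_splice f s t)"
    unfolding limit_null_def
    by (intro exI[of _ "\<lambda>n. chord_splice (H n) (S n) (T n)"] conjI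
      uniform_limit_chord_splice[OF H cf ST(1) ST01(1) ST(2) ST01(2) st01 slt])
  have "\<forall>n. null_loop X (chord_loop (H n) (S n) (T n))"
  proof
    fix n
    show "null_loop X (chord_loop (H n) (S n) (T n))"
      unfolding H_def S_def T_def by (rule null_loop_chord_loop[OF st(7,8)])
  qed
  then have 2: "limit_null X (chord_loop f s t)"
    unfolding limit_null_def
    by (intro exI[of _ "\<lambda>n. chord_loop (H n) (S n) (T n)"] conjI
      uniform_limit_chord_loop[OF H cf ST(1) ST01(1) ST(2) ST01(2) st01])
  have b: "0 \<le> s" "t \<le> 1" using st01 by simp_all
  show thesis by (rule that[OF b(1) slt b(2) ord us 1 2 seg])
qed

section \<open>Contractions of loops and their gluing along a chord\<close>

definition contraction :: "(real \<Rightarrow> 'a::real_normed_vector) \<Rightarrow> (real \<times> real \<Rightarrow> 'a) \<Rightarrow> bool" where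
  "contraction f h \<longleftrightarrow> continuous_on unit_square h \<and> (\<forall>x\<in>{0..1}. h (0, x) = f x \<and> h (1, x) = f 0) \<and>
     (\<forall>r\<in>{0..1}. h (r, 0) = f 0 \<and> h (r, 1) = f 0)"

text \<open>As \<^term>\<open>r\<close> grows, \<^term>\<open>fan_base r\<close> runs through the three sides of the square on which a
  contraction is constant; \<^term>\<open>fan r\<close> is the segment from there to the midpoint of the
  fourth side. These segments deform one half of that side into the reverse of the other half.\<close>
definition fan_base :: "real \<Rightarrow> real \<times> real" where
  "fan_base r = (min 1 (min (3 * r) (3 - 3 * r)), clamp01 (3 * r - 1))"

definition fan :: "real \<Rightarrow> real \<Rightarrow> real \<times> real" where
  "fan r l = ((1 - l) * fst (fan_base r), (1 - l) * snd (fan_base r) + l / 2)"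

text \<open>First \<^term>\<open>f\<close> is deformed, using the contraction \<^term>\<open>h2\<close> of the cut-off loop, into the
  path with the chord, which is then contracted by \<^term>\<open>h1\<close>.\<close>
definition glue :: "(real \<Rightarrow> 'a::real_normed_vector) \<Rightarrow> real \<Rightarrow> real \<Rightarrow> (real \<times> real \<Rightarrow> 'a) \<Rightarrow> (real \<times> real \<Rightarrow> 'a) \<Rightarrow> real \<times> real \<Rightarrow> 'a" where
  "glue f s t h1 h2 z = f (min (snd z) s) + (f (max (snd z) t) - f t)
     + (h2 (fan (min 1 (2 * fst z)) (clamp01 ((snd z - s) / (t - s)))) - f s)
     + (h1 (max 0 (2 * fst z - 1), snd z) - chord_splice f s t (snd z))"

lemma fan_in_square:
  assumes "0 \<le> r" "r \<le> 1" "0 \<le> l" "l \<le> 1"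
  shows "fan r l \<in> unit_square"
proof -
  have b: "0 \<le> fst (fan_base r)" "fst (fan_base r) \<le> 1" "0 \<le> snd (fan_base r)" "snd (fan_base r) \<le> 1"
    using assms by (auto simp: fan_base_def)
  have "(1 - l) * fst (fan_base r) \<le> 1 * 1" by (rule mult_mono) (use b assms in auto)
  moreover have "(1 - l) * snd (fan_base r) \<le> (1 - l) * 1" by (rule mult_left_mono) (use b assms in auto)
  moreover have "0 \<le> (1 - l) * fst (fan_base r)" "0 \<le> (1 - l) * snd (fan_base r)" using b assms by simp_all
  ultimately show ?thesis using assms(3,4) by (simp add: fan_def)
qed

lemma fan_ends: "fan r 0 = fan_base r" "fan r 1 = (0, 1/2)" "fan 1 l = (0, 1 - l / 2)"
  by (simp_all add: fan_def fan_base_def clamp01_def)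

lemma contraction_fan_base:
  assumes "contraction f h" "0 \<le> r" "r \<le> 1"
  shows "h (fan_base r) = f 0"
proof -
  consider "r \<le> 1/3" | "1/3 \<le> r" "r \<le> 2/3" | "2/3 \<le> r" by linarith
  then show ?thesis
  proof cases
    case 1
    then have "fan_base r = (3 * r, 0)" using assms by (auto simp: fan_base_def clamp01_def)
    then show ?thesis using assms 1 by (auto simp: contraction_def)
  next
    case 2
    then have "fan_base r = (1, 3 * r - 1)" using assms by (auto simp: fan_base_def clamp01_def)
    then show ?thesis using assms 2 by (auto simp: contraction_def)
  next
    case 3
    then have "fan_base r = (3 - 3 * r, 1)" using assms by (auto simp: fan_base_def clamp01_def)
    then show ?thesis using assms 3 by (auto simp: contraction_def)
  qed
qed

text \<open>The summands of \<open>glue\<close> are made to cancel. In the first half of the time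
  \<open>h1\<close> still shows the spliced path, so the last summand vanishes. In the second half
  \<open>h2\<close> has arrived at the chord, so the first three summands add up to the spliced path
  and only \<open>h1\<close> remains.\<close>

lemma glue_eq:
  assumes h1: "contraction (chord_splice f s t) h1" and h2: "contraction (chord_loop f s t) h2"
    and st: "0 \<le> s" "s < t" "t \<le> 1" and r: "r \<in> {0..1}" and x: "x \<in> {0..1}"
  shows "glue f s t h1 h2 (r, x) = (if r \<le> 1/2 then if x \<le> s \<or> t \<le> x then f x else h2 (fan (2 * r) ((x - s) / (t - s)))
     else h1 (2 * r - 1, x))"
proof -
  let ?l = "(x - s) / (t - s)"
  have h10: "h1 (0, x) = chord_splice f s t x" using h1 x by (auto simp: contraction_def)
  show ?thesis
  proof (cases "r \<le> 1/2")
    case True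
    then have r2: "min 1 (2 * r) = 2 * r" "max 0 (2 * r - 1) = 0" "0 \<le> 2 * r" "2 * r \<le> 1" using r by auto
    then have g: "glue f s t h1 h2 (r, x) = f (min x s) + (f (max x t) - f t) + (h2 (fan (2 * r) (clamp01 ?l)) - f s)"
      using h10 by (simp add: glue_def)
    consider "x \<le> s" | "t \<le> x" | "s < x" "x < t" by linarith
    then show ?thesis
    proof cases
      case 1
      then have "?l \<le> 0" using st by (intro divide_nonpos_pos) auto
      then have "clamp01 ?l = 0" by (simp add: clamp01_def)
      then have "h2 (fan (2 * r) (clamp01 ?l)) = f s"
        using contraction_fan_base[OF h2 r2(3,4)] by (simp add: fan_ends chord_loop_ends)
      then show ?thesis using g True 1 st by (simp add: min_def max_def)
    next
      case 2
      then have "1 \<le> ?l" using st by (simp add: field_simps)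
      then have "clamp01 ?l = 1" by (simp add: clamp01_def)
      moreover have "h2 (0, 1/2) = f t" using h2 chord_loop_ends(3)[of f s t] by (simp add: contraction_def)
      ultimately have "h2 (fan (2 * r) (clamp01 ?l)) = f t" by (simp add: fan_ends)
      then show ?thesis using g True 2 st by (simp add: min_def max_def)
    next
      case 3
      then have "clamp01 ?l = ?l" using st by (intro clamp01_id) (auto simp: field_simps)
      then show ?thesis using g True 3 by (simp add: min_def max_def)
    qed
  next
    case False
    then have r2: "min 1 (2 * r) = 1" "max 0 (2 * r - 1) = 2 * r - 1" by auto
    let ?c = "clamp01 ?l"
    have cb: "0 \<le> ?c" "?c \<le> 1" by (rule clamp01_bounds)+
    then have m: "1 - ?c / 2 \<in> {0..1}" "1/2 \<le> 1 - ?c / 2" unfolding atLeastAtMost_iff by linarith+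
    have "h2 (0, 1 - ?c / 2) = chord_loop f s t (1 - ?c / 2)"
      using h2 m(1) unfolding contraction_def by blast
    then have "h2 (fan 1 ?c) = linepath (f t) (f s) (2 * (1 - ?c / 2) - 1)"
      unfolding fan_ends using chord_loop_second[OF m(2)] by metis
    also have "\<dots> = f s + ?c *\<^sub>R (f t - f s)" by (simp add: linepath_def algebra_simps)
    finally show ?thesis using r2 False by (simp add: glue_def chord_splice_def)
  qed
qed

lemma contraction_glue:
  assumes f: "continuous_on {0..1} f" "f 1 = f 0"
    and h1: "contraction (chord_splice f s t) h1" and h2: "contraction (chord_loop f s t) h2"
    and st: "0 \<le> s" "s < t" "t \<le> 1"
  shows "contraction f (glue f s t h1 h2)"
proof -
  have c: "continuous_on unit_square (glue f s t h1 h2)"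
    unfolding glue_def[abs_def]
  proof (intro continuous_on_add continuous_on_diff continuous_on_const)
    show "continuous_on unit_square (\<lambda>z. f (min (snd z) s))"
      by (rule continuous_on_compose2[OF f(1)]) (use st in \<open>auto intro!: continuous_intros\<close>)
    show "continuous_on unit_square (\<lambda>z. f (max (snd z) t))"
      by (rule continuous_on_compose2[OF f(1)]) (use st in \<open>auto intro!: continuous_intros\<close>)
    show "continuous_on unit_square (\<lambda>z. h2 (fan (min 1 (2 * fst z)) (clamp01 ((snd z - s) / (t - s)))))"
    proof (rule continuous_on_compose2[of unit_square h2])
      show "continuous_on unit_square h2" using h2 by (simp add: contraction_def)
      show "continuous_on unit_square (\<lambda>z. fan (min 1 (2 * fst z)) (clamp01 ((snd z - s) / (t - s))))"
      proof -
        have "continuous_on unit_square (\<lambda>z. min 1 (2 * fst z))" by (intro continuous_intros)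
        moreover have "continuous_on unit_square (\<lambda>z. clamp01 ((snd z - s) / (t - s)))"
          using st(2) by (intro continuous_intros) simp
        ultimately show ?thesis
          unfolding fan_def fan_base_def fst_conv snd_conv
          by (intro continuous_on_Pair continuous_on_mult continuous_on_diff continuous_on_add continuous_on_const
            continuous_on_min continuous_on_divide continuous_on_clamp01 continuous_on_fst continuous_on_snd continuous_on_id)
              (use st(2) in simp_all)
      qed
      show "(\<lambda>z. fan (min 1 (2 * fst z)) (clamp01 ((snd z - s) / (t - s)))) ` unit_square \<subseteq> unit_square"
      proof
        fix w assume "w \<in> (\<lambda>z. fan (min 1 (2 * fst z)) (clamp01 ((snd z - s) / (t - s)))) ` unit_square"
        then obtain z where z: "z \<in> unit_square" "w = fan (min 1 (2 * fst z)) (clamp01 ((snd z - s) / (t - s)))" by blast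
        show "w \<in> unit_square" unfolding z(2) by (rule fan_in_square) (use z(1) in auto)
      qed
    qed
    show "continuous_on unit_square (\<lambda>z. h1 (max 0 (2 * fst z - 1), snd z))"
    proof (rule continuous_on_compose2[of unit_square h1])
      show "continuous_on unit_square h1" using h1 by (simp add: contraction_def)
      show "continuous_on unit_square (\<lambda>z. (max 0 (2 * fst z - 1), snd z))" by (intro continuous_intros)
    qed auto
    show "continuous_on unit_square (\<lambda>z. chord_splice f s t (snd z))"
    proof (rule continuous_on_compose2[of "{0..1}" "chord_splice f s t"])
      show "continuous_on {0..1} (chord_splice f s t)"
        using path_chord_splice[of f s t] f(1) st by (simp add: path_def)
    qed (auto intro!: continuous_intros)
  qed
  have h1v: "h1 (1, x) = f 0" "h1 (r, 0) = f 0" "h1 (r, 1) = f 0" if "x \<in> {0..1}" "r \<in> {0..1}" for x r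
    using h1 that st chord_splice_outside[of s t 0 f] by (auto simp: contraction_def)
  \<comment> \<open>At time 0 the fan consists of the points \<open>(0, l / 2)\<close>, along which
    \<open>h2\<close> runs through the first half of the cut-off loop, that is, through
    \<open>f\<close>.\<close>
  have v0: "glue f s t h1 h2 (0, x) = f x" if x: "x \<in> {0..1}" for x
  proof (cases "x \<le> s \<or> t \<le> x")
    case True
    then show ?thesis using glue_eq[OF h1 h2 st _ x, of 0] by simp
  next
    case False
    define l where "l = (x - s) / (t - s)"
    have l: "0 \<le> l" "l \<le> 1" using False st by (auto simp: l_def field_simps)
    have "fan 0 l = (0, l / 2)" by (simp add: fan_def fan_base_def clamp01_def)
    moreover have "l / 2 \<in> {0..1}" using l by simp
    then have "h2 (0, l / 2) = chord_loop f s t (l / 2)" using h2 unfolding contraction_def by blast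
    moreover have "chord_loop f s t (l / 2) = f (s + l * (t - s))" using chord_loop_first[of "l/2" f s t] l by simp
    moreover have "s + l * (t - s) = x" using st by (simp add: l_def)
    ultimately have "h2 (fan 0 ((x - s) / (t - s))) = f x" unfolding l_def by metis
    then show ?thesis using glue_eq[OF h1 h2 st _ x, of 0] False by simp
  qed
  show ?thesis
    unfolding contraction_def
  proof (intro conjI ballI c)
    fix x :: real assume x: "x \<in> {0..1}"
    show "glue f s t h1 h2 (0, x) = f x" by (rule v0[OF x])
    show "glue f s t h1 h2 (1, x) = f 0" using glue_eq[OF h1 h2 st _ x, of 1] h1v(1)[OF x x] by simp
  next
    fix r :: real assume r: "r \<in> {0..1}"
    show "glue f s t h1 h2 (r, 0) = f 0"
      using glue_eq[OF h1 h2 st r, of 0] h1v(2)[of 0 "2 * r - 1"] r st by auto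
    show "glue f s t h1 h2 (r, 1) = f 0"
      using glue_eq[OF h1 h2 st r, of 1] h1v(3)[of 0 "2 * r - 1"] r st f(2) by auto
  qed
qed

text \<open>The parameter \<open>x\<close> or \<open>w\<close> depends on the cut and on
  \<open>z\<close> but not on the contractions. So two gluings over the same cut are compared at one
  common point of \<open>f\<close>, of the first or of the second contractions, and gluing does not
  enlarge distances.\<close>

lemma glue_values:
  assumes h1: "contraction (chord_splice f s t) h1" and h2: "contraction (chord_loop f s t) h2"
    and st: "0 \<le> s" "s < t" "t \<le> 1" and z: "z \<in> unit_square"
  obtains x where "x \<in> {0..1}" "\<And>h1 h2. contraction (chord_splice f s t) h1 \<Longrightarrow> contraction (chord_loop f s t) h2 \<Longrightarrow> glue f s t h1 h2 z = f x"
    | w where "w \<in> unit_square" "\<And>h1 h2. contraction (chord_splice f s t) h1 \<Longrightarrow> contraction (chord_loop f s t) h2 \<Longrightarrow> glue f s t h1 h2 z = h1 w"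
    | w where "w \<in> unit_square" "\<And>h1 h2. contraction (chord_splice f s t) h1 \<Longrightarrow> contraction (chord_loop f s t) h2 \<Longrightarrow> glue f s t h1 h2 z = h2 w"
proof -
  obtain r x where rx: "z = (r, x)" "r \<in> {0..1}" "x \<in> {0..1}" using z by (cases z) auto
  note g = glue_eq[OF _ _ st rx(2,3)]
  show thesis
  proof (cases "r \<le> 1/2")
    case True
    show thesis
    proof (cases "x \<le> s \<or> t \<le> x")
      case False
      have "fan (2 * r) ((x - s) / (t - s)) \<in> unit_square"
        by (rule fan_in_square) (use True rx False in \<open>auto simp: field_simps\<close>)
      then show thesis by (rule that(3)) (use g rx(1) True False in simp)
    next
      case tr: True
      show thesis by (rule that(1)[OF rx(3)]) (use g rx(1) True tr in simp)
    qed
  next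
    case False
    have "(2 * r - 1, x) \<in> unit_square" using rx False by auto
    then show thesis by (rule that(2)) (use g rx(1) False in simp)
  qed
qed

text \<open>A derivation is a tree of cuts whose leaves are loops of diameter at most
  \<open>e\<close>. Leaves are coned off linearly, so the values may leave \<open>X\<close>, but
  only by at most \<open>e\<close>. Induction over the tree allows a refinement leaf by
  leaf.\<close>

inductive approx_contraction :: "'a::real_normed_vector set \<Rightarrow> real \<Rightarrow> (real \<Rightarrow> 'a) \<Rightarrow> (real \<times> real \<Rightarrow> 'a) \<Rightarrow> bool"
  for X :: "'a set" and e :: real where
  cone: "\<lbrakk>limit_null X f; \<And>x y. x \<in> {0..1} \<Longrightarrow> y \<in> {0..1} \<Longrightarrow> dist (f x) (f y) \<le> e\<rbrakk>
    \<Longrightarrow> approx_contraction X e f (\<lambda>z. (1 - fst z) *\<^sub>R f (snd z) + fst z *\<^sub>R f 0)"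
| cut: "\<lbrakk>limit_null X f; 0 \<le> s; s < t; t \<le> 1;
    approx_contraction X e (chord_splice f s t) h1; approx_contraction X e (chord_loop f s t) h2\<rbrakk>
    \<Longrightarrow> approx_contraction X e f (glue f s t h1 h2)"

text \<open>Cutting only inserts chords and coning only inserts segments, so nothing leaves the
  convex hull of the loop. This clause later bounds the distance between a contraction and its
  refinement on a leaf.\<close>

lemma approx_contraction_facts:
  assumes "approx_contraction X e f h" "closed X"
  shows "limit_null X f \<and> contraction f h \<and> h ` unit_square \<subseteq> convex hull (f ` {0..1}) \<and>
    (\<forall>z\<in>unit_square. \<exists>y\<in>X. dist (h z) y \<le> e)"
  using assms(1)
proof induction
  case (cone f)
  note fc = limit_null_facts[OF cone(1) assms(2)]
  let ?h = "\<lambda>z. (1 - fst z) *\<^sub>R f (snd z) + fst z *\<^sub>R f 0"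
  have "continuous_on unit_square ?h"
  proof (intro continuous_intros)
    show "continuous_on unit_square (\<lambda>z. f (snd z))"
      by (rule continuous_on_compose2[OF fc(1)]) (auto intro!: continuous_intros)
  qed
  then have 1: "contraction f ?h" using fc(3) by (auto simp: contraction_def algebra_simps)
  have 2: "?h ` unit_square \<subseteq> convex hull (f ` {0..1})"
  proof
    fix w assume "w \<in> ?h ` unit_square"
    then obtain z where z: "z \<in> unit_square" "w = ?h z" by blast
    have "f (snd z) \<in> convex hull (f ` {0..1})" "f 0 \<in> convex hull (f ` {0..1})"
      using z(1) by (auto intro!: hull_inc)
    then show "w \<in> convex hull (f ` {0..1})"
      unfolding z(2) using z(1) by (intro convexD[OF convex_convex_hull]) auto
  qed
  have 3: "\<exists>y\<in>X. dist (?h z) y \<le> e" if z: "z \<in> unit_square" for z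
  proof -
    have x: "snd z \<in> {0..1}" and r: "fst z \<in> {0..1}" using z by auto
    have "?h z - f (snd z) = fst z *\<^sub>R (f 0 - f (snd z))" by (simp add: algebra_simps)
    then have "dist (?h z) (f (snd z)) = fst z * dist (f 0) (f (snd z))" using r by (simp add: dist_norm)
    also have "\<dots> \<le> 1 * e" by (rule mult_mono) (use cone(2)[of 0 "snd z"] x r order_trans[OF zero_le_dist cone(2)[of 0 0]] in auto)
    finally have "dist (?h z) (f (snd z)) \<le> e" by simp
    then show ?thesis using fc(2) x by blast
  qed
  show ?case using cone(1) 1 2 3 by blast
next
  case (cut f s t h1 h2)
  note fc = limit_null_facts[OF cut(1) assms(2)]
  have h1: "contraction (chord_splice f s t) h1" and h2: "contraction (chord_loop f s t) h2"
    using cut by auto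
  have sub: "f ` {0..1} \<subseteq> convex hull (f ` {0..1})" by (rule hull_subset)
  have i1: "h1 ` unit_square \<subseteq> convex hull (f ` {0..1})"
    using cut(7) hull_minimal[where S = convex, OF chord_splice_in_convex[OF convex_convex_hull sub cut(2,3,4)] convex_convex_hull] by blast
  have i2: "h2 ` unit_square \<subseteq> convex hull (f ` {0..1})"
    using cut(8) hull_minimal[where S = convex, OF chord_loop_in_convex[OF convex_convex_hull sub cut(2,3,4)] convex_convex_hull] by blast
  have e0: "0 \<le> e"
  proof -
    have "(0::real, 0::real) \<in> unit_square" by simp
    then obtain y where "dist (h1 (0,0)) y \<le> e" using cut(7) by blast
    then show ?thesis using zero_le_dist order_trans by blast
  qed
  have "glue f s t h1 h2 z \<in> convex hull (f ` {0..1}) \<and> (\<exists>y\<in>X. dist (glue f s t h1 h2 z) y \<le> e)"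
    if z: "z \<in> unit_square" for z
  proof (rule glue_values[OF h1 h2 cut(2,3,4) z])
    fix x assume "x \<in> {0..1}" "\<And>h1 h2. contraction (chord_splice f s t) h1 \<Longrightarrow> contraction (chord_loop f s t) h2 \<Longrightarrow> glue f s t h1 h2 z = f x"
    then have "glue f s t h1 h2 z = f x" "f x \<in> f ` {0..1}" using h1 h2 by auto
    then show ?thesis using sub fc(2) e0 by (metis dist_self subsetD)
  next
    fix w assume "w \<in> unit_square" "\<And>h1 h2. contraction (chord_splice f s t) h1 \<Longrightarrow> contraction (chord_loop f s t) h2 \<Longrightarrow> glue f s t h1 h2 z = h1 w"
    then show ?thesis using h1 h2 i1 cut(7) by (metis image_subset_iff)
  next
    fix w assume "w \<in> unit_square" "\<And>h1 h2. contraction (chord_splice f s t) h1 \<Longrightarrow> contraction (chord_loop f s t) h2 \<Longrightarrow> glue f s t h1 h2 z = h2 w"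
    then show ?thesis using h1 h2 i2 cut(8) by (metis image_subset_iff)
  qed
  then show ?case using contraction_glue[OF fc(1,3) h1 h2 cut(2,3,4)] cut(1) by blast
qed

lemma convex_hull_diameter_le:
  fixes S :: "'a::real_normed_vector set"
  assumes "\<And>x y. x \<in> S \<Longrightarrow> y \<in> S \<Longrightarrow> dist x y \<le> e" "a \<in> convex hull S" "b \<in> convex hull S"
  shows "dist a b \<le> e"
proof -
  have "convex hull S \<subseteq> cball x e" if "x \<in> S" for x
    by (rule hull_minimal) (use assms(1) that in auto)
  then have "S \<subseteq> cball a e" using assms(2) by (auto simp: dist_commute subset_iff)
  then have "convex hull S \<subseteq> cball a e" by (rule hull_minimal) auto
  then show ?thesis using assms(3) by auto
qed

text \<open>The cuts are kept and each cone is replaced by a finer contraction of the same leaf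
  loop. Both maps stay in the convex hull of that loop, which has diameter at most \<open>e\<close>,
  and gluing passes the bound on unchanged.\<close>

lemma approx_contraction_refine:
  assumes "approx_contraction X e f h" "closed X"
    and ex: "\<And>f. limit_null X f \<Longrightarrow> \<exists>h. approx_contraction X e' f h"
  shows "\<exists>h'. approx_contraction X e' f h' \<and> (\<forall>z\<in>unit_square. dist (h z) (h' z) \<le> e)"
  using assms(1)
proof induction
  case (cone f)
  then obtain h' where h': "approx_contraction X e' f h'" using ex by blast
  let ?h = "\<lambda>z. (1 - fst z) *\<^sub>R f (snd z) + fst z *\<^sub>R f 0"
  have "?h ` unit_square \<subseteq> convex hull (f ` {0..1})" "h' ` unit_square \<subseteq> convex hull (f ` {0..1})"
    using approx_contraction_facts[OF approx_contraction.cone[OF cone] assms(2)]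
      approx_contraction_facts[OF h' assms(2)] by blast+
  moreover have "dist x y \<le> e" if "x \<in> f ` {0..1}" "y \<in> f ` {0..1}" for x y using that cone(2) by blast
  ultimately have "\<forall>z\<in>unit_square. dist (?h z) (h' z) \<le> e"
    using convex_hull_diameter_le[of "f ` {0..1}" e] by blast
  then show ?case using h' by blast
next
  case (cut f s t h1 h2)
  obtain h1' where h1': "approx_contraction X e' (chord_splice f s t) h1'" "\<forall>z\<in>unit_square. dist (h1 z) (h1' z) \<le> e"
    using cut(7) by blast
  obtain h2' where h2': "approx_contraction X e' (chord_loop f s t) h2'" "\<forall>z\<in>unit_square. dist (h2 z) (h2' z) \<le> e"
    using cut(8) by blast
  have c: "contraction (chord_splice f s t) h1" "contraction (chord_loop f s t) h2"
    "contraction (chord_splice f s t) h1'" "contraction (chord_loop f s t) h2'"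
    using approx_contraction_facts[OF cut(5) assms(2)] approx_contraction_facts[OF cut(6) assms(2)]
      approx_contraction_facts[OF h1'(1) assms(2)] approx_contraction_facts[OF h2'(1) assms(2)] by auto
  have "(0::real, 0::real) \<in> unit_square" by simp
  then have e0: "0 \<le> e" using h1'(2) zero_le_dist order_trans by blast
  have "dist (glue f s t h1 h2 z) (glue f s t h1' h2' z) \<le> e" if z: "z \<in> unit_square" for z
  proof (rule glue_values[OF c(1,2) cut(2,3,4) z])
    fix x assume "\<And>h1 h2. contraction (chord_splice f s t) h1 \<Longrightarrow> contraction (chord_loop f s t) h2 \<Longrightarrow> glue f s t h1 h2 z = f x"
    note this[OF c(1,2)] this[OF c(3,4)]
    then show ?thesis using e0 by simp
  next
    fix w assume w: "w \<in> unit_square" "\<And>h1 h2. contraction (chord_splice f s t) h1 \<Longrightarrow> contraction (chord_loop f s t) h2 \<Longrightarrow> glue f s t h1 h2 z = h1 w"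
    show ?thesis unfolding w(2)[OF c(1,2)] w(2)[OF c(3,4)] using h1'(2) w(1) by blast
  next
    fix w assume w: "w \<in> unit_square" "\<And>h1 h2. contraction (chord_splice f s t) h1 \<Longrightarrow> contraction (chord_loop f s t) h2 \<Longrightarrow> glue f s t h1 h2 z = h2 w"
    show ?thesis unfolding w(2)[OF c(1,2)] w(2)[OF c(3,4)] using h2'(2) w(1) by blast
  qed
  moreover have "approx_contraction X e' f (glue f s t h1' h2')"
    by (rule approx_contraction.cut[OF cut(1-4) h1'(1) h2'(1)])
  ultimately show ?case by blast
qed

section \<open>Counting intervals of small oscillation of one coordinate\<close>

inductive osc_parts :: "(real \<Rightarrow> real) \<Rightarrow> real \<Rightarrow> real \<Rightarrow> real \<Rightarrow> nat \<Rightarrow> bool"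
  for g :: "real \<Rightarrow> real" and d :: real where
  single: "a \<le> b \<Longrightarrow> (\<And>x y. x \<in> {a..b} \<Longrightarrow> y \<in> {a..b} \<Longrightarrow> \<bar>g x - g y\<bar> < d) \<Longrightarrow> osc_parts g d a b 1"
| append: "osc_parts g d a b m \<Longrightarrow> osc_parts g d b c n \<Longrightarrow> osc_parts g d a c (m + n)"

lemma osc_parts_pos: "osc_parts g d a b n \<Longrightarrow> a \<le> b \<and> 1 \<le> n"
  by (induction rule: osc_parts.induct) auto

text \<open>Only an interval that contains \<open>x\<close> is divided, which adds one to the
  count.\<close>

lemma osc_parts_split:
  assumes "osc_parts g d a b n" "a \<le> x" "x \<le> b"
  shows "\<exists>m k. osc_parts g d a x m \<and> osc_parts g d x b k \<and> m + k \<le> n + 1"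
  using assms
proof (induction arbitrary: x rule: osc_parts.induct)
  case (single a b)
  have "osc_parts g d a x 1" "osc_parts g d x b 1"
    by (rule osc_parts.single; use single in simp)+
  then show ?case by (intro exI[of _ 1]) simp
next
  case (append a b m c n)
  show ?case
  proof (cases "x \<le> b")
    case True
    then obtain i j where "osc_parts g d a x i" "osc_parts g d x b j" "i + j \<le> m + 1"
      using append.IH(1)[of x] append.prems by auto
    then show ?thesis using osc_parts.append[OF _ append.hyps(2)] by (intro exI[of _ i] exI[of _ "j + n"]) auto
  next
    case False
    then obtain i j where "osc_parts g d b x i" "osc_parts g d x c j" "i + j \<le> n + 1"
      using append.IH(2)[of x] append.prems by auto
    then show ?thesis using osc_parts.append[OF append.hyps(1)] by (intro exI[of _ "m + i"] exI[of _ j]) auto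
  qed
qed

lemma osc_parts_spread:
  assumes "osc_parts g d a b n" "x \<in> {a..b}" "y \<in> {a..b}"
  shows "\<bar>g x - g y\<bar> < of_nat n * d"
  using assms
proof (induction arbitrary: x y rule: osc_parts.induct)
  case (single a b)
  then show ?case by simp
next
  case (append a b m c n)
  have ord: "a \<le> b" "b \<le> c" "1 \<le> m" "1 \<le> n" using osc_parts_pos append.hyps by auto
  have d: "0 < d" using append.IH(1)[of b b] ord by (simp add: zero_less_mult_iff)
  have md: "0 \<le> real m * d" "0 \<le> real n * d" using d by simp_all
  have e: "real (m + n) * d = real m * d + real n * d" by (simp add: algebra_simps)
  consider "x \<le> b" "y \<le> b" | "x \<le> b" "b \<le> y" | "b \<le> x" "y \<le> b" | "b \<le> x" "b \<le> y" by linarith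
  then show ?case
  proof cases
    case 1
    then have "\<bar>g x - g y\<bar> < real m * d" using append.IH(1)[of x y] append.prems by auto
    then show ?thesis using e md by linarith
  next
    case 2
    then have "\<bar>g x - g b\<bar> < real m * d" "\<bar>g b - g y\<bar> < real n * d"
      using append.IH(1)[of x b] append.IH(2)[of b y] append.prems ord by auto
    then show ?thesis using e by linarith
  next
    case 3
    then have "\<bar>g b - g y\<bar> < real m * d" "\<bar>g x - g b\<bar> < real n * d"
      using append.IH(1)[of b y] append.IH(2)[of x b] append.prems ord by auto
    then show ?thesis using e by linarith
  next
    case 4
    then have "\<bar>g x - g y\<bar> < real n * d" using append.IH(2)[of x y] append.prems by auto
    then show ?thesis using e md by linarith
  qed
qed

lemma osc_parts_affine:
  assumes "osc_parts g d a b n" "0 < k" "\<And>x. x \<in> {a..b} \<Longrightarrow> g' (k * x + l) = g x"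
  shows "osc_parts g' d (k * a + l) (k * b + l) n"
  using assms(1,3)
proof (induction rule: osc_parts.induct)
  case (single a b)
  have inv: "\<exists>x'. x = k * x' + l \<and> x' \<in> {a..b}" if "x \<in> {k * a + l..k * b + l}" for x
    by (rule exI[of _ "(x - l) / k"]) (use that assms(2) in \<open>auto simp: field_simps\<close>)
  show ?case
  proof (rule osc_parts.single)
    show "k * a + l \<le> k * b + l" using single(1) assms(2) by simp
    fix x y assume "x \<in> {k * a + l..k * b + l}" "y \<in> {k * a + l..k * b + l}"
    then obtain x' y' where "x = k * x' + l" "x' \<in> {a..b}" "y = k * y' + l" "y' \<in> {a..b}" using inv by metis
    then show "\<bar>g' x - g' y\<bar> < d" using single(2,3) by simp
  qed
next
  case (append a b m c n)
  have ord: "a \<le> b" "b \<le> c" using osc_parts_pos append.hyps by auto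
  have "osc_parts g' d (k * a + l) (k * b + l) m" by (rule append.IH(1)) (use append.prems ord in auto)
  moreover have "osc_parts g' d (k * b + l) (k * c + l) n" by (rule append.IH(2)) (use append.prems ord in auto)
  ultimately show ?case by (rule osc_parts.append)
qed

lemma osc_parts_cong:
  assumes "osc_parts g d a b n" "\<And>x. x \<in> {a..b} \<Longrightarrow> g' x = g x"
  shows "osc_parts g' d a b n"
  using osc_parts_affine[of g d a b n 1 g' 0] assms by simp

lemma osc_parts_exists:
  assumes "continuous_on {0..1} g" "0 < d"
  shows "\<exists>n. osc_parts g d 0 1 n"
proof -
  have "0 \<le> (0::real) \<longrightarrow> (1::real) \<le> 1 \<longrightarrow> (\<exists>n. osc_parts g d 0 1 n)"
  proof (rule Bolzano[where P = "\<lambda>a b. 0 \<le> a \<longrightarrow> b \<le> 1 \<longrightarrow> (\<exists>n. osc_parts g d a b n)"])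
    fix a b c :: real
    assume "0 \<le> a \<longrightarrow> b \<le> 1 \<longrightarrow> (\<exists>n. osc_parts g d a b n)" "0 \<le> b \<longrightarrow> c \<le> 1 \<longrightarrow> (\<exists>n. osc_parts g d b c n)" "a \<le> b" "b \<le> c"
    then show "0 \<le> a \<longrightarrow> c \<le> 1 \<longrightarrow> (\<exists>n. osc_parts g d a c n)"
      using osc_parts.append by (meson order_trans)
  next
    fix x :: real assume x: "0 \<le> x" "x \<le> 1"
    obtain e where e: "e > 0" "\<And>y. y \<in> {0..1} \<Longrightarrow> dist y x < e \<Longrightarrow> dist (g y) (g x) < d/2"
      using assms x unfolding continuous_on_iff by (metis atLeastAtMost_iff half_gt_zero)
    have "\<exists>n. osc_parts g d a b n" if ab: "a \<le> x" "x \<le> b" "b - a < e" "0 \<le> a" "b \<le> 1" for a b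
    proof -
      have "dist (g y) (g x) < d/2" if "y \<in> {a..b}" for y
        using e(2)[of y] that ab by (auto simp: dist_real_def)
      then have "\<bar>g y - g z\<bar> < d" if "y \<in> {a..b}" "z \<in> {a..b}" for y z
        using that unfolding dist_real_def by (smt (verit) field_sum_of_halves)
      then have "osc_parts g d a b 1" using ab by (intro osc_parts.single) auto
      then show ?thesis by blast
    qed
    then show "\<exists>e>0. \<forall>a b. a \<le> x \<and> x \<le> b \<and> b - a < e \<longrightarrow> 0 \<le> a \<longrightarrow> b \<le> 1 \<longrightarrow> (\<exists>n. osc_parts g d a b n)"
      using e(1) by blast
  qed simp
  then show ?thesis by simp
qed

text \<open>One of the points \<^term>\<open>p\<close>, \<^term>\<open>q\<close> lies between \<^term>\<open>s\<close> and \<^term>\<open>t\<close> and the other one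
  does not, so both paths obtained by cutting lose at least four intervals and gain at most three.\<close>
lemma osc_parts_cut:
  fixes f :: "real \<Rightarrow> 'a::real_inner"
  assumes parts: "osc_parts (\<lambda>x. u \<bullet> f x) d 0 1 n" and st: "0 \<le> s" "s < t" "t \<le> 1"
    and c: "u \<bullet> f s = c" "u \<bullet> f t = c" and pq: "0 \<le> p" "q \<le> 1"
    and ord: "p < s \<and> s < q \<and> q < t \<or> s < p \<and> p < t \<and> t < q"
    and dev: "4 * d \<le> \<bar>u \<bullet> f p - c\<bar>" "4 * d \<le> \<bar>u \<bullet> f q - c\<bar>" and d: "0 < d"
  shows "\<exists>m<n. osc_parts (\<lambda>x. u \<bullet> chord_splice f s t x) d 0 1 m"
    and "\<exists>m<n. osc_parts (\<lambda>x. u \<bullet> chord_loop f s t x) d 0 1 m"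
proof -
  let ?g = "\<lambda>x. u \<bullet> f x"
  obtain n1 k where 1: "osc_parts ?g d 0 s n1" "osc_parts ?g d s 1 k" "n1 + k \<le> n + 1"
    using osc_parts_split[OF parts, of s] st by auto
  obtain n2 n3 where 2: "osc_parts ?g d s t n2" "osc_parts ?g d t 1 n3" "n2 + n3 \<le> k + 1"
    using osc_parts_split[OF 1(2), of t] st by auto
  \<comment> \<open>Splitting at \<open>s\<close> and at \<open>t\<close> gives
    \<open>n1 + n2 + n3 \<le> n + 2\<close>. An interval on which the function takes the value
    \<open>c\<close> and a value at distance at least \<open>4 * d\<close> from it needs more than
    four parts.\<close>
  have many: "5 \<le> m" if "osc_parts ?g d a b m" "x \<in> {a..b}" "y \<in> {a..b}" "?g y = c" "4 * d \<le> \<bar>?g x - c\<bar>" for a b m x y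
  proof -
    have "4 * d < real m * d" using osc_parts_spread[OF that(1,2,3)] that(4,5) by simp
    then have "4 < real m" using d by simp
    then show ?thesis by linarith
  qed
  have n2: "5 \<le> n2" using ord
  proof
    assume "p < s \<and> s < q \<and> q < t" then show ?thesis using many[OF 2(1), of q s] c dev st by auto
  next
    assume "s < p \<and> p < t \<and> t < q" then show ?thesis using many[OF 2(1), of p s] c dev st by auto
  qed
  have n13: "5 \<le> n1 \<or> 5 \<le> n3" using ord
  proof
    assume "p < s \<and> s < q \<and> q < t" then show ?thesis using many[OF 1(1), of p s] c dev st pq by auto
  next
    assume "s < p \<and> p < t \<and> t < q" then show ?thesis using many[OF 2(2), of q t] c dev st pq by auto
  qed
  have pos: "1 \<le> n1" "1 \<le> n3" using osc_parts_pos 1 2 by auto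
  have lin: "u \<bullet> linepath (f s) (f t) z = c" "u \<bullet> linepath (f t) (f s) z = c" for z
    using c by (simp_all add: linepath_def inner_right_distrib algebra_simps)
  show "\<exists>m<n. osc_parts (\<lambda>x. u \<bullet> chord_splice f s t x) d 0 1 m"
  proof (intro exI conjI)
    have "osc_parts (\<lambda>x. u \<bullet> chord_splice f s t x) d 0 s n1"
      by (rule osc_parts_cong[OF 1(1)]) (use st chord_splice_outside[of s t _ f] in auto)
    moreover have "osc_parts (\<lambda>x. u \<bullet> chord_splice f s t x) d s t 1"
      by (rule osc_parts.single) (use st chord_splice_inside[OF st(2), of _ f] lin d in auto)
    moreover have "osc_parts (\<lambda>x. u \<bullet> chord_splice f s t x) d t 1 n3"
      by (rule osc_parts_cong[OF 2(2)]) (use st chord_splice_outside[of s t _ f] in auto)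
    ultimately show "osc_parts (\<lambda>x. u \<bullet> chord_splice f s t x) d 0 1 ((n1 + 1) + n3)"
      by (meson osc_parts.append)
    show "(n1 + 1) + n3 < n" using 1(3) 2(3) n2 by linarith
  qed
  show "\<exists>m<n. osc_parts (\<lambda>x. u \<bullet> chord_loop f s t x) d 0 1 m"
  proof (intro exI conjI)
    let ?k = "1 / (2 * (t - s))"
    have "osc_parts (\<lambda>x. u \<bullet> chord_loop f s t x) d (?k * s + (- s * ?k)) (?k * t + (- s * ?k)) n2"
    proof (rule osc_parts_affine[OF 2(1)])
      show "0 < ?k" using st by simp
      fix x assume x: "x \<in> {s..t}"
      define w where "w = ?k * x + (- s * ?k)"
      have "w = (x - s) / (2 * (t - s))" by (simp add: w_def diff_divide_distrib)
      then have w: "w * (2 * (t - s)) = x - s" using st(2) by simp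
      have "w * (2 * (t - s)) \<le> 1/2 * (2 * (t - s))" using w x by simp
      then have "w \<le> 1/2" using st(2) by (simp only: mult_le_cancel_right) simp
      then have "chord_loop f s t w = f (s + 2 * w * (t - s))" by (rule chord_loop_first)
      also have "s + 2 * w * (t - s) = s + w * (2 * (t - s))" by (simp only: ac_simps)
      also have "\<dots> = x" using w by simp
      finally show "u \<bullet> chord_loop f s t (?k * x + (- s * ?k)) = u \<bullet> f x" by (simp only: w_def)
    qed
    moreover have "?k * s + (- s * ?k) = 0" by simp
    moreover have "?k * t + (- s * ?k) = (t - s) / (2 * (t - s))" by (simp add: diff_divide_distrib)
    then have "?k * t + (- s * ?k) = 1/2" using st(2) by simp
    ultimately have "osc_parts (\<lambda>x. u \<bullet> chord_loop f s t x) d 0 (1/2) n2" by (simp only:)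
    moreover have "osc_parts (\<lambda>x. u \<bullet> chord_loop f s t x) d (1/2) 1 1"
      by (rule osc_parts.single) (use chord_loop_second[of _ f s t] lin d in auto)
    ultimately show "osc_parts (\<lambda>x. u \<bullet> chord_loop f s t x) d 0 1 (n2 + 1)"
      by (rule osc_parts.append)
    show "n2 + 1 < n" using 1(3) 2(3) n13 pos by linarith
  qed
qed

text \<open>Induction on the number of parts: a loop whose \<open>u\<close>-range is longer than
  \<open>9 * d\<close> is cut along the middle line, from which both extreme values differ by at
  least \<open>4 * d\<close>, as \<open>osc_parts_cut\<close> demands. \<open>P\<close> is a
  property that cutting preserves; it carries along what cutting in another direction has
  achieved.\<close>

lemma approx_contraction_by_cutting:
  fixes X :: "(real^2) set"
  assumes X: "closed X" and d: "0 < d"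
    and P: "\<And>f s t. P f \<Longrightarrow> 0 \<le> s \<Longrightarrow> s < t \<Longrightarrow> t \<le> 1 \<Longrightarrow> P (chord_splice f s t) \<and> P (chord_loop f s t)"
    and base: "\<And>f a. limit_null X f \<Longrightarrow> P f \<Longrightarrow> \<forall>x\<in>{0..1}. a \<le> u \<bullet> f x \<and> u \<bullet> f x \<le> a + 9 * d \<Longrightarrow> \<exists>h. approx_contraction X e f h"
    and f: "limit_null X f" "P f" "osc_parts (\<lambda>x. u \<bullet> f x) d 0 1 n"
  shows "\<exists>h. approx_contraction X e f h"
  using f
proof (induction n arbitrary: f rule: less_induct)
  case (less n)
  note cf = limit_null_facts(1)[OF less.prems(1) X]
  have cu: "continuous_on {0..1} (\<lambda>x. u \<bullet> f x)" by (intro continuous_intros cf)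
  obtain p where p: "p \<in> {0..1}" "\<And>x. x \<in> {0..1} \<Longrightarrow> u \<bullet> f p \<le> u \<bullet> f x"
    using continuous_attains_inf[OF compact_Icc _ cu] by auto
  obtain q where q: "q \<in> {0..1}" "\<And>x. x \<in> {0..1} \<Longrightarrow> u \<bullet> f x \<le> u \<bullet> f q"
    using continuous_attains_sup[OF compact_Icc _ cu] by auto
  show ?case
  proof (cases "u \<bullet> f q - u \<bullet> f p \<le> 9 * d")
    case True
    then have "\<forall>x\<in>{0..1}. u \<bullet> f p \<le> u \<bullet> f x \<and> u \<bullet> f x \<le> u \<bullet> f p + 9 * d" using p(2) q(2) by force
    then show ?thesis using base[OF less.prems(1,2)] by blast
  next
    case False
    define c where "c = (u \<bullet> f p + u \<bullet> f q) / 2"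
    have dev: "4 * d \<le> \<bar>u \<bullet> f p - c\<bar>" "4 * d \<le> \<bar>u \<bullet> f q - c\<bar>" "u \<bullet> f p < c" "c < u \<bullet> f q"
      using False d unfolding c_def by (auto simp: field_simps)
    have "\<exists>h. approx_contraction X e f h" if pq': "0 \<le> p'" "p' < q'" "q' \<le> 1"
      and c': "u \<bullet> f p' < c \<and> c < u \<bullet> f q' \<or> u \<bullet> f q' < c \<and> c < u \<bullet> f p'"
      and dev': "4 * d \<le> \<bar>u \<bullet> f p' - c\<bar>" "4 * d \<le> \<bar>u \<bullet> f q' - c\<bar>" for p' q'
    proof (rule limit_null_cut[OF X less.prems(1) pq' c'])
      fix s t
      assume st: "0 \<le> s" "s < t" "t \<le> 1" and ord: "p' < s \<and> s < q' \<and> q' < t \<or> s < p' \<and> p' < t \<and> t < q'"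
        and uc: "u \<bullet> f s = c" "u \<bullet> f t = c"
        and ln: "limit_null X (chord_splice f s t)" "limit_null X (chord_loop f s t)"
      note m = osc_parts_cut[OF less.prems(3) st uc pq'(1,3) ord dev' d]
      obtain h1 where h1: "approx_contraction X e (chord_splice f s t) h1"
        using m(1) less.IH ln(1) P[OF less.prems(2) st] by blast
      obtain h2 where h2: "approx_contraction X e (chord_loop f s t) h2"
        using m(2) less.IH ln(2) P[OF less.prems(2) st] by blast
      show ?thesis using approx_contraction.cut[OF less.prems(1) st h1 h2] by blast
    qed
    note * = this
    have "p \<noteq> q" using dev by auto
    then show ?thesis using *[of p q] *[of q p] p(1) q(1) dev by (cases "p < q") auto
  qed
qed

lemma approx_contraction_exists:
  fixes X :: "(real^2) set"
  assumes X: "closed X" and e: "0 < e" and f: "limit_null X f"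
  shows "\<exists>h. approx_contraction X e f h"
proof -
  \<comment> \<open>Two rounds of cutting, one for each coordinate, leave ranges of length at most
    \<open>9 * d\<close>, and the diameter is at most the sum of the two ranges.\<close>
  define d where "d = e / 18"
  have d: "0 < d" using e by (simp add: d_def)
  define u :: "2 \<Rightarrow> real^2" where "u i = axis i 1" for i
  \<comment> \<open>Confinement to a vertical strip. A strip is convex, so the second round of
    cutting does not undo the first.\<close>
  define P where "P f \<longleftrightarrow> (\<exists>a. \<forall>x\<in>{0..1::real}. a \<le> u 1 \<bullet> f x \<and> u 1 \<bullet> f x \<le> a + 9 * d)" for f :: "real \<Rightarrow> real^2"
  have P: "P (chord_splice f s t) \<and> P (chord_loop f s t)" if Pf: "P f" and st: "0 \<le> s" "s < t" "t \<le> 1" for f s t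
  proof -
    obtain a where a: "\<forall>x\<in>{0..1}. a \<le> u 1 \<bullet> f x \<and> u 1 \<bullet> f x \<le> a + 9 * d" using Pf by (auto simp: P_def)
    define C where "C = {z. a \<le> u 1 \<bullet> z} \<inter> {z. u 1 \<bullet> z \<le> a + 9 * d}"
    have cv: "convex C" unfolding C_def using convex_halfspace_ge[of a "u 1"] convex_halfspace_le[of "u 1" "a + 9 * d"]
      by (intro convex_Int) auto
    have sub: "f ` {0..1} \<subseteq> C" using a by (auto simp: C_def)
    note chord_splice_in_convex[OF cv sub st] chord_loop_in_convex[OF cv sub st]
    then show ?thesis unfolding P_def C_def by blast
  qed
  have parts: "\<exists>n. osc_parts (\<lambda>x. v \<bullet> f x) d 0 1 n" if "limit_null X f" for v and f :: "real \<Rightarrow> real^2"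
    by (rule osc_parts_exists) (use limit_null_facts(1)[OF that X] d in \<open>auto intro!: continuous_intros\<close>)
  have base2: "\<exists>h. approx_contraction X e f h"
    if f: "limit_null X f" "P f" "\<forall>x\<in>{0..1}. b \<le> u 2 \<bullet> f x \<and> u 2 \<bullet> f x \<le> b + 9 * d" for f b
  proof -
    obtain a where a: "\<forall>x\<in>{0..1}. a \<le> u 1 \<bullet> f x \<and> u 1 \<bullet> f x \<le> a + 9 * d" using f(2) by (auto simp: P_def)
    have "dist (f x) (f y) \<le> e" if "x \<in> {0..1}" "y \<in> {0..1}" for x y
    proof -
      have "dist (f x) (f y) \<le> \<bar>(f x - f y) $ 1\<bar> + \<bar>(f x - f y) $ 2\<bar>"
        unfolding dist_norm using norm_le_l1_cart[of "f x - f y"] by (simp add: sum_2)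
      also have "\<dots> = \<bar>u 1 \<bullet> f x - u 1 \<bullet> f y\<bar> + \<bar>u 2 \<bullet> f x - u 2 \<bullet> f y\<bar>"
        by (simp add: u_def inner_axis')
      also have "\<dots> \<le> 9 * d + 9 * d"
      proof (rule add_mono)
        show "\<bar>u 1 \<bullet> f x - u 1 \<bullet> f y\<bar> \<le> 9 * d" using a[rule_format, OF that(1)] a[rule_format, OF that(2)] by linarith
        show "\<bar>u 2 \<bullet> f x - u 2 \<bullet> f y\<bar> \<le> 9 * d" using f(3)[rule_format, OF that(1)] f(3)[rule_format, OF that(2)] by linarith
      qed
      finally show ?thesis by (simp add: d_def)
    qed
    then show ?thesis using approx_contraction.cone[OF f(1)] by blast
  qed
  have base1: "\<exists>h. approx_contraction X e f h"
    if f: "limit_null X f" and a: "\<forall>x\<in>{0..1}. a \<le> u 1 \<bullet> f x \<and> u 1 \<bullet> f x \<le> a + 9 * d" for f a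
  proof -
    have "P f" unfolding P_def using a by blast
    moreover obtain n where "osc_parts (\<lambda>x. u 2 \<bullet> f x) d 0 1 n" using parts[OF f] by blast
    ultimately show ?thesis
      using approx_contraction_by_cutting[OF X d, of P "u 2" e f n] P base2 f by blast
  qed
  obtain n where "osc_parts (\<lambda>x. u 1 \<bullet> f x) d 0 1 n" using parts[OF f] by blast
  then show ?thesis
    using approx_contraction_by_cutting[OF X d, of "\<lambda>_. True" "u 1" e f n] base1 f by blast
qed

text \<open>Refining with tolerances \<open>(1/2)^n\<close> yields contractions that converge
  uniformly by the Weierstrass test. The values of the \<open>n\<close>-th one are within
  \<open>(1/2)^n\<close> of \<open>X\<close>, so the limit has its values in the closed set
  \<open>X\<close>.\<close>

theorem limit_null_imp_null_loop:
  fixes X :: "(real^2) set"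
  assumes X: "closed X" and f: "limit_null X f"
  shows "null_loop X f"
proof -
  have "\<exists>h. \<forall>n. approx_contraction X ((1/2)^n) f (h n) \<and> (\<forall>z\<in>unit_square. dist (h n z) (h (Suc n) z) \<le> (1/2)^n)"
  proof (rule dependent_nat_choice)
    show "\<exists>h. approx_contraction X ((1/2)^0) f h" using approx_contraction_exists[OF X _ f] by simp
    fix h n assume "approx_contraction X ((1/2)^n) f h"
    then show "\<exists>h'. approx_contraction X ((1/2)^Suc n) f h' \<and> (\<forall>z\<in>unit_square. dist (h z) (h' z) \<le> (1/2)^n)"
      by (rule approx_contraction_refine[OF _ X approx_contraction_exists[OF X]]) simp
  qed
  then obtain h where h: "\<And>n. approx_contraction X ((1/2)^n) f (h n)"
    "\<And>n z. z \<in> unit_square \<Longrightarrow> dist (h n z) (h (Suc n) z) \<le> (1/2)^n" by blast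
  note hf = approx_contraction_facts[OF h(1) X]
  define g where "g z = h 0 z + (\<Sum>i. h (Suc i) z - h i z)" for z
  have "uniform_limit unit_square (\<lambda>n z. \<Sum>i<n. h (Suc i) z - h i z) (\<lambda>z. \<Sum>i. h (Suc i) z - h i z) sequentially"
    by (rule Weierstrass_m_test[where M = "\<lambda>n. (1/2)^n"])
       (use h(2) in \<open>auto simp: dist_norm norm_minus_commute summable_geometric\<close>)
  then have "uniform_limit unit_square (\<lambda>n z. h 0 z + (\<Sum>i<n. h (Suc i) z - h i z)) g sequentially"
    unfolding g_def by (intro uniform_limit_add uniform_limit_const)
  moreover have "h 0 z + (\<Sum>i<n. h (Suc i) z - h i z) = h n z" for n z
    by (subst sum_lessThan_telescope) simp
  ultimately have lim: "uniform_limit unit_square h g sequentially" by (simp add: fun_eq_iff)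
  have pt: "(\<lambda>n. h n z) \<longlonglongrightarrow> g z" if "z \<in> unit_square" for z
    by (rule tendsto_uniform_limitI[OF lim that])
  have cont: "continuous_on unit_square g"
    by (rule uniform_limit_theorem[OF _ lim]) (use hf in \<open>auto simp: contraction_def\<close>)
  have gX: "g z \<in> X" if z: "z \<in> unit_square" for z
  proof -
    have "\<forall>n. \<exists>y\<in>X. dist (h n z) y \<le> (1/2)^n" using hf z by blast
    then obtain y where y: "\<And>n. y n \<in> X" "\<And>n. dist (h n z) (y n) \<le> (1/2)^n" by metis
    have "(\<lambda>n. dist (h n z) (y n)) \<longlonglongrightarrow> 0"
      by (rule tendsto_sandwich[of "\<lambda>_. 0" _ _ "\<lambda>n. (1/2)^n"]) (use y(2) in \<open>auto intro!: LIMSEQ_power_zero\<close>)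
    then have "(\<lambda>n. h n z - y n) \<longlonglongrightarrow> 0" by (simp add: dist_norm tendsto_norm_zero_iff)
    from tendsto_diff[OF pt[OF z] this] have "y \<longlonglongrightarrow> g z" by simp
    then show ?thesis using closed_sequentially[OF X] y(1) by blast
  qed
  have val: "g z = v" if "z \<in> unit_square" "\<And>n. h n z = v" for z v
    using pt[OF that(1)] that(2) LIMSEQ_const_iff by (metis (no_types, lifting) LIMSEQ_unique tendsto_const ext)
  have b: "g (0, x) = f x" "g (1, x) = f 0" "g (x, 0) = f 0" "g (x, 1) = f 0" if "x \<in> {0..1}" for x
    by (rule val; use that hf in \<open>auto simp: contraction_def\<close>)+
  have f1: "f 1 = f 0" by (rule limit_null_facts(3)[OF f X])
  show ?thesis
    unfolding homotopic_paths
  proof (intro exI[of _ g] conjI ballI cont)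
    show "g \<in> unit_square \<rightarrow> X" using gX by blast
  qed (use b f1 in \<open>auto simp: pathstart_def pathfinish_def linepath_refl\<close>)
qed

text \<open>The loop that runs along \<open>F n\<close> and back along \<open>G n\<close> is
  null-homotopic, hence so is its uniform limit, and two paths are homotopic if the loop formed by
  them in this way is.\<close>

theorem homotopic_paths_uniform_limit:
  fixes X :: "(real^2) set"
  assumes X: "closed X" and FG: "\<And>n. homotopic_paths X (F n) (G n)"
    and F: "uniform_limit {0..1} F f sequentially" and G: "uniform_limit {0..1} G g sequentially"
  shows "homotopic_paths X f g"
proof -
  have pG: "path (G n)" "path_image (G n) \<subseteq> X" for n
    using FG[of n] homotopic_paths_imp_path homotopic_paths_imp_subset by blast+
  have g: "path g"
    unfolding path_def by (rule uniform_limit_theorem[OF _ G]) (use pG in \<open>auto simp: path_def\<close>)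
  have nl: "null_loop X (F n +++ reversepath (G n))" for n
  proof -
    have ends: "pathstart (F n) = pathstart (G n)" "pathfinish (F n) = pathfinish (G n)"
      using homotopic_paths_imp_pathstart[OF FG] homotopic_paths_imp_pathfinish[OF FG] by simp_all
    have "homotopic_paths X (F n +++ reversepath (G n)) (G n +++ reversepath (G n))"
    proof (rule homotopic_paths_join[OF FG])
      show "homotopic_paths X (reversepath (G n)) (reversepath (G n))" using pG by simp
      show "pathfinish (F n) = pathstart (reversepath (G n))" using ends by simp
    qed
    also have "homotopic_paths X \<dots> (linepath (pathstart (G n)) (pathstart (G n)))"
      by (rule homotopic_paths_rinv[OF pG])
    finally show ?thesis using ends by (simp add: pathstart_def joinpaths_def)
  qed
  have ul: "uniform_limit {0..1} (\<lambda>n. F n +++ reversepath (G n)) (f +++ reversepath g) sequentially"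
  proof (rule uniform_limit_joinpaths[OF F])
    have "uniform_limit {0..1} (\<lambda>n x. G n (1 - x)) (\<lambda>x. g (1 - x)) sequentially"
      by (rule uniform_limit_compose'[OF G]) auto
    then show "uniform_limit {0..1} (\<lambda>n. reversepath (G n)) (reversepath g) sequentially"
      by (simp add: reversepath_def[abs_def])
  qed
  have "limit_null X (f +++ reversepath g)"
    unfolding limit_null_def by (intro exI[of _ "\<lambda>n. F n +++ reversepath (G n)"] conjI allI nl ul)
  from limit_null_imp_null_loop[OF X this]
  have n: "null_loop X (f +++ reversepath g)" .
  have "pathfinish (f +++ reversepath g) = pathstart (f +++ reversepath g)"
    using homotopic_paths_imp_pathstart[OF n] homotopic_paths_imp_pathfinish[OF n] by simp
  then have "homotopic_loops X (f +++ reversepath g) (linepath ((f +++ reversepath g) 0) ((f +++ reversepath g) 0))"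
    by (intro homotopic_paths_imp_homotopic_loops[OF n]) (auto simp: pathstart_def)
  then show ?thesis using homotopic_paths_loop_parts g by blast
qed

section \<open>Oscillations and tight paths\<close>

lemma gfun_alt: "gfun t = max (-1) (min 0 ((t + 1) / 2)) + min 1 (max 0 ((t - 1) / 2))"
  by (auto simp: gfun_def min_def max_def)

lemma gPQ_bounds: "\<bar>gPQ P x\<bar> \<le> 1"
  by (cases P) (auto simp: gPQ_def gfun_alt)

lemma continuous_gPQ: "continuous_on UNIV (gPQ P)"
proof -
  obtain u c1 c2 where P: "P = (u, c1, c2)" by (cases P)
  have "continuous_on UNIV gfun"
    unfolding gfun_alt[abs_def] by (intro continuous_intros) auto
  then have "continuous_on UNIV (\<lambda>x. gfun (-3 + (u \<bullet> x - c1) * k))" for k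
    by (rule continuous_on_compose2[of UNIV gfun]) (auto intro!: continuous_intros)
  from this[of "6 / (c2 - c1)"]
  show ?thesis by (simp add: P gPQ_def[abs_def] mult.commute)
qed

lemma gPQ_flip: "gPQ (lp_flip P) x = gPQ P x"
proof -
  obtain u c1 c2 where P: "P = (u, c1, c2)" by (cases P)
  have "6 * (- u \<bullet> x - - c1) = - (6 * (u \<bullet> x - c1))" "- c2 - - c1 = - (c2 - c1)" by simp_all
  then show ?thesis unfolding P gPQ_def lp_flip_def prod.case by (simp only: minus_divide_divide)
qed

text \<open>Opposite signs put the two arguments of \<open>gfun\<close> on different sides of the
  interval from -1 to 1, whose length is a third of the length 6 that corresponds to
  \<open>c2 - c1\<close>.\<close>

lemma gPQ_opposite_signs:
  assumes "gPQ (u, c1, c2) x * gPQ (u, c1, c2) y < 0"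
  shows "\<bar>c2 - c1\<bar> / 3 \<le> \<bar>u \<bullet> x - u \<bullet> y\<bar>"
proof -
  define a b where "a = -3 + 6 * (u \<bullet> x - c1) / (c2 - c1)" and "b = -3 + 6 * (u \<bullet> y - c1) / (c2 - c1)"
  have "gfun a * gfun b < 0" using assms by (simp add: gPQ_def a_def b_def)
  then have "a < -1 \<and> 1 < b \<or> b < -1 \<and> 1 < a"
    by (auto simp: gfun_def mult_less_0_iff split: if_splits)
  then have ab: "2 \<le> \<bar>a - b\<bar>" by auto
  have ne: "c2 - c1 \<noteq> 0" using ab by (auto simp: a_def b_def)
  have "a - b = 6 * (u \<bullet> x - u \<bullet> y) / (c2 - c1)" by (simp add: a_def b_def diff_divide_distrib[symmetric] algebra_simps)
  then have "(a - b) * (c2 - c1) = 6 * (u \<bullet> x - u \<bullet> y)" using ne by simp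
  then have "\<bar>a - b\<bar> * \<bar>c2 - c1\<bar> = 6 * \<bar>u \<bullet> x - u \<bullet> y\<bar>" by (metis abs_mult abs_numeral)
  moreover have "2 * \<bar>c2 - c1\<bar> \<le> \<bar>a - b\<bar> * \<bar>c2 - c1\<bar>" by (rule mult_right_mono) (use ab in auto)
  ultimately have "2 * \<bar>c2 - c1\<bar> \<le> 6 * \<bar>u \<bullet> x - u \<bullet> y\<bar>" by simp
  then show ?thesis by simp
qed

section \<open>Oscillation as a supremum over sorted lists of times\<close>

fun osum :: "real list \<Rightarrow> real" where
  "osum (x # y # zs) = - x * y + osum (y # zs)"
| "osum _ = 0"

lemma osum_append: "osum (xs @ y # ys) = osum (xs @ [y]) + osum (y # ys)"
  by (induction xs rule: osum.induct) auto

definition chain :: "real list \<Rightarrow> bool" where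
  "chain ts \<longleftrightarrow> sorted ts \<and> set ts \<subseteq> {0..1}"

lemma osum_map_upt: "osum (map v [0..<Suc k]) = - (\<Sum>i\<in>{1..k}. v (i - 1) * v i)"
proof (induction k)
  case (Suc k)
  have "map v [0..<Suc (Suc k)] = map v [0..<k] @ v k # [v (Suc k)]" by simp
  then have "osum (map v [0..<Suc (Suc k)]) = osum (map v [0..<k] @ [v k]) + osum [v k, v (Suc k)]"
    by (metis osum_append)
  also have "map v [0..<k] @ [v k] = map v [0..<Suc k]" by simp
  finally show ?case using Suc by simp
qed simp

lemma osc_chains: "osc f P = Sup {osum (map (\<lambda>t. gPQ P (f t)) ts) | ts. chain ts}"
proof -
  have "{- (\<Sum>i\<in>{1..k}. gPQ P (f (a (i - 1))) * gPQ P (f (a i))) | a k.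
      (\<forall>i\<le>k. 0 \<le> a i \<and> a i \<le> 1) \<and> (\<forall>i<k. a i \<le> a (Suc i))} = {osum (map (\<lambda>t. gPQ P (f t)) ts) | ts. chain ts}"
    (is "?A = ?B")
  proof
    show "?A \<subseteq> ?B"
    proof
      fix z assume "z \<in> ?A"
      then obtain a :: "nat \<Rightarrow> real" and k where a: "z = - (\<Sum>i\<in>{1..k}. gPQ P (f (a (i - 1))) * gPQ P (f (a i)))"
        "\<forall>i\<le>k. 0 \<le> a i \<and> a i \<le> 1" "\<forall>i<k. a i \<le> a (Suc i)" by blast
      have "z = osum (map (\<lambda>t. gPQ P (f t)) (map a [0..<Suc k]))"
        unfolding a(1) map_map using osum_map_upt[of "\<lambda>i. gPQ P (f (a i))" k] by (simp add: o_def del: upt_Suc)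
      moreover have "chain (map a [0..<Suc k])"
        unfolding chain_def sorted_iff_nth_Suc using a(2,3) by (auto simp del: upt_Suc)
      ultimately show "z \<in> ?B" by blast
    qed
    show "?B \<subseteq> ?A"
    proof
      fix z assume "z \<in> ?B"
      then obtain ts where ts: "z = osum (map (\<lambda>t. gPQ P (f t)) ts)" "chain ts" by blast
      show "z \<in> ?A"
      proof (cases "ts = []")
        case True
        then show ?thesis using ts by (auto intro!: exI[of _ "\<lambda>_. 0"] exI[of _ 0])
      next
        case False
        define k where "k = length ts - 1"
        have k: "Suc k = length ts" using False by (simp add: k_def)
        have "map (\<lambda>t. gPQ P (f t)) ts = map (\<lambda>i. gPQ P (f (ts ! i))) [0..<Suc k]"
          by (rule nth_equalityI) (auto simp: k simp del: upt_Suc)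
        then have "z = - (\<Sum>i\<in>{1..k}. gPQ P (f (ts ! (i - 1))) * gPQ P (f (ts ! i)))"
          unfolding ts(1) by (simp only: osum_map_upt)
        moreover have "\<forall>i\<le>k. 0 \<le> ts ! i \<and> ts ! i \<le> 1"
          using ts(2) k nth_mem[of _ ts] unfolding chain_def by (metis atLeastAtMost_iff less_Suc_eq_le subsetD)
        moreover have "\<forall>i<k. ts ! i \<le> ts ! Suc i"
          using ts(2) k unfolding chain_def sorted_iff_nth_Suc by auto
        ultimately show ?thesis by blast
      qed
    qed
  qed
  then show ?thesis by (simp add: osc_def)
qed

text \<open>A summand can be positive only if the path moves by a fixed amount across the strip,
  which by uniform continuity takes time at least \<open>d\<close>. Since a summand is at most 1, it
  is at most \<open>(y - x) / d\<close>, and these bounds telescope.\<close>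

lemma osum_chain_bounded:
  assumes f: "path f"
  shows "bdd_above {osum (map (\<lambda>t. gPQ P (f t)) ts) | ts. chain ts}"
proof -
  obtain u c1 c2 where P: "P = (u, c1, c2)" by (cases P)
  show ?thesis
  proof (cases "c1 = c2")
    case True
    \<comment> \<open>Division by \<open>c2 - c1 = 0\<close> yields 0, so the argument of
      \<open>gfun\<close> is constantly -3.\<close>
    have "gPQ P x = -1" for x by (simp add: P gPQ_def True gfun_def)
    then have "osum (map (\<lambda>t. gPQ P (f t)) ts) \<le> 0" for ts
      by (induction ts rule: induct_list012) auto
    then show ?thesis by (intro bdd_aboveI[of _ 0]) auto
  next
    case False
    have "uniformly_continuous_on {0..1} (\<lambda>t. u \<bullet> f t)"
      by (rule compact_uniformly_continuous) (use f in \<open>auto simp: path_def intro!: continuous_intros\<close>)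
    then obtain d where d: "d > 0" "\<And>x y. x \<in> {0..1} \<Longrightarrow> y \<in> {0..1} \<Longrightarrow> dist x y < d \<Longrightarrow> dist (u \<bullet> f x) (u \<bullet> f y) < \<bar>c2 - c1\<bar> / 3"
      unfolding uniformly_continuous_on_def using False
      by (metis abs_eq_0 abs_ge_zero diff_eq_diff_eq diff_self divide_pos_pos less_eq_real_def zero_less_numeral)
    have step: "- gPQ P (f x) * gPQ P (f y) \<le> (y - x) / d" if "x \<in> {0..1}" "y \<in> {0..1}" "x \<le> y" for x y
    proof (cases "gPQ P (f x) * gPQ P (f y) < 0")
      case True
      then have "\<not> dist x y < d" using gPQ_opposite_signs[of u c1 c2 "f x" "f y"] d(2)[OF that(1,2)] by (auto simp: P dist_real_def)
      then have "1 \<le> (y - x) / d" using that d(1) by (auto simp: dist_real_def)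
      moreover have "\<bar>gPQ P (f x) * gPQ P (f y)\<bar> \<le> 1 * 1"
        unfolding abs_mult by (intro mult_mono gPQ_bounds) auto
      ultimately show ?thesis by linarith
    next
      case False
      moreover have "0 \<le> (y - x) / d" using that d(1) by simp
      ultimately show ?thesis by simp
    qed
    have "osum (map (\<lambda>t. gPQ P (f t)) ts) \<le> (1 - hd ts) / d" if "chain ts" "ts \<noteq> []" for ts
      using that
    proof (induction ts rule: induct_list012)
      case (2 x)
      then show ?case using d(1) by (simp add: chain_def)
    next
      case (3 x y zs)
      have "osum (map (\<lambda>t. gPQ P (f t)) (y # zs)) \<le> (1 - y) / d"
        using 3(2) 3(3) by (simp add: chain_def)
      moreover have "- gPQ P (f x) * gPQ P (f y) \<le> (y - x) / d" by (rule step) (use 3(3) in \<open>auto simp: chain_def\<close>)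
      moreover have "(y - x) / d + (1 - y) / d = (1 - x) / d" by (simp add: add_divide_distrib[symmetric])
      ultimately show ?case by simp
    qed simp
    note b1 = this
    have b2: "(1 - hd ts) / d \<le> 1 / d" if "chain ts" "ts \<noteq> []" for ts
      using that d(1) by (cases ts) (auto simp: chain_def divide_right_mono)
    have "osum (map (\<lambda>t. gPQ P (f t)) ts) \<le> 1 / d" if "chain ts" for ts
    proof (cases "ts = []")
      case False
      then show ?thesis using order_trans[OF b1 b2] that by blast
    qed (use d(1) in simp)
    then show ?thesis by (intro bdd_aboveI[of _ "1/d"]) auto
  qed
qed

lemma osc_ge: "path f \<Longrightarrow> chain ts \<Longrightarrow> osum (map (\<lambda>t. gPQ P (f t)) ts) \<le> osc f P"
  unfolding osc_chains by (rule cSup_upper[OF _ osum_chain_bounded]) blast+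

lemma chain_Nil: "chain []"
  by (simp add: chain_def)

lemma osc_le:
  assumes "\<And>ts. chain ts \<Longrightarrow> osum (map (\<lambda>t. gPQ P (f t)) ts) \<le> B"
  shows "osc f P \<le> B"
  unfolding osc_chains by (rule cSup_least) (use assms chain_Nil in blast)+

lemma osc_nonneg: "path f \<Longrightarrow> 0 \<le> osc f P"
  using osc_ge[of f "[]" P] chain_Nil by simp

lemma osc_le_reparam:
  assumes g: "path g" and mono: "mono_on {0..1} \<theta>" and maps: "\<And>t. t \<in> {0..1} \<Longrightarrow> \<theta> t \<in> {0..1}"
    and eq: "\<And>t. t \<in> {0..1} \<Longrightarrow> gPQ P (f t) = gPQ P (g (\<theta> t))"
  shows "osc f P \<le> osc g P"
proof (rule osc_le)
  fix ts assume ts: "chain ts"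
  have "chain (map \<theta> ts)"
    using ts maps unfolding chain_def sorted_map
    by (auto intro!: sorted_wrt_mono_rel[of ts "(\<le>)"] monotone_onD[OF mono] simp: subset_iff)
  moreover have "map (\<lambda>t. gPQ P (f t)) ts = map (\<lambda>t. gPQ P (g t)) (map \<theta> ts)"
    using ts eq by (auto simp: chain_def subset_iff)
  ultimately show "osum (map (\<lambda>t. gPQ P (f t)) ts) \<le> osc g P" using osc_ge[OF g] by metis
qed

definition Tterm :: "(nat \<Rightarrow> linepair) \<Rightarrow> (real \<Rightarrow> real^2) \<Rightarrow> nat \<Rightarrow> real" where
  "Tterm L f i = (1/2) ^ (Suc i) * (osc f (L i) / (1 + osc f (L i)))"

lemma saturation_mono:
  fixes a b :: real
  assumes "0 \<le> a"
  shows "a \<le> b \<Longrightarrow> a / (1 + a) \<le> b / (1 + b)" "a < b \<Longrightarrow> a / (1 + a) < b / (1 + b)"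
  using assms by (auto simp: field_simps)

lemma Tterm_bounds: "path f \<Longrightarrow> 0 \<le> Tterm L f i \<and> Tterm L f i \<le> (1/2) ^ Suc i"
  using osc_nonneg[of f "L i"] mult_left_le[of "osc f (L i) / (1 + osc f (L i))" "(1/2) ^ Suc i"]
  unfolding Tterm_def by simp

lemma summable_Tterm: "path f \<Longrightarrow> summable (Tterm L f)"
  by (rule summable_comparison_test[of _ "\<lambda>i. (1/2) ^ Suc i"])
     (use Tterm_bounds in \<open>auto intro!: exI[of _ 0] summable_mult summable_geometric\<close>)

lemma Tfun_eq: "Tfun L f = suminf (Tterm L f)"
  by (simp add: Tfun_def Tterm_def[abs_def])

lemma Tterm_mono: "path f \<Longrightarrow> osc f (L i) \<le> osc g (L i) \<Longrightarrow> Tterm L f i \<le> Tterm L g i"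
  unfolding Tterm_def by (intro mult_left_mono saturation_mono osc_nonneg) auto

lemma Tfun_mono:
  assumes "path f" "path g" "\<And>i. osc f (L i) \<le> osc g (L i)"
  shows "Tfun L f \<le> Tfun L g"
  unfolding Tfun_eq by (intro suminf_le summable_Tterm Tterm_mono assms)

lemma Tfun_strict_mono:
  assumes "path f" "path g" "\<And>i. osc f (L i) \<le> osc g (L i)" "osc f (L j) < osc g (L j)"
  shows "Tfun L f < Tfun L g"
proof -
  have "0 < (\<Sum>i. Tterm L g i - Tterm L f i)"
  proof (rule suminf_pos2[of _ j])
    show "summable (\<lambda>i. Tterm L g i - Tterm L f i)" by (intro summable_diff summable_Tterm assms)
    show "0 \<le> Tterm L g i - Tterm L f i" for i using Tterm_mono[OF assms(1) assms(3)] by simp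
    show "0 < Tterm L g j - Tterm L f j"
      unfolding Tterm_def diff_gt_0_iff_gt
      by (intro mult_strict_left_mono saturation_mono(2) osc_nonneg assms) simp
  qed
  then show ?thesis unfolding Tfun_eq by (subst (asm) suminf_diff[symmetric]) (simp_all add: summable_Tterm assms)
qed

lemma dense_separates:
  assumes L: "dense_linepair_seq L" and u: "norm u = 1" and c: "c1 < c2" "0 < d"
    and A: "\<And>x. x \<in> A \<Longrightarrow> norm x \<le> M \<and> u \<bullet> x \<le> c1 - d" and B: "\<And>x. x \<in> B \<Longrightarrow> norm x \<le> M \<and> c2 + d \<le> u \<bullet> x"
  obtains i where "\<And>x. x \<in> A \<Longrightarrow> gPQ (L i) x = -1" "\<And>x. x \<in> B \<Longrightarrow> gPQ (L i) x = 1"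
proof -
  define M' where "M' = max M 0"
  \<comment> \<open>For points of norm at most \<open>M'\<close>, a change of the normal by
    \<open>e\<close> moves an inner product by at most \<open>e * M'\<close>, and a change of the
    offset adds another \<open>e\<close>; together they fit into the margin \<open>d\<close>. The
    second bound keeps the two lines in order.\<close>
  define e where "e = min (d / (M' + 1)) ((c2 - c1) / 2)"
  have M': "0 \<le> M'" "M \<le> M'" by (auto simp: M'_def)
  have e: "0 < e" using c M' by (simp add: e_def)
  have eM: "e * M' + e \<le> d"
  proof -
    have "e * (M' + 1) \<le> d / (M' + 1) * (M' + 1)" by (rule mult_right_mono) (use M' in \<open>auto simp: e_def\<close>)
    also have "\<dots> = d" using M' by simp
    finally show ?thesis by (simp only: distrib_left mult_1_right)
  qed
  have "e \<le> (c2 - c1) / 2" unfolding e_def by (rule min.cobounded2)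
  then have ec: "2 * e \<le> c2 - c1" by simp
  have "(u, c1, c2) \<in> linepair_space" using u c by (simp add: linepair_space_def)
  then have "(u, c1, c2) \<in> closure (range L \<union> lp_flip ` range L)"
    using L unfolding dense_linepair_seq_def by blast
  then obtain y where y: "y \<in> range L \<union> lp_flip ` range L" "dist y (u, c1, c2) < e"
    using e unfolding closure_approachable by blast
  obtain u' d1 d2 where y': "y = (u', d1, d2)" by (cases y)
  have "dist u' u < e" "dist (d1, d2) (c1, c2) < e"
    using y(2) dist_fst_le[of y "(u, c1, c2)"] dist_snd_le[of y "(u, c1, c2)"] by (simp_all add: y')
  then have cl: "norm (u' - u) < e" "\<bar>d1 - c1\<bar> < e" "\<bar>d2 - c2\<bar> < e"
    using dist_fst_le[of "(d1, d2)" "(c1, c2)"] dist_snd_le[of "(d1, d2)" "(c1, c2)"]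
    by (simp_all add: dist_norm)
  have dd: "d1 < d2" using cl ec by linarith
  have ip: "\<bar>u' \<bullet> x - u \<bullet> x\<bar> \<le> e * M'" if "norm x \<le> M" for x
  proof -
    have "\<bar>(u' - u) \<bullet> x\<bar> \<le> norm (u' - u) * norm x" by (rule Cauchy_Schwarz_ineq2)
    also have "\<dots> \<le> e * M'" by (rule mult_mono) (use cl that M' e in auto)
    finally show ?thesis by (simp add: inner_diff_left)
  qed
  have gy: "gPQ y x = gfun (-3 + 6 * ((u' \<bullet> x - d1) / (d2 - d1)))" for x
    by (simp add: y' gPQ_def)
  have g1: "gfun (-3 + 6 * r) = -1" if "r \<le> 0" for r using that by (simp add: gfun_def)
  have g2: "gfun (-3 + 6 * r) = 1" if "1 \<le> r" for r using that by (simp add: gfun_def)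
  have "gPQ y x = -1" if "x \<in> A" for x
  proof -
    have "u' \<bullet> x \<le> d1" using ip[of x] A[OF that] cl eM by linarith
    then have "(u' \<bullet> x - d1) / (d2 - d1) \<le> 0" using dd by (intro divide_nonpos_pos) auto
    then show ?thesis unfolding gy by (rule g1)
  qed
  moreover have "gPQ y x = 1" if "x \<in> B" for x
  proof -
    have "d2 \<le> u' \<bullet> x" using ip[of x] B[OF that] cl eM by linarith
    then have "1 \<le> (u' \<bullet> x - d1) / (d2 - d1)" using dd by simp
    then show ?thesis unfolding gy by (rule g2)
  qed
  moreover obtain i where "y = L i \<or> y = lp_flip (L i)" using y(1) by blast
  ultimately show thesis using that[of i] gPQ_flip by metis
qed

definition tight :: "(real^2) set \<Rightarrow> (real \<Rightarrow> real^2) \<Rightarrow> bool" where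
  "tight X a \<longleftrightarrow> path a \<and> path_image a \<subseteq> X \<and> (\<forall>s t. 0 \<le> s \<and> s < t \<and> t \<le> 1 \<and> closed_segment (a s) (a t) \<subseteq> X \<and>
     homotopic_paths X (subpath s t a) (linepath (a s) (a t)) \<longrightarrow> a ` {s..t} \<subseteq> closed_segment (a s) (a t))"

text \<open>\<open>\<theta> x\<close> is the least time at which \<open>g\<close> takes the value
  \<open>\<phi> x\<close>. By the intermediate value theorem \<open>g\<close> has passed through
  \<open>\<phi> x\<close> no later than at \<open>\<theta> y\<close> if \<open>x \<le> y\<close>, so
  these times are ordered.\<close>

lemma monotone_selection:
  fixes g \<phi> :: "real \<Rightarrow> real"
  assumes g: "continuous_on {s..t} g" and st: "s \<le> t" and \<phi>: "mono_on {s..t} \<phi>"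
    and between: "\<And>x. x \<in> {s..t} \<Longrightarrow> g s \<le> \<phi> x \<and> \<phi> x \<le> g t"
  obtains \<theta> where "mono_on {s..t} \<theta>" "\<And>x. x \<in> {s..t} \<Longrightarrow> \<theta> x \<in> {s..t} \<and> g (\<theta> x) = \<phi> x"
proof -
  have "\<forall>x\<in>{s..t}. \<exists>y. y \<in> {s..t} \<and> g y = \<phi> x \<and> (\<forall>z\<in>{s..t}. g z = \<phi> x \<longrightarrow> y \<le> z)"
  proof
    fix x assume x: "x \<in> {s..t}"
    let ?S = "{s..t} \<inter> g -` {\<phi> x}"
    have "closed ?S" using continuous_closed_preimage[OF g] by auto
    then have "compact ?S" using compact_Int_closed[OF compact_Icc, of ?S s t] by (simp add: Int_absorb1 Int_assoc[symmetric])
    moreover have "?S \<noteq> {}" using IVT'[of g s "\<phi> x" t] between[OF x] st g by auto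
    ultimately obtain y where "y \<in> ?S" "\<forall>z\<in>?S. y \<le> z" using compact_attains_inf by metis
    then show "\<exists>y. y \<in> {s..t} \<and> g y = \<phi> x \<and> (\<forall>z\<in>{s..t}. g z = \<phi> x \<longrightarrow> y \<le> z)" by auto
  qed
  from bchoice[OF this] obtain \<theta> where \<theta>: "\<And>x. x \<in> {s..t} \<Longrightarrow> \<theta> x \<in> {s..t}" "\<And>x. x \<in> {s..t} \<Longrightarrow> g (\<theta> x) = \<phi> x"
    "\<And>x z. x \<in> {s..t} \<Longrightarrow> z \<in> {s..t} \<Longrightarrow> g z = \<phi> x \<Longrightarrow> \<theta> x \<le> z" by blast
  have "mono_on {s..t} \<theta>"
  proof (rule mono_onI)
    fix x y assume xy: "x \<in> {s..t}" "y \<in> {s..t}" "x \<le> y"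
    have "\<phi> x \<le> g (\<theta> y)" using mono_onD[OF \<phi> xy] \<theta>(2)[OF xy(2)] by simp
    moreover have "continuous_on {s..\<theta> y} g" using continuous_on_subset[OF g] \<theta>(1)[OF xy(2)] by auto
    ultimately obtain z where "s \<le> z" "z \<le> \<theta> y" "g z = \<phi> x"
      using IVT'[of g s "\<phi> x" "\<theta> y"] between[OF xy(1)] \<theta>(1)[OF xy(2)] by auto
    then show "\<theta> x \<le> \<theta> y" using \<theta>(3)[OF xy(1), of z] \<theta>(1)[OF xy(2)] by auto
  qed
  then show thesis using that \<theta>(1,2) by blast
qed

text \<open>\<open>gPQ\<close> sees only the inner product with \<open>u\<close>, which is monotone
  along a chord. The original subpath takes the same values between the same ends and can be sampled
  in the same order, so every chain for the splice is matched by a chain for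
  \<open>a\<close>.\<close>

lemma osc_chord_splice_le:
  assumes a: "path a" and st: "0 \<le> s" "s < t" "t \<le> 1"
  shows "osc (chord_splice a s t) P \<le> osc a P"
proof -
  obtain u c1 c2 where P: "P = (u, c1, c2)" by (cases P)
  let ?\<phi> = "\<lambda>x. u \<bullet> chord_splice a s t x" and ?g = "\<lambda>x. u \<bullet> a x"
  define k where "k = (u \<bullet> a t - u \<bullet> a s) / (t - s)"
  have \<phi>: "?\<phi> x = ?g s + k * (x - s)" if "x \<in> {s..t}" for x
  proof -
    define z where "z = (x - s) / (t - s)"
    have "?\<phi> x = u \<bullet> linepath (a s) (a t) z" using that st chord_splice_inside[of s t x a] by (simp add: z_def)
    also have "\<dots> = ?g s + z * (?g t - ?g s)" by (simp add: linepath_def inner_right_distrib algebra_simps)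
    also have "z * (?g t - ?g s) = k * (x - s)" by (simp add: z_def k_def)
    finally show ?thesis .
  qed
  have kt: "?g t = ?g s + k * (t - s)" using st by (simp add: k_def)
  have g: "continuous_on {s..t} ?g"
  proof -
    have "continuous_on {s..t} a"
      by (rule continuous_on_subset[of "{0..1}"]) (use a st in \<open>auto simp: path_def\<close>)
    then show ?thesis by (intro continuous_intros)
  qed
  obtain \<theta> where \<theta>: "mono_on {s..t} \<theta>" "\<And>x. x \<in> {s..t} \<Longrightarrow> \<theta> x \<in> {s..t} \<and> ?g (\<theta> x) = ?\<phi> x"
  proof (cases "0 \<le> k")
    case True
    have "mono_on {s..t} ?\<phi>" using \<phi> True by (auto intro!: mono_onI mult_left_mono)
    moreover have "?g s \<le> ?\<phi> x \<and> ?\<phi> x \<le> ?g t" if "x \<in> {s..t}" for x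
      using that True by (simp add: \<phi> kt mult_left_mono)
    ultimately show thesis using monotone_selection[OF g less_imp_le[OF st(2)], of ?\<phi>] that by blast
  next
    case False
    have "mono_on {s..t} (\<lambda>x. - ?\<phi> x)" using \<phi> False by (auto intro!: mono_onI mult_left_mono_neg)
    moreover have "- ?g s \<le> - ?\<phi> x \<and> - ?\<phi> x \<le> - ?g t" if "x \<in> {s..t}" for x
      using that False mult_left_mono_neg[of "x - s" "t - s" k] by (simp add: \<phi> kt mult_nonpos_nonneg)
    moreover have "continuous_on {s..t} (\<lambda>x. - ?g x)" by (intro continuous_intros g)
    ultimately obtain \<theta> where "mono_on {s..t} \<theta>" "\<And>x. x \<in> {s..t} \<Longrightarrow> \<theta> x \<in> {s..t} \<and> - ?g (\<theta> x) = - ?\<phi> x"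
      using monotone_selection[of s t "\<lambda>x. - ?g x" "\<lambda>x. - ?\<phi> x"] st(2) by (metis less_imp_le)
    then show thesis using that by simp
  qed
  define \<theta>' where "\<theta>' x = (if x \<in> {s..t} then \<theta> x else x)" for x
  show ?thesis
  proof (rule osc_le_reparam[OF a, of \<theta>'])
    show "mono_on {0..1} \<theta>'"
    proof (rule mono_onI)
      fix x y :: real assume "x \<le> y"
      then show "\<theta>' x \<le> \<theta>' y"
        using mono_onD[OF \<theta>(1), of x y] \<theta>(2)[of x] \<theta>(2)[of y] by (auto simp: \<theta>'_def)
    qed
    show "\<theta>' x \<in> {0..1}" if "x \<in> {0..1}" for x using that \<theta>(2)[of x] st by (auto simp: \<theta>'_def)
    show "gPQ P (chord_splice a s t x) = gPQ P (a (\<theta>' x))" if "x \<in> {0..1}" for x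
    proof (cases "x \<in> {s..t}")
      case True
      then show ?thesis using \<theta>(2)[OF True] by (simp add: \<theta>'_def P gPQ_def)
    next
      case False
      then show ?thesis using chord_splice_outside[OF st(2), of x a] by (auto simp: \<theta>'_def)
    qed
  qed
qed

lemma osum_ones:
  assumes "set Y \<subseteq> {1}"
  shows "osum (1 # Y @ Z) \<le> osum (1 # Z)"
  using assms by (induction Y) auto

text \<open>If \<open>Y\<close> is nonempty, collapsing its ones costs nothing and the excursion to
  -1 gains 2. If \<open>Y\<close> is empty between neighbours \<open>x\<close> and \<open>z\<close>,
  the gain is \<open>1 + (1 - x) * (1 - z)\<close>, which is at least 1; if a neighbour is missing,
  attaching the excursion on the other side costs at most 1 of the 2.\<close>

lemma osum_insert_excursion:
  assumes X: "set X \<subseteq> {-1..1}" and Y: "set Y \<subseteq> {1}" and Z: "set Z \<subseteq> {-1..1}"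
  shows "osum (X @ Y @ Z) + 1 \<le> osum (X @ [1, -1, 1] @ Z)"
proof -
  have e: "osum (X @ [1, -1, 1] @ Z) = osum (X @ [1]) + 2 + osum (1 # Z)"
    using osum_append[of X 1 "[-1, 1] @ Z"] by simp
  show ?thesis
  proof (cases Y)
    case (Cons y Y')
    then have "osum (X @ Y @ Z) = osum (X @ [1]) + osum (1 # Y' @ Z)"
      using Y osum_append[of X 1 "Y' @ Z"] by simp
    then show ?thesis using e osum_ones[of Y' Z] Y Cons by auto
  next
    case Nil
    show ?thesis
    proof (cases "X = [] \<or> Z = []")
      case True
      have "osum Z \<le> osum (1 # Z) + 1" using Z by (cases Z) auto
      moreover have "osum X \<le> osum (X @ [1]) + 1"
      proof (cases X rule: rev_cases)
        case (snoc X' x)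
        then show ?thesis using X osum_append[of X' x "[1]"] by auto
      qed simp
      ultimately show ?thesis using True e Nil by auto
    next
      case False
      then obtain X' x z Z' where xz: "X = X' @ [x]" "Z = z # Z'" by (metis list.exhaust rev_exhaust)
      have "osum (X @ Y @ Z) = osum (X' @ [x]) - x * z + osum (z # Z')"
        using osum_append[of X' x "z # Z'"] xz Nil by simp
      moreover have "osum (X @ [1]) = osum (X' @ [x]) - x" using osum_append[of X' x "[1]"] xz by simp
      moreover have "0 \<le> (1 - x) * (1 - z)" using X Z xz by (intro mult_nonneg_nonneg) auto
      ultimately show ?thesis using e xz by (simp add: algebra_simps)
    qed
  qed
qed

lemma sorted_filter_decomp:
  fixes s t :: real
  assumes "sorted ts" "s < t"
  shows "ts = filter (\<lambda>x. x < s) ts @ filter (\<lambda>x. s \<le> x \<and> x \<le> t) ts @ filter (\<lambda>x. t < x) ts"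
  using assms
proof (induction ts)
  case (Cons x ts)
  have le: "x \<le> y" if "y \<in> set ts" for y using Cons.prems that by auto
  consider "x < s" | "s \<le> x" "x \<le> t" | "t < x" by linarith
  then show ?case
  proof cases
    case 1
    then show ?thesis using Cons by simp
  next
    case 2
    then have "filter (\<lambda>x. x < s) ts = []" using le by (fastforce simp: filter_empty_conv)
    then show ?thesis using Cons 2 by simp
  next
    case 3
    then have "filter (\<lambda>x. x < s) ts = []" "filter (\<lambda>x. s \<le> x \<and> x \<le> t) ts = []"
      using le Cons.prems(2) by (fastforce simp: filter_empty_conv)+
    then show ?thesis using Cons 3 by simp
  qed
qed simp

text \<open>The times of a chain that fall into \<open>{s..t}\<close> see only the value 1 on the
  chord. Exchanging them for \<open>s\<close>, \<open>m\<close>, \<open>t\<close> gives a chain for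
  \<open>a\<close> whose sum is larger by at least 1, and a uniform gain survives the
  supremum.\<close>

lemma osc_chord_splice_less:
  assumes a: "path a" and st: "0 \<le> s" "s < t" "t \<le> 1" and m: "m \<in> {s..t}" "gPQ P (a m) = -1"
    and seg: "\<And>x. x \<in> closed_segment (a s) (a t) \<Longrightarrow> gPQ P x = 1"
  shows "osc (chord_splice a s t) P < osc a P"
proof -
  let ?b = "chord_splice a s t"
  have "osc ?b P \<le> osc a P - 1"
  proof (rule osc_le)
    fix ts assume ts: "chain ts"
    define xs ys zs where "xs = filter (\<lambda>x. x < s) ts" and "ys = filter (\<lambda>x. s \<le> x \<and> x \<le> t) ts" and "zs = filter (\<lambda>x. t < x) ts"
    have dec: "ts = xs @ ys @ zs" unfolding xs_def ys_def zs_def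
      using sorted_filter_decomp[OF _ st(2)] ts by (simp add: chain_def)
    let ?X = "map (\<lambda>t. gPQ P (a t)) xs" and ?Y = "map (\<lambda>t. gPQ P (?b t)) ys" and ?Z = "map (\<lambda>t. gPQ P (a t)) zs"
    have bd: "gPQ P x \<in> {-1..1}" for x using gPQ_bounds[of P x] by (auto simp: abs_le_iff)
    have Y: "set ?Y \<subseteq> {1}"
    proof -
      have "gPQ P (?b y) = 1" if "y \<in> set ys" for y
      proof -
        have y: "s \<le> y" "y \<le> t" using that by (auto simp: ys_def)
        then have "(y - s) / (t - s) \<in> {0..1}" using st by auto
        then have "?b y \<in> closed_segment (a s) (a t)"
          unfolding chord_splice_inside[OF st(2) y] by (rule linepath_in_path)
        then show ?thesis by (rule seg)
      qed
      then show ?thesis by auto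
    qed
    have "map (\<lambda>t. gPQ P (?b t)) ts = ?X @ ?Y @ ?Z"
      using chord_splice_outside[OF st(2), of _ a] by (subst dec) (auto simp: xs_def zs_def)
    then have "osum (map (\<lambda>t. gPQ P (?b t)) ts) + 1 \<le> osum (?X @ [1, -1, 1] @ ?Z)"
      using osum_insert_excursion[OF _ Y, of ?X ?Z] bd by (simp only: set_map image_subset_iff) blast
    also have "?X @ [1, -1, 1] @ ?Z = map (\<lambda>t. gPQ P (a t)) (xs @ [s, m, t] @ zs)"
      using seg m by simp
    also have "osum \<dots> \<le> osc a P"
    proof (rule osc_ge[OF a])
      have "sorted xs" "sorted zs" "set xs \<subseteq> {0..1}" "set zs \<subseteq> {0..1}"
        using ts by (auto simp: xs_def zs_def chain_def sorted_wrt_filter)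
      moreover have "\<forall>x\<in>set xs. x < s" "\<forall>x\<in>set zs. t < x" by (auto simp: xs_def zs_def)
      ultimately show "chain (xs @ [s, m, t] @ zs)"
        unfolding chain_def using m st by (auto simp: sorted_append intro: less_imp_le) force+
    qed
    finally show "osum (map (\<lambda>t. gPQ P (?b t)) ts) \<le> osc a P - 1" by simp
  qed
  then show ?thesis by simp
qed

lemma shorten_if_not_tight:
  assumes L: "dense_linepair_seq L" and a: "path a" "path_image a \<subseteq> X" and nt: "\<not> tight X a"
  obtains b where "homotopic_paths X a b" "\<And>P. osc b P \<le> osc a P" "Tfun L b < Tfun L a"
proof -
  obtain s t m where st: "0 \<le> s" "s < t" "t \<le> 1" and seg: "closed_segment (a s) (a t) \<subseteq> X"
    and hom: "homotopic_paths X (subpath s t a) (linepath (a s) (a t))"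
    and m: "m \<in> {s..t}" "a m \<notin> closed_segment (a s) (a t)"
    using nt a unfolding tight_def by blast
  let ?S = "closed_segment (a s) (a t)" and ?b = "chord_splice a s t"
  obtain v c where v: "v \<bullet> a m < c" "\<And>x. x \<in> ?S \<Longrightarrow> c < v \<bullet> x"
    using separating_hyperplane_closed_point[OF convex_closed_segment closed_segment m(2)] by metis
  have vs: "c < v \<bullet> a s" "c < v \<bullet> a t" using v(2) by auto
  then have v0: "v \<noteq> 0" using v(1) by auto
  define u where "u = v /\<^sub>R norm v"
  have nu: "norm u = 1" using v0 by (simp add: u_def)
  have uv: "u \<bullet> x = (v \<bullet> x) / norm v" for x by (simp add: u_def divide_inverse mult.commute)
  define lo hi where "lo = u \<bullet> a m" and "hi = min (u \<bullet> a s) (u \<bullet> a t)"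
  have lh: "lo < hi" using v(1) vs v0 unfolding lo_def hi_def uv by (auto simp: divide_strict_right_mono)
  have hiS: "hi \<le> u \<bullet> x" if "x \<in> ?S" for x
  proof -
    have "convex {x. hi \<le> u \<bullet> x}" using convex_halfspace_ge[of hi u] by simp
    then have "?S \<subseteq> {x. hi \<le> u \<bullet> x}" by (rule closed_segment_subset[rotated 2]) (auto simp: hi_def)
    then show ?thesis using that by blast
  qed
  have "bounded (insert (a m) ?S)" by (simp add: bounded_closed_segment)
  then obtain M where M: "\<And>x. x \<in> insert (a m) ?S \<Longrightarrow> norm x \<le> M"
    unfolding bounded_iff by blast
  \<comment> \<open>A quarter of the gap is the margin on either side; the remaining half separates
    the two lines.\<close>
  define d where "d = (hi - lo) / 4"
  have d: "0 < d" using lh by (simp add: d_def)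
  obtain i where i: "gPQ (L i) (a m) = -1" "\<And>x. x \<in> ?S \<Longrightarrow> gPQ (L i) x = 1"
  proof (rule dense_separates[OF L nu, of "lo + d" "hi - d" d "{a m}" M ?S])
    have "hi - lo = 4 * d" by (simp add: d_def)
    then show "lo + d < hi - d" using d by linarith
    show "0 < d" by (rule d)
    show "norm x \<le> M \<and> u \<bullet> x \<le> lo + d - d" if "x \<in> {a m}" for x using that M by (auto simp: lo_def)
    show "norm x \<le> M \<and> hi - d + d \<le> u \<bullet> x" if "x \<in> ?S" for x using M hiS that by simp
    fix i assume "\<And>x. x \<in> {a m} \<Longrightarrow> gPQ (L i) x = -1" "\<And>x. x \<in> ?S \<Longrightarrow> gPQ (L i) x = 1"
    then show thesis using that[of i] by blast
  qed
  note le = osc_chord_splice_le[OF a(1) st]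
  have "osc ?b (L i) < osc a (L i)" by (rule osc_chord_splice_less[OF a(1) st m(1) i])
  then have "Tfun L ?b < Tfun L a" by (rule Tfun_strict_mono[OF path_chord_splice[OF a(1) st] a(1) le])
  then show thesis using that[OF homotopic_chord_splice[OF a st seg hom] le] by blast
qed

section \<open>Existence of tight representatives\<close>

fun flips :: "real list \<Rightarrow> nat" where
  "flips (x # y # zs) = (if x * y = -1 then 1 else 0) + flips (y # zs)"
| "flips _ = 0"

text \<open>Neighbours of equal sign may make the sum of a chain smaller than its number of flips.
  Dropping suitable times leaves an alternating list of values 1 and -1 that still pays 1 for every
  flip. The last conjunct strengthens the induction: the next flip has to find the value of the old
  head at the head of the selected list.\<close>

lemma alternating_subchain:
  fixes g :: "real \<Rightarrow> real"
  assumes "sorted ts" "\<And>t. \<bar>g t\<bar> \<le> 1"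
  shows "\<exists>us. sorted us \<and> set us \<subseteq> set ts \<and> (\<forall>t\<in>set us. \<bar>g t\<bar> = 1) \<and> real (flips (map g ts)) \<le> osum (map g us) \<and>
    (ts \<noteq> [] \<and> \<bar>g (hd ts)\<bar> = 1 \<longrightarrow> us \<noteq> [] \<and> g (hd us) = g (hd ts))"
  using assms(1)
proof (induction ts rule: induct_list012)
  case 1
  show ?case by (intro exI[of _ "[]"]) simp
next
  case (2 x)
  show ?case by (intro exI[of _ "if \<bar>g x\<bar> = 1 then [x] else []"]) simp
next
  case (3 x y zs)
  obtain us where us: "sorted us" "set us \<subseteq> set (y # zs)" "\<forall>t\<in>set us. \<bar>g t\<bar> = 1"
    "real (flips (map g (y # zs))) \<le> osum (map g us)" "\<bar>g y\<bar> = 1 \<longrightarrow> us \<noteq> [] \<and> g (hd us) = g y"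
    using 3 by auto
  have xle: "\<forall>t\<in>set us. x \<le> t" using us(2) 3(3) by auto
  have cons: "osum (map g (x # us)) = - g x * g (hd us) + osum (map g us)" if "us \<noteq> []"
    using that by (cases us) auto
  show ?case
  proof (cases "g x * g y = -1")
    case True
    then have "\<bar>g x\<bar> * \<bar>g y\<bar> = 1" by (simp add: abs_mult[symmetric])
    moreover have "\<bar>g x\<bar> * \<bar>g y\<bar> \<le> \<bar>g y\<bar>" "\<bar>g x\<bar> * \<bar>g y\<bar> \<le> \<bar>g x\<bar>"
      using assms(2) by (simp_all add: mult_left_le mult_left_le_one_le)
    ultimately have a: "\<bar>g y\<bar> = 1" "\<bar>g x\<bar> = 1" using assms(2)[of x] assms(2)[of y] by linarith+
    then have b: "us \<noteq> []" "g (hd us) = g y" using us(5) by auto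
    then have "osum (map g (x # us)) = 1 + osum (map g us)" using cons True by simp
    then show ?thesis
      by (intro exI[of _ "x # us"]) (use us xle a True in auto)
  next
    case False
    then have fl: "flips (map g (x # y # zs)) = flips (map g (y # zs))" by simp
    show ?thesis
    proof (cases "\<bar>g x\<bar> = 1 \<and> (us = [] \<or> g (hd us) \<noteq> g x)")
      case True
      have "osum (map g us) \<le> osum (map g (x # us))"
      proof (cases "us = []")
        case ne: False
        then have "\<bar>g (hd us)\<bar> = 1" "g (hd us) \<noteq> g x" using us(3) True by auto
        then have "- g x * g (hd us) = 1" using True by (auto simp: abs_if split: if_splits)
        then show ?thesis using cons[OF ne] by simp
      qed simp
      then show ?thesis
        by (intro exI[of _ "x # us"]) (use us xle True fl in auto)
    next
      case nt: False
      show ?thesis by (intro exI[of _ us]) (use us fl nt in auto)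
    qed
  qed
qed

lemma flips_le_osc:
  assumes "path f" "chain ts"
  shows "real (flips (map (\<lambda>t. gPQ P (f t)) ts)) \<le> osc f P"
proof -
  obtain us where "sorted us" "set us \<subseteq> set ts" "real (flips (map (\<lambda>t. gPQ P (f t)) ts)) \<le> osum (map (\<lambda>t. gPQ P (f t)) us)"
    using alternating_subchain[of ts "\<lambda>t. gPQ P (f t)"] assms(2) gPQ_bounds unfolding chain_def by blast
  moreover from this have "chain us" using assms(2) by (auto simp: chain_def)
  ultimately show ?thesis using osc_ge[OF assms(1)] order_trans by blast
qed

definition jump_chain :: "real \<Rightarrow> (real \<Rightarrow> 'a::metric_space) \<Rightarrow> real list \<Rightarrow> bool" where
  "jump_chain e f ts \<longleftrightarrow> chain ts \<and> successively (\<lambda>s t. e \<le> dist (f s) (f t)) ts"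

text \<open>Each jump of the chain is a flip for at least one pair of lines in \<open>F\<close>, so
  the flips for all these pairs together count every jump.\<close>

lemma jump_chain_length:
  fixes f :: "real \<Rightarrow> real^2"
  assumes F: "finite F" and f: "f ` {0..1} \<subseteq> X" "jump_chain e f ts"
    and sep: "\<And>x y. x \<in> X \<Longrightarrow> y \<in> X \<Longrightarrow> e \<le> dist x y \<Longrightarrow> \<exists>k\<in>F. gPQ (L k) x * gPQ (L k) y = -1"
  shows "length ts \<le> 1 + (\<Sum>k\<in>F. flips (map (\<lambda>t. gPQ (L k) (f t)) ts))"
  using f(2)
proof (induction ts rule: induct_list012)
  case (3 x y zs)
  have xy: "f x \<in> X" "f y \<in> X" "e \<le> dist (f x) (f y)" "jump_chain e f (y # zs)"
    using 3(3) f(1) by (auto simp: jump_chain_def chain_def)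
  obtain k where k: "k \<in> F" "gPQ (L k) (f x) * gPQ (L k) (f y) = -1" using sep[OF xy(1,2,3)] by blast
  have "(1::nat) \<le> (\<Sum>k\<in>F. if gPQ (L k) (f x) * gPQ (L k) (f y) = -1 then 1 else 0)"
    using member_le_sum[OF k(1), of "\<lambda>k. if gPQ (L k) (f x) * gPQ (L k) (f y) = -1 then 1 else (0::nat)"] k(2) F by simp
  then show ?case using 3(2)[OF xy(4)] by (simp add: sum.distrib)
qed auto

text \<open>A finite cover of \<open>X\<close> by balls of radius \<open>e/8\<close> reduces the
  claim to finitely many pairs of balls. Points at distance at least \<open>e\<close> have centers
  at distance at least \<open>3 * e / 4\<close>; lines at \<open>e/4\<close> from the centers leave
  a margin \<open>e/8\<close> outside the balls and a gap of at least \<open>e/4\<close> between the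
  lines.\<close>

lemma dense_separates_far_points:
  assumes L: "dense_linepair_seq L" and X: "compact X" and e: "0 < e"
  obtains F where "finite F" "\<And>x y. x \<in> X \<Longrightarrow> y \<in> X \<Longrightarrow> e \<le> dist x y \<Longrightarrow> \<exists>k\<in>F. gPQ (L k) x * gPQ (L k) y = -1"
proof -
  obtain D where D: "finite D" "X \<subseteq> (\<Union>c\<in>D. ball c (e/8))"
    using X e unfolding compact_eq_totally_bounded by (metis divide_pos_pos zero_less_numeral)
  have "\<exists>k. \<forall>x\<in>ball a (e/8). \<forall>y\<in>ball b (e/8). gPQ (L k) x * gPQ (L k) y = -1" if ab: "3 * e / 4 \<le> dist a b" for a b :: "real^2"
  proof -
    define u where "u = (b - a) /\<^sub>R norm (b - a)"
    have ne: "norm (b - a) \<noteq> 0" using ab e by (auto simp: dist_norm)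
    have nu: "norm u = 1" using ne by (simp add: u_def)
    have "u \<bullet> b - u \<bullet> a = u \<bullet> (b - a)" by (rule inner_diff_right[symmetric])
    also have "\<dots> = ((b - a) \<bullet> (b - a)) / norm (b - a)"
      unfolding u_def inner_scaleR_left divide_inverse by (rule mult.commute)
    also have "\<dots> = norm (b - a)" using ne by (simp add: dot_square_norm power2_eq_square)
    finally have uab: "3 * e / 4 \<le> u \<bullet> b - u \<bullet> a" using ab by (simp add: dist_norm norm_minus_commute)
    have cs: "\<bar>u \<bullet> x - u \<bullet> c\<bar> \<le> e/8" "norm x \<le> norm c + e/8" if "x \<in> ball c (e/8)" for x c
    proof -
      have n: "norm (x - c) \<le> e/8" using that by (simp add: dist_norm norm_minus_commute)
      have "\<bar>u \<bullet> (x - c)\<bar> \<le> norm u * norm (x - c)" by (rule Cauchy_Schwarz_ineq2)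
      then show "\<bar>u \<bullet> x - u \<bullet> c\<bar> \<le> e/8" using n nu by (simp add: inner_diff_right)
      show "norm x \<le> norm c + e/8" using n norm_triangle_ineq2[of x c] by linarith
    qed
    have lt: "u \<bullet> a + e/4 < u \<bullet> b - e/4" using uab e by simp
    obtain k where "\<And>x. x \<in> ball a (e/8) \<Longrightarrow> gPQ (L k) x = -1" "\<And>x. x \<in> ball b (e/8) \<Longrightarrow> gPQ (L k) x = 1"
    proof (rule dense_separates[OF L nu lt, of "e/8" "ball a (e/8)" "max (norm a) (norm b) + e/8" "ball b (e/8)"])
      show "norm x \<le> max (norm a) (norm b) + e/8 \<and> u \<bullet> x \<le> u \<bullet> a + e/4 - e/8" if "x \<in> ball a (e/8)" for x
      proof
        show "norm x \<le> max (norm a) (norm b) + e/8" using cs(2)[OF that] by simp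
        have "u \<bullet> x - u \<bullet> a \<le> e/8" by (rule order_trans[OF abs_ge_self cs(1)[OF that]])
        then show "u \<bullet> x \<le> u \<bullet> a + e/4 - e/8" by simp
      qed
      show "norm x \<le> max (norm a) (norm b) + e/8 \<and> u \<bullet> b - e/4 + e/8 \<le> u \<bullet> x" if "x \<in> ball b (e/8)" for x
      proof
        show "norm x \<le> max (norm a) (norm b) + e/8" using cs(2)[OF that] by simp
        have "u \<bullet> b - u \<bullet> x \<le> e/8"
          using order_trans[OF abs_ge_minus_self cs(1)[OF that]] by (simp only: minus_diff_eq)
        then show "u \<bullet> b - e/4 + e/8 \<le> u \<bullet> x" by simp
      qed
    qed (use e in auto)
    then show ?thesis by (intro exI[of _ k]) simp
  qed
  then obtain K where K: "\<And>a b x y. 3 * e / 4 \<le> dist a b \<Longrightarrow> x \<in> ball a (e/8) \<Longrightarrow> y \<in> ball b (e/8) \<Longrightarrow> gPQ (L (K a b)) x * gPQ (L (K a b)) y = -1"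
    by metis
  show thesis
  proof (rule that[of "(\<lambda>(a,b). K a b) ` (D \<times> D)"])
    fix x y assume xy: "x \<in> X" "y \<in> X" "e \<le> dist x y"
    obtain a b where ab: "a \<in> D" "x \<in> ball a (e/8)" "b \<in> D" "y \<in> ball b (e/8)" using D(2) xy by blast
    have "dist x y \<le> dist a x + dist a b + dist b y" 
      using dist_triangle[of x y a] dist_triangle[of a y b] by (simp add: dist_commute)
    then have "3 * e / 4 \<le> dist a b" using xy(3) ab(2,4) by simp
    then show "\<exists>k\<in>(\<lambda>(a,b). K a b) ` (D \<times> D). gPQ (L k) x * gPQ (L k) y = -1"
      using K[OF _ ab(2,4)] ab(1,3) by auto
  qed (use D in auto)
qed

text \<open>The bound depends on \<open>X\<close>, \<open>e\<close> and \<open>B\<close> but not on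
  the path \<open>q\<close>; so one modulus of continuity will serve a whole minimizing sequence
  after reparametrization.\<close>

lemma jump_chain_bounded:
  assumes L: "dense_linepair_seq L" and X: "compact X" and e: "0 < e"
  obtains N :: nat where "\<And>q ts. path q \<Longrightarrow> path_image q \<subseteq> X \<Longrightarrow> (\<And>i. osc q (L i) \<le> B i) \<Longrightarrow> jump_chain e q ts \<Longrightarrow> length ts \<le> N"
proof -
  obtain F where F: "finite F" "\<And>x y. x \<in> X \<Longrightarrow> y \<in> X \<Longrightarrow> e \<le> dist x y \<Longrightarrow> \<exists>k\<in>F. gPQ (L k) x * gPQ (L k) y = -1"
    using dense_separates_far_points[OF assms] by metis
  define N where "N = nat \<lceil>1 + (\<Sum>k\<in>F. B k)\<rceil>"
  show thesis
  proof (rule that[of N])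
    fix q ts assume q: "path q" "path_image q \<subseteq> X" "\<And>i. osc q (L i) \<le> B i" "jump_chain e q ts"
    have "length ts \<le> 1 + (\<Sum>k\<in>F. flips (map (\<lambda>t. gPQ (L k) (q t)) ts))"
      by (rule jump_chain_length[OF F(1) _ q(4) F(2)]) (use q(2) in \<open>auto simp: path_image_def\<close>)
    then have "real (length ts) \<le> real (1 + (\<Sum>k\<in>F. flips (map (\<lambda>t. gPQ (L k) (q t)) ts)))" by (rule of_nat_mono)
    also have "\<dots> = 1 + (\<Sum>k\<in>F. real (flips (map (\<lambda>t. gPQ (L k) (q t)) ts)))" by simp
    also have "(\<Sum>k\<in>F. real (flips (map (\<lambda>t. gPQ (L k) (q t)) ts))) \<le> (\<Sum>k\<in>F. B k)"
      by (rule sum_mono) (use flips_le_osc[OF q(1)] q(3,4) order_trans in \<open>unfold jump_chain_def, blast\<close>)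
    finally show "length ts \<le> N" unfolding N_def by linarith
  qed
qed

text \<open>The time change is the generalized inverse of the strictly increasing function
  \<^term>\<open>\<lambda>t. t + (\<Sum>k. w k * \<nu> k t)\<close>, where \<^term>\<open>\<nu> k t\<close> is the maximal length of a chain of
  jumps of size at least \<^term>\<open>e k\<close> up to time \<^term>\<open>t\<close>.\<close>
lemma equicontinuous_reparametrization:
  fixes q :: "real \<Rightarrow> 'a::metric_space" and n :: "nat \<Rightarrow> nat"
  assumes q: "path q" and n: "\<And>k ts. jump_chain (e k) q ts \<Longrightarrow> length ts \<le> n k" and e: "\<And>k. 0 < e k"
  obtains \<eta> where "mono_on {0..1} \<eta>" "\<eta> ` {0..1} \<subseteq> {0..1}" "continuous_on {0..1} \<eta>" "\<eta> 0 = 0" "\<eta> 1 = 1"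
    "\<And>k x y. x \<in> {0..1} \<Longrightarrow> y \<in> {0..1} \<Longrightarrow> \<bar>x - y\<bar> < (1/2) ^ (k + 2) / (n k + 1) \<Longrightarrow> dist (q (\<eta> x)) (q (\<eta> y)) \<le> 2 * e k"
proof -
  define C where "C k t = {length ts | ts. jump_chain (e k) q ts \<and> set ts \<subseteq> {..t}}" for k t
  define \<nu> where "\<nu> k t = Max (C k t)" for k t
  have finC: "finite (C k t)" for k t
    by (rule finite_subset[of _ "{..n k}"]) (use n in \<open>auto simp: C_def\<close>)
  have neC: "0 \<in> C k t" for k t
    unfolding C_def by (auto intro!: exI[of _ "[]"] simp: jump_chain_def chain_def)
  have \<nu>n: "\<nu> k t \<le> n k" for k t
  proof -
    have "Max (C k t) \<in> C k t" by (rule Max_in[OF finC]) (use neC in blast)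
    then obtain ts where "Max (C k t) = length ts" "jump_chain (e k) q ts" unfolding C_def by blast
    then show ?thesis unfolding \<nu>_def using n by simp
  qed
  have \<nu>mono: "\<nu> k s \<le> \<nu> k t" if "s \<le> t" for k s t
    unfolding \<nu>_def
  proof (rule Max_mono[OF _ _ finC])
    show "C k s \<subseteq> C k t"
    proof
      fix l assume "l \<in> C k s"
      then obtain ts where ts: "l = length ts" "jump_chain (e k) q ts" "set ts \<subseteq> {..s}" unfolding C_def by blast
      have "set ts \<subseteq> {..t}" using ts(3) that by auto
      then show "l \<in> C k t" unfolding C_def using ts(1,2) by blast
    qed
    show "C k s \<noteq> {}" using neC by blast
  qed
  \<comment> \<open>A longest chain up to \<open>s\<close> cannot be extended by any time from
    \<open>s\<close> to \<open>t\<close>, so \<open>q s\<close> and \<open>q t\<close> are both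
    within \<open>e k\<close> of the value at its last time.\<close>
  have near: "dist (q s) (q t) \<le> 2 * e k" if st: "0 \<le> s" "s \<le> t" "t \<le> 1" and eq: "\<nu> k s = \<nu> k t" for k s t
  proof -
    have "\<nu> k s \<in> C k s" unfolding \<nu>_def by (rule Max_in[OF finC]) (use neC in blast)
    then obtain ts where ts: "length ts = \<nu> k s" "jump_chain (e k) q ts" "set ts \<subseteq> {..s}" by (auto simp: C_def)
    have ext: "\<not> jump_chain (e k) q (ts @ [r])" if "r \<in> {s..t}" for r
    proof
      assume "jump_chain (e k) q (ts @ [r])"
      then have "Suc (length ts) \<in> C k r" unfolding C_def using ts(3) that by (auto intro!: exI[of _ "ts @ [r]"])
      then have "Suc (length ts) \<le> \<nu> k r" unfolding \<nu>_def using finC by simp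
      also have "\<dots> \<le> \<nu> k t" using \<nu>mono that by simp
      finally show False using ts(1) eq by simp
    qed
    have ch: "chain (ts @ [r])" if "r \<in> {s..t}" for r
      using ts(2,3) that st by (auto simp: jump_chain_def chain_def sorted_append)
    have "ts \<noteq> []" using ext[of s] ch[of s] st by (auto simp: jump_chain_def)
    then have "dist (q (last ts)) (q r) < e k" if "r \<in> {s..t}" for r
      using ext[OF that] ch[OF that] ts(2) by (auto simp: jump_chain_def successively_append_iff)
    from this[of s] this[of t] show ?thesis
      using st dist_triangle3[of "q s" "q t" "q (last ts)"] by simp
  qed
  \<comment> \<open>\<open>\<nu> k\<close> is at most \<open>n k\<close>, so the weighted counts are
    dominated by a geometric series with sum 1, and the total increase of \<open>\<phi>\<close> on
    the unit interval lies between 1 and 2.\<close>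
  define w where "w k = (1/2) ^ Suc k / (n k + 1)" for k
  have w: "0 < w k" for k by (simp add: w_def)
  have wb: "0 \<le> w k * \<nu> k t" "w k * \<nu> k t \<le> (1/2) ^ Suc k" for k t
  proof -
    show "0 \<le> w k * \<nu> k t" using w[of k] by simp
    have "w k * \<nu> k t \<le> w k * (n k + 1)" using w[of k] \<nu>n[of k t] by (intro mult_left_mono) auto
    also have "\<dots> = (1/2) ^ Suc k"
    proof -
      have "a / c * c = a" if "c \<noteq> 0" for a c :: real using that by simp
      then show ?thesis unfolding w_def by this simp
    qed
    finally show "w k * \<nu> k t \<le> (1/2) ^ Suc k" .
  qed
  have geo: "summable (\<lambda>k. (1/2::real) ^ Suc k)" "(\<Sum>k. (1/2::real) ^ Suc k) = 1"
    using power_half_series by (auto simp: sums_iff)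
  have sm: "summable (\<lambda>k. w k * \<nu> k t)" for t
    by (rule summable_comparison_test[OF _ geo(1)]) (use wb in auto)
  define \<phi> where "\<phi> t = t + (\<Sum>k. w k * \<nu> k t)" for t
  have diff: "(t - s) + w k * (\<nu> k t - \<nu> k s) \<le> \<phi> t - \<phi> s" if "s \<le> t" for s t k
  proof -
    have "w k * (\<nu> k t - \<nu> k s) \<le> (\<Sum>j. w j * \<nu> j t - w j * \<nu> j s)"
    proof -
      have "(\<Sum>j\<in>{k}. w j * \<nu> j t - w j * \<nu> j s) \<le> (\<Sum>j. w j * \<nu> j t - w j * \<nu> j s)"
        by (rule sum_le_suminf) (use summable_diff[OF sm sm] w \<nu>mono[OF that] less_imp_le in \<open>auto intro!: mult_left_mono\<close>)
      then show ?thesis using \<nu>mono[OF that, of k] by (simp add: of_nat_diff right_diff_distrib)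
    qed
    then show ?thesis unfolding \<phi>_def by (simp add: suminf_diff[OF sm sm, symmetric])
  qed
  have diff0: "t - s \<le> \<phi> t - \<phi> s" if "s \<le> t" for s t
  proof -
    have "0 \<le> w 0 * (\<nu> 0 t - \<nu> 0 s)" using w[of 0] by simp
    then show ?thesis using diff[OF that, of 0] by linarith
  qed
  define S where "S = \<phi> 1 - \<phi> 0"
  have S: "1 \<le> S" "S \<le> 2"
  proof -
    show "1 \<le> S" using diff0[of 0 1] by (simp add: S_def)
    have "(\<Sum>k. w k * \<nu> k 1) \<le> 1" using suminf_le[OF wb(2) sm geo(1)] geo(2) by simp
    moreover have "0 \<le> (\<Sum>k. w k * \<nu> k 0)" by (rule suminf_nonneg[OF sm wb(1)])
    ultimately show "S \<le> 2" by (simp add: S_def \<phi>_def)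
  qed
  define A where "A x = {t \<in> {0..1}. \<phi> t - \<phi> 0 \<le> S * x}" for x
  define \<eta> where "\<eta> x = Sup (A x)" for x
  have bA: "bdd_above (A x)" for x by (rule bdd_aboveI[of _ 1]) (auto simp: A_def)
  have zA: "0 \<in> A x" if "0 \<le> x" for x using that S by (simp add: A_def)
  have \<eta>01: "\<eta> x \<in> {0..1}" if "0 \<le> x" for x
  proof -
    have "0 \<le> \<eta> x" unfolding \<eta>_def by (rule cSup_upper[OF zA[OF that] bA])
    moreover have "\<eta> x \<le> 1"
      unfolding \<eta>_def
    proof (rule cSup_least)
      show "A x \<noteq> {}" using zA[OF that] by blast
      show "t \<le> 1" if "t \<in> A x" for t using that by (simp add: A_def)
    qed
    ultimately show ?thesis by simp
  qed
  have \<eta>mono: "\<eta> x \<le> \<eta> y" if "0 \<le> x" "x \<le> y" for x y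
    unfolding \<eta>_def
  proof (rule cSup_subset_mono[OF _ bA])
    show "A x \<noteq> {}" using zA that by blast
    have "S * x \<le> S * y" using that S by (intro mult_left_mono) auto
    then show "A x \<subseteq> A y" by (auto simp: A_def)
  qed
  \<comment> \<open>\<open>\<phi>\<close> may jump at \<open>\<eta> x\<close> and at
    \<open>\<eta> y\<close>, so its increase is controlled only strictly between these
    times.\<close>
  have between: "\<phi> t2 - \<phi> t1 < S * (y - x)" if m: "0 \<le> x" "x \<le> y" "\<eta> x < t1" "t1 \<le> t2" "t2 < \<eta> y" for x y t1 t2
  proof -
    have "t1 \<in> {0..1}" using m \<eta>01[of x] \<eta>01[of y] by auto
    moreover have "t1 \<notin> A x" using m(3) cSup_upper[OF _ bA, of t1 x] by (auto simp: \<eta>_def)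
    ultimately have 1: "S * x < \<phi> t1 - \<phi> 0" by (auto simp: A_def)
    obtain t3 where "t3 \<in> A y" "t2 < t3"
      using m(5) less_cSup_iff[OF _ bA, of y t2] zA[of y] m(1,2) unfolding \<eta>_def by fastforce
    then have 2: "\<phi> t2 - \<phi> 0 \<le> S * y" using diff0[of t2 t3] by (auto simp: A_def)
    show ?thesis using 1 2 by (simp add: right_diff_distrib)
  qed
  \<comment> \<open>\<open>\<phi>\<close> grows at least as fast as the identity and
    \<open>S\<close> is at most 2, so its inverse has Lipschitz constant 2.\<close>
  have lip: "\<eta> y - \<eta> x \<le> 2 * (y - x)" if "0 \<le> x" "x \<le> y" for x y
  proof (rule ccontr)
    assume neg: "\<not> \<eta> y - \<eta> x \<le> 2 * (y - x)"
    define g where "g = (\<eta> y - \<eta> x - 2 * (y - x)) / 3"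
    have "3 * g = \<eta> y - \<eta> x - 2 * (y - x)" by (simp add: g_def)
    then have g: "0 < g" "\<eta> y - \<eta> x = 2 * (y - x) + 3 * g" using neg by linarith+
    have "\<phi> (\<eta> y - g) - \<phi> (\<eta> x + g) < S * (y - x)"
      by (rule between) (use that g in auto)
    moreover have "\<eta> y - g - (\<eta> x + g) \<le> \<phi> (\<eta> y - g) - \<phi> (\<eta> x + g)" by (rule diff0) (use that g in auto)
    moreover have "S * (y - x) \<le> 2 * (y - x)" using S that by (intro mult_right_mono) auto
    ultimately show False using g by linarith
  qed
  have \<eta>0: "\<eta> 0 = 0"
  proof -
    have "t = 0" if "t \<in> A 0" for t using that diff0[of 0 t] by (auto simp: A_def)
    then have "A 0 = {0}" using zA[of 0] by auto
    then show ?thesis by (simp add: \<eta>_def)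
  qed
  have \<eta>1: "\<eta> 1 = 1"
  proof -
    have "1 \<in> A 1" by (simp add: A_def S_def)
    then have "1 \<le> \<eta> 1" unfolding \<eta>_def by (rule cSup_upper[OF _ bA])
    then show ?thesis using \<eta>01[of 1] by auto
  qed
  have cont: "continuous_on {0..1} \<eta>"
    unfolding continuous_on_iff
  proof (intro ballI allI impI)
    fix x r :: real assume x: "x \<in> {0..1}" and r: "0 < r"
    have "dist (\<eta> y) (\<eta> x) < r" if "y \<in> {0..1}" "dist y x < r/2" for y
    proof -
      have "\<bar>\<eta> y - \<eta> x\<bar> \<le> 2 * \<bar>y - x\<bar>"
        using lip[of x y] lip[of y x] \<eta>mono[of x y] \<eta>mono[of y x] x that(1) by (cases "x \<le> y") auto
      then show ?thesis using that(2) by (simp add: dist_real_def)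
    qed
    then show "\<exists>d>0. \<forall>y\<in>{0..1}. dist y x < d \<longrightarrow> dist (\<eta> y) (\<eta> x) < r" using r by (intro exI[of _ "r/2"]) auto
  qed
  \<comment> \<open>A change of \<open>\<nu> k\<close> strictly between the two times would raise
    \<open>\<phi>\<close> by at least \<open>w k\<close>, more than \<open>S * (y - x)\<close>
    allows. So \<open>near\<close> applies inside, and continuity of \<open>q\<close> carries the
    estimate to the ends.\<close>
  have modulus: "dist (q (\<eta> x)) (q (\<eta> y)) \<le> 2 * e k" if xy: "0 \<le> x" "x \<le> y" "y \<le> 1" "y - x < w k / 2" for x y k
  proof (cases "\<eta> x = \<eta> y")
    case True
    then show ?thesis using e[of k] by simp
  next
    case False
    then have lt: "\<eta> x < \<eta> y" using \<eta>mono[OF xy(1,2)] by simp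
    have in01: "\<eta> x \<in> {0..1}" "\<eta> y \<in> {0..1}" using \<eta>01 xy by auto
    \<comment> \<open>The denominator is at least 3, so the two points approach the ends without
      crossing.\<close>
    define s t where "s m = \<eta> x + (\<eta> y - \<eta> x) / (m + 3)" and "t m = \<eta> y - (\<eta> y - \<eta> x) / (m + 3)" for m :: nat
    have st: "\<eta> x < s m" "s m \<le> t m" "t m < \<eta> y" for m
    proof -
      have "(\<eta> y - \<eta> x) / (m + 3) \<le> (\<eta> y - \<eta> x) / 2" using lt by (intro divide_left_mono) auto
      moreover have "0 < (\<eta> y - \<eta> x) / (m + 3)" using lt by simp
      moreover have "(\<eta> y - \<eta> x) / 2 + (\<eta> y - \<eta> x) / 2 = \<eta> y - \<eta> x" by simp
      ultimately show "\<eta> x < s m" "s m \<le> t m" "t m < \<eta> y" unfolding s_def t_def by linarith+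
    qed
    have st01: "s m \<in> {0..1}" "t m \<in> {0..1}" for m using st[of m] in01 by auto
    have le: "dist (q (s m)) (q (t m)) \<le> 2 * e k" for m
    proof (rule near)
      show "\<nu> k (s m) = \<nu> k (t m)"
      proof (rule ccontr)
        assume "\<nu> k (s m) \<noteq> \<nu> k (t m)"
        then have "1 \<le> real (\<nu> k (t m) - \<nu> k (s m))" using \<nu>mono[OF st(2)[of m], of k] by simp
        then have "w k * 1 \<le> w k * (\<nu> k (t m) - \<nu> k (s m))" using w[of k] by (intro mult_left_mono) auto
        then have "w k \<le> \<phi> (t m) - \<phi> (s m)" using diff[OF st(2)[of m], of k] st(2)[of m] by linarith
        also have "\<dots> < S * (y - x)" by (rule between[OF xy(1,2) st])
        also have "\<dots> \<le> 2 * (y - x)" using S xy by (intro mult_right_mono) auto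
        finally show False using xy(4) by simp
      qed
    qed (use st01 st in auto)
    have z: "(\<lambda>m. (\<eta> y - \<eta> x) / (real m + 3)) \<longlonglongrightarrow> 0"
      using LIMSEQ_ignore_initial_segment[OF lim_const_over_n[of "\<eta> y - \<eta> x"], of 3] by simp
    have "s \<longlonglongrightarrow> \<eta> x" "t \<longlonglongrightarrow> \<eta> y"
      unfolding s_def[abs_def] t_def[abs_def] using tendsto_add[OF tendsto_const z] tendsto_diff[OF tendsto_const z] by auto
    then have "(\<lambda>m. q (s m)) \<longlonglongrightarrow> q (\<eta> x)" "(\<lambda>m. q (t m)) \<longlonglongrightarrow> q (\<eta> y)"
      using q in01 st01 unfolding path_def continuous_on_sequentially by (auto simp: o_def)
    then have "(\<lambda>m. dist (q (s m)) (q (t m))) \<longlonglongrightarrow> dist (q (\<eta> x)) (q (\<eta> y))" by (rule tendsto_dist)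
    then show ?thesis by (rule LIMSEQ_le_const2) (use le in auto)
  qed
  show thesis
  proof (rule that[of \<eta>])
    show "mono_on {0..1} \<eta>" by (rule mono_onI) (use \<eta>mono in auto)
    show "\<eta> ` {0..1} \<subseteq> {0..1}" by (rule image_subsetI) (use \<eta>01 in simp)
    fix k :: nat and x y :: real
    assume xy: "x \<in> {0..1}" "y \<in> {0..1}" "\<bar>x - y\<bar> < (1/2) ^ (k + 2) / (n k + 1)"
    have "(1/2) ^ (k + 2) / (n k + 1) = w k / 2" by (simp add: w_def)
    then have lt: "\<bar>x - y\<bar> < w k / 2" using xy(3) by (simp only:)
    show "dist (q (\<eta> x)) (q (\<eta> y)) \<le> 2 * e k"
    proof (cases "x \<le> y")
      case True
      then show ?thesis using lt xy by (intro modulus) auto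
    next
      case False
      then show ?thesis unfolding dist_commute[of "q (\<eta> x)"] using lt xy by (intro modulus) auto
    qed
  qed (use cont \<eta>0 \<eta>1 in auto)
qed

section \<open>Lower semicontinuity and restricted minimizers\<close>

lemma osc_lower_semicontinuous:
  assumes f: "path f" and F: "\<And>n. path (F n)" and lim: "\<And>t. t \<in> {0..1} \<Longrightarrow> (\<lambda>n. F n t) \<longlonglongrightarrow> f t" and e: "0 < e"
  shows "\<forall>\<^sub>F n in sequentially. osc f P \<le> osc (F n) P + e"
proof -
  let ?S = "{osum (map (\<lambda>t. gPQ P (f t)) ts) | ts. chain ts}"
  have "osum (map (\<lambda>t. gPQ P (f t)) []) \<in> ?S" using chain_Nil by blast
  then have ne: "?S \<noteq> {}" by blast
  have "osc f P - e < Sup ?S" using e by (simp add: osc_chains)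
  then obtain z where "z \<in> ?S" "osc f P - e < z"
    using less_cSup_iff[OF ne osum_chain_bounded[OF f]] by blast
  then obtain ts where ts: "chain ts" "osc f P - e < osum (map (\<lambda>t. gPQ P (f t)) ts)" by blast
  have g: "(\<lambda>n. gPQ P (F n t)) \<longlonglongrightarrow> gPQ P (f t)" if "t \<in> {0..1}" for t
    using continuous_on_tendsto_compose[OF continuous_gPQ lim[OF that]] by simp
  have "(\<lambda>n. osum (map (\<lambda>t. gPQ P (F n t)) ts)) \<longlonglongrightarrow> osum (map (\<lambda>t. gPQ P (f t)) ts)" if "set ts \<subseteq> {0..1}" for ts
    using that by (induction ts rule: induct_list012) (auto intro!: tendsto_intros g)
  then have "(\<lambda>n. osum (map (\<lambda>t. gPQ P (F n t)) ts)) \<longlonglongrightarrow> osum (map (\<lambda>t. gPQ P (f t)) ts)"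
    using ts(1) by (simp add: chain_def)
  from order_tendstoD(1)[OF this ts(2)] show ?thesis
  proof eventually_elim
    case (elim n)
    then show ?case using osc_ge[OF F[of n] ts(1), of P] by linarith
  qed
qed

lemma saturation_lipschitz:
  fixes a b e :: real
  assumes "0 \<le> a" "0 \<le> b" "0 \<le> e" "a \<le> b + e"
  shows "a / (1 + a) \<le> b / (1 + b) + e"
proof -
  have "a / (1 + a) \<le> (b + e) / (1 + (b + e))" by (rule saturation_mono(1)) (use assms in auto)
  also have "\<dots> = b / (1 + (b + e)) + e / (1 + (b + e))" by (rule add_divide_distrib)
  also have "\<dots> \<le> b / (1 + b) + e / 1"
    by (intro add_mono divide_left_mono) (use assms in \<open>auto intro!: mult_pos_pos\<close>)
  finally show ?thesis by simp
qed

text \<open>Finitely many terms are treated at a time, each with the slack \<open>e/2\<close>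
  weighted by its geometric factor, so that the total slack is at most \<open>e/2\<close> for every
  number of terms.\<close>

lemma Tfun_lower_semicontinuous:
  assumes f: "path f" and F: "\<And>n. path (F n)" and lim: "\<And>t. t \<in> {0..1} \<Longrightarrow> (\<lambda>n. F n t) \<longlonglongrightarrow> f t"
    and T: "(\<lambda>n. Tfun L (F n)) \<longlonglongrightarrow> m"
  shows "Tfun L f \<le> m"
proof (rule field_le_epsilon)
  fix e :: real assume e: "0 < e"
  have geo: "summable (\<lambda>k. (1/2::real) ^ Suc k)" "(\<Sum>k. (1/2::real) ^ Suc k) = 1"
    using power_half_series by (auto simp: sums_iff)
  show "Tfun L f \<le> m + e"
    unfolding Tfun_eq
  proof (rule suminf_le_const[OF summable_Tterm[OF f]])
    fix N
    have "\<forall>\<^sub>F n in sequentially. Tterm L f i \<le> Tterm L (F n) i + (1/2) ^ Suc i * (e/2)" for i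
    proof -
      have "\<forall>\<^sub>F n in sequentially. osc f (L i) \<le> osc (F n) (L i) + e/2"
        by (rule osc_lower_semicontinuous[OF f F lim]) (use e in auto)
      then show ?thesis
      proof eventually_elim
        case (elim n)
        have "osc f (L i) / (1 + osc f (L i)) \<le> osc (F n) (L i) / (1 + osc (F n) (L i)) + e/2"
          by (rule saturation_lipschitz) (use osc_nonneg f F e elim in auto)
        then have "(1/2) ^ Suc i * (osc f (L i) / (1 + osc f (L i))) \<le> (1/2) ^ Suc i * (osc (F n) (L i) / (1 + osc (F n) (L i)) + e/2)"
          by (rule mult_left_mono) simp
        then show ?case unfolding Tterm_def by (simp only: distrib_left)
      qed
    qed
    then have "\<forall>\<^sub>F n in sequentially. \<forall>i\<in>{..<N}. Tterm L f i \<le> Tterm L (F n) i + (1/2) ^ Suc i * (e/2)"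
      by (intro eventually_ball_finite) auto
    moreover have "\<forall>\<^sub>F n in sequentially. Tfun L (F n) < m + e/2"
      using order_tendstoD(2)[OF T, of "m + e/2"] e by simp
    ultimately have "\<forall>\<^sub>F n in sequentially. sum (Tterm L f) {..<N} \<le> m + e"
    proof eventually_elim
      case (elim n)
      have "sum (Tterm L f) {..<N} \<le> (\<Sum>i<N. Tterm L (F n) i + (1/2) ^ Suc i * (e/2))"
        by (rule sum_mono) (use elim(1) in blast)
      also have "\<dots> = sum (Tterm L (F n)) {..<N} + (\<Sum>i<N. (1/2) ^ Suc i) * (e/2)"
        by (simp only: sum.distrib sum_distrib_right)
      also have "sum (Tterm L (F n)) {..<N} \<le> Tfun L (F n)"
        unfolding Tfun_eq by (rule sum_le_suminf[OF summable_Tterm[OF F]]) (use Tterm_bounds F in auto)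
      also have "(\<Sum>i<N. (1/2::real) ^ Suc i) \<le> 1"
        using sum_le_suminf[OF geo(1), of "{..<N}"] geo(2) by simp
      finally show ?case using elim(2) e by (simp add: mult_right_mono)
    qed
    then show "sum (Tterm L f) {..<N} \<le> m + e" by (simp add: eventually_const_iff)
  qed
qed

lemma tight_representative:
  assumes X: "compact X" and L: "dense_linepair_seq L" and p: "path p" "path_image p \<subseteq> X"
  obtains q where "homotopic_paths X p q" "tight X q" "\<And>i. osc q (L i) \<le> osc p (L i)"
proof -
  \<comment> \<open>The oscillation bounds make the bounds on jumps uniform over \<open>K\<close>.
    They are inherited under reparametrization and under shortening, and by lower semicontinuity
    they pass to limits.\<close>
  define K where "K = {q. homotopic_paths X p q \<and> (\<forall>i. osc q (L i) \<le> osc p (L i))}"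
  have pK: "p \<in> K" using p by (simp add: K_def)
  have Kp: "path q" "path_image q \<subseteq> X" if "q \<in> K" for q
    using that homotopic_paths_imp_path homotopic_paths_imp_subset unfolding K_def by blast+
  define m where "m = Inf (Tfun L ` K)"
  have T0: "0 \<le> Tfun L q" if "q \<in> K" for q
    unfolding Tfun_eq by (rule suminf_nonneg[OF summable_Tterm]) (use Kp[OF that] Tterm_bounds in auto)
  have bdd: "bdd_below (Tfun L ` K)" by (rule bdd_belowI[of _ 0]) (use T0 in auto)
  have mle: "m \<le> Tfun L q" if "q \<in> K" for q unfolding m_def by (rule cInf_lower[OF _ bdd]) (use that in simp)
  have "\<exists>q\<in>K. Tfun L q < m + inverse (Suc n)" for n
  proof -
    have "Inf (Tfun L ` K) < m + inverse (Suc n)" by (simp add: m_def)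
    then show ?thesis using cInf_less_iff[OF _ bdd] pK by auto
  qed
  then obtain q where q: "\<And>n. q n \<in> K" "\<And>n. Tfun L (q n) < m + inverse (Suc n)" by metis
  define e where "e k = inverse (real (Suc k))" for k
  have e: "0 < e k" for k by (simp add: e_def)
  have "\<exists>N :: nat. \<forall>r ts. path r \<longrightarrow> path_image r \<subseteq> X \<longrightarrow> (\<forall>i. osc r (L i) \<le> osc p (L i)) \<longrightarrow> jump_chain (e k) r ts \<longrightarrow> length ts \<le> N" for k
    using jump_chain_bounded[OF L X e[of k], of "\<lambda>i. osc p (L i)"] by metis
  then obtain N :: "nat \<Rightarrow> nat" where N: "\<And>k r ts. path r \<Longrightarrow> path_image r \<subseteq> X \<Longrightarrow> (\<forall>i. osc r (L i) \<le> osc p (L i)) \<Longrightarrow> jump_chain (e k) r ts \<Longrightarrow> length ts \<le> N k"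
    by metis
  define d where "d k = (1/2) ^ (k + 2) / real (N k + 1)" for k
  have d: "0 < d k" for k by (simp add: d_def)
  have "\<exists>r. r \<in> K \<and> Tfun L r \<le> Tfun L (q n) \<and> (\<forall>k. \<forall>x\<in>{0..1}. \<forall>y\<in>{0..1}. \<bar>x - y\<bar> < d k \<longrightarrow> dist (r x) (r y) \<le> 2 * e k)" for n
  proof -
    have jn: "length ts \<le> N k" if "jump_chain (e k) (q n) ts" for k ts
      using N[OF Kp[OF q(1)] _ that] q(1)[of n] by (simp add: K_def)
    show ?thesis
    proof (rule equicontinuous_reparametrization[OF Kp(1)[OF q(1)[of n]] jn e])
      fix \<eta>
      assume \<eta>: "mono_on {0..1} \<eta>" "\<eta> ` {0..1} \<subseteq> {0..1}" "continuous_on {0..1} \<eta>" "\<eta> 0 = 0" "\<eta> 1 = 1"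
        "\<And>k x y. x \<in> {0..1} \<Longrightarrow> y \<in> {0..1} \<Longrightarrow> \<bar>x - y\<bar> < (1/2) ^ (k + 2) / (N k + 1) \<Longrightarrow> dist (q n (\<eta> x)) (q n (\<eta> y)) \<le> 2 * e k"
      have \<eta>01: "\<eta> t \<in> {0..1}" if "t \<in> {0..1}" for t using \<eta>(2) that by blast
      define r where "r t = q n (\<eta> t)" for t
      have hom: "homotopic_paths X (q n) r"
        by (rule homotopic_paths_reparametrize[of _ _ \<eta>]) (use Kp[OF q(1)] \<eta>(3-5) \<eta>01 in \<open>auto simp: r_def\<close>)
      have osc: "osc r P \<le> osc (q n) P" for P
        by (rule osc_le_reparam[OF Kp(1)[OF q(1)] \<eta>(1)]) (use \<eta>01 in \<open>auto simp: r_def\<close>)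
      have "homotopic_paths X p (q n)" using q(1) by (simp add: K_def)
      then have "homotopic_paths X p r" using hom homotopic_paths_trans by blast
      moreover have "osc r (L i) \<le> osc p (L i)" for i
        using order_trans[OF osc] q(1)[of n] by (simp add: K_def)
      moreover have "Tfun L r \<le> Tfun L (q n)"
        by (rule Tfun_mono[OF _ Kp(1)[OF q(1)] osc]) (use hom homotopic_paths_imp_path in blast)
      ultimately show ?thesis
        using \<eta>(6) unfolding d_def by (intro exI[of _ r]) (auto simp: K_def r_def)
    qed
  qed
  then obtain r where r: "\<And>n. r n \<in> K" "\<And>n. Tfun L (r n) \<le> Tfun L (q n)"
    "\<And>n k x y. x \<in> {0..1} \<Longrightarrow> y \<in> {0..1} \<Longrightarrow> \<bar>x - y\<bar> < d k \<Longrightarrow> dist (r n x) (r n y) \<le> 2 * e k" by metis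
  obtain M where M: "\<And>x. x \<in> X \<Longrightarrow> norm x \<le> M" using compact_imp_bounded[OF X] by (auto simp: bounded_iff)
  obtain f and k :: "nat \<Rightarrow> nat" where fk: "continuous_on {0..1} f" "strict_mono k"
    "\<And>e. 0 < e \<Longrightarrow> \<exists>N. \<forall>n x. n \<ge> N \<and> x \<in> {0..1} \<longrightarrow> norm (r (k n) x - f x) < e"
  proof (rule Arzela_Ascoli[of "{0..1::real}" r M])
    show "compact {0..1::real}" by simp
    show "norm (r n x) \<le> M" if "x \<in> {0..1}" for n x
      using M Kp(2)[OF r(1)[of n]] that unfolding path_image_def by blast
    fix x a :: real assume x: "x \<in> {0..1}" and a: "0 < a"
    obtain j where j: "inverse (real (Suc j)) < a / 2" using reals_Archimedean[of "a/2"] a by auto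
    have "norm (r n x - r n y) < a" if "y \<in> {0..1}" "norm (x - y) < d j" for n y
    proof -
      have "dist (r n x) (r n y) \<le> 2 * e j" by (rule r(3)[OF x that(1)]) (use that(2) in simp)
      then show ?thesis using j by (simp add: e_def dist_norm)
    qed
    then show "\<exists>d>0. \<forall>n y. y \<in> {0..1} \<and> norm (x - y) < d \<longrightarrow> norm (r n x - r n y) < a"
      using d[of j] by blast
  qed blast
  define F where "F n = r (k n)" for n
  have FK: "F n \<in> K" for n by (simp add: F_def r(1))
  have ul: "uniform_limit {0..1} F f sequentially"
    unfolding uniform_limit_sequentially_iff dist_norm F_def using fk(3) by blast
  have pt: "(\<lambda>n. F n t) \<longlonglongrightarrow> f t" if "t \<in> {0..1}" for t by (rule tendsto_uniform_limitI[OF ul that])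
  have pf: "path f" using fk(1) by (simp add: path_def)
  have "homotopic_paths X f p"
  proof (rule homotopic_paths_uniform_limit[OF compact_imp_closed[OF X] _ ul uniform_limit_const])
    show "homotopic_paths X (F n) p" for n
      by (rule homotopic_paths_sym) (use FK[of n] in \<open>simp add: K_def\<close>)
  qed
  then have hom: "homotopic_paths X p f" by (rule homotopic_paths_sym)
  have osc: "osc f (L i) \<le> osc p (L i)" for i
  proof (rule field_le_epsilon)
    fix a :: real assume "0 < a"
    from osc_lower_semicontinuous[OF pf Kp(1)[OF FK] pt this]
    obtain n where "osc f (L i) \<le> osc (F n) (L i) + a"
      using eventually_happens' sequentially_bot by blast
    then show "osc f (L i) \<le> osc p (L i) + a" using FK[of n] by (auto simp: K_def intro: order_trans)
  qed
  have fK: "f \<in> K" using hom osc by (simp add: K_def)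
  have Tm: "(\<lambda>n. Tfun L (F n)) \<longlonglongrightarrow> m"
  proof (rule tendsto_sandwich)
    show "\<forall>\<^sub>F n in sequentially. m \<le> Tfun L (F n)" using mle[OF FK] by simp
    show "\<forall>\<^sub>F n in sequentially. Tfun L (F n) \<le> m + inverse (Suc n)"
    proof (rule always_eventually, rule allI)
      fix n
      have "inverse (real (Suc (k n))) \<le> inverse (real (Suc n))"
        using seq_suble[OF fk(2), of n] by (intro le_imp_inverse_le) auto
      then show "Tfun L (F n) \<le> m + inverse (Suc n)"
        using r(2)[of "k n"] q(2)[of "k n"] unfolding F_def by linarith
    qed
    show "(\<lambda>n. m + inverse (real (Suc n))) \<longlonglongrightarrow> m"
      using tendsto_add[OF tendsto_const LIMSEQ_inverse_real_of_nat, of m] by simp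
  qed simp
  have Tf: "Tfun L f \<le> m" by (rule Tfun_lower_semicontinuous[OF pf Kp(1)[OF FK] pt Tm])
  have "tight X f"
  proof (rule ccontr)
    assume "\<not> tight X f"
    then obtain b where b: "homotopic_paths X f b" "\<And>P. osc b P \<le> osc f P" "Tfun L b < Tfun L f"
      using shorten_if_not_tight[OF L Kp[OF fK]] by metis
    have "b \<in> K" unfolding K_def using homotopic_paths_trans[OF hom b(1)] order_trans[OF b(2) osc] by blast
    then show False using mle[of b] b(3) Tf by linarith
  qed
  then show thesis using that[OF hom] osc by blast
qed

section \<open>Uniqueness of tight paths\<close>

lemma tight_subpath:
  assumes a: "tight X a" and st: "0 \<le> s" "s \<le> t" "t \<le> 1"
  shows "tight X (subpath s t a)"
  unfolding tight_def
proof (intro conjI allI impI)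
  show "path (subpath s t a)" using a st by (simp add: tight_def)
  show "path_image (subpath s t a) \<subseteq> X"
    using path_image_subpath_subset[of s t a] a st unfolding tight_def by auto
  fix x y :: real
  assume xy: "0 \<le> x \<and> x < y \<and> y \<le> 1 \<and> closed_segment (subpath s t a x) (subpath s t a y) \<subseteq> X \<and>
    homotopic_paths X (subpath x y (subpath s t a)) (linepath (subpath s t a x) (subpath s t a y))"
  show "subpath s t a ` {x..y} \<subseteq> closed_segment (subpath s t a x) (subpath s t a y)"
  proof (cases "s = t")
    case True
    then show ?thesis by (auto simp: subpath_def)
  next
    case False
    define x' y' where "x' = (t - s) * x + s" and "y' = (t - s) * y + s"
    have e: "subpath s t a x = a x'" "subpath s t a y = a y'" by (simp_all add: subpath_def x'_def y'_def)
    have lt: "x' < y'" using False st xy unfolding x'_def y'_def by simp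
    have "(t - s) * y \<le> (t - s) * 1" by (rule mult_left_mono) (use st xy in auto)
    then have b: "0 \<le> x'" "y' \<le> 1" using st xy by (simp_all add: x'_def y'_def)
    have sub: "subpath x y (subpath s t a) = subpath x' y' a"
      by (simp add: subpath_def x'_def y'_def fun_eq_iff algebra_simps)
    have "a ` {x'..y'} \<subseteq> closed_segment (a x') (a y')"
      using a lt b xy unfolding tight_def e sub by blast
    moreover have "subpath s t a z \<in> a ` {x'..y'}" if "z \<in> {x..y}" for z
    proof -
      have "(t - s) * x \<le> (t - s) * z" "(t - s) * z \<le> (t - s) * y"
        by (rule mult_left_mono; use st that in simp)+
      then have "(t - s) * z + s \<in> {x'..y'}" by (simp add: x'_def y'_def)
      then show ?thesis unfolding subpath_def by blast
    qed
    ultimately show ?thesis unfolding e by blast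
  qed
qed

text \<open>A sphere through \<open>y\<close> whose center is far away on the side of the segment is
  nearly a hyperplane, and so encloses both ends of the segment. In a set containing
  \<open>y\<close>, a point farthest from such a center is therefore different from both
  ends.\<close>

lemma ball_separating_point_from_segment:
  fixes z0 z1 y :: "'a::euclidean_space"
  assumes "y \<notin> closed_segment z0 z1"
  obtains cc where "dist z0 cc < dist y cc" "dist z1 cc < dist y cc"
proof -
  obtain v c where v: "v \<bullet> y < c" "\<And>x. x \<in> closed_segment z0 z1 \<Longrightarrow> c < v \<bullet> x"
    using separating_hyperplane_closed_point[OF convex_closed_segment closed_segment assms] by metis
  \<comment> \<open>With the center \<open>y + l *\<^sub>R v\<close>, the comparison of distances
    amounts to \<open>(norm (z - y))^2 < 2 * l * (v \<bullet> (z - y))\<close>; from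
    \<open>l = k z\<close> on this holds with a factor 2 to spare.\<close>
  define k where "k z = (norm (z - y))\<^sup>2 / (v \<bullet> (z - y))" for z
  define l where "l = max (k z0) (k z1)"
  have key: "dist z (y + l *\<^sub>R v) < dist y (y + l *\<^sub>R v)" if z: "z \<in> closed_segment z0 z1" "k z \<le> l" for z
  proof -
    have pos: "0 < v \<bullet> (z - y)" using v(1) v(2)[OF z(1)] by (simp add: inner_diff_right)
    have nz: "0 < (norm (z - y))\<^sup>2" using pos by auto
    have "k z * (v \<bullet> (z - y)) \<le> l * (v \<bullet> (z - y))" by (rule mult_right_mono) (use z pos in auto)
    then have 1: "(norm (z - y))\<^sup>2 \<le> l * (v \<bullet> (z - y))" using pos by (simp add: k_def)
    have "(norm (a - w))\<^sup>2 = (norm a)\<^sup>2 - 2 * (a \<bullet> w) + (norm w)\<^sup>2" for a w :: 'a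
      by (simp add: power2_norm_eq_inner inner_diff_left inner_diff_right inner_commute)
    then have "(norm ((z - y) - l *\<^sub>R v))\<^sup>2 = (norm (z - y))\<^sup>2 - 2 * ((z - y) \<bullet> (l *\<^sub>R v)) + (norm (l *\<^sub>R v))\<^sup>2" .
    also have "(z - y) \<bullet> (l *\<^sub>R v) = l * (v \<bullet> (z - y))" by (simp only: inner_scaleR_right inner_commute)
    also have "(norm (z - y))\<^sup>2 - 2 * (l * (v \<bullet> (z - y))) + (norm (l *\<^sub>R v))\<^sup>2 < (norm (l *\<^sub>R v))\<^sup>2" using 1 nz by linarith
    finally have "norm ((z - y) - l *\<^sub>R v) < norm (l *\<^sub>R v)" by (rule power_less_imp_less_base) simp
    moreover have "(z - y) - l *\<^sub>R v = z - (y + l *\<^sub>R v)" by simp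
    ultimately show ?thesis by (simp add: dist_norm)
  qed
  show thesis by (rule that[of "y + l *\<^sub>R v"]) (rule key; simp add: l_def)+
qed

lemma closed_segment_inner_const:
  assumes "u \<bullet> p = c" "u \<bullet> q = c" "x \<in> closed_segment p q"
  shows "u \<bullet> x = c"
proof -
  obtain t where "x = (1 - t) *\<^sub>R p + t *\<^sub>R q" using assms(3) by (auto simp: closed_segment_def)
  then have "u \<bullet> x = (1 - t) * c + t * c" using assms(1,2) by (simp add: inner_right_distrib)
  then show ?thesis by (simp add: algebra_simps)
qed

text \<open>The loop formed by the two paths is cut by lines close to the tangent of the circle through
  the farthest point. Tightness excludes cuts with both ends on \<^term>\<open>A\<close>.\<close>
lemma tight_meets_at_farthest_point_cut:
  fixes X :: "(real^2) set"
  assumes A: "tight X A" and B: "path B" "path_image B \<subseteq> X" and hom: "homotopic_paths X A B"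
    and m: "m \<in> {0..1}" and c: "u \<bullet> A 1 < c" "c < u \<bullet> A m"
  obtains \<sigma> \<tau> where "\<sigma> \<in> {0..1}" "\<tau> \<in> {0..1}" "u \<bullet> A \<sigma> = c" "u \<bullet> B \<tau> = c"
    "homotopic_paths X (subpath 0 \<sigma> A +++ linepath (A \<sigma>) (B \<tau>)) (subpath 0 \<tau> B)"
proof -
  note cutI = that
  have pA: "path A" "path_image A \<subseteq> X" using A by (auto simp: tight_def)
  have ends: "A 0 = B 0" "A 1 = B 1"
    using homotopic_paths_imp_pathstart[OF hom] homotopic_paths_imp_pathfinish[OF hom] by (simp_all add: pathstart_def pathfinish_def)
  define l where "l = A +++ reversepath B"
  have l1: "l y = A (2 * y)" if "y \<le> 1/2" for y using that by (simp add: l_def joinpaths_def)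
  have l2: "l y = B (2 - 2 * y)" if "1/2 \<le> y" for y
  proof (cases "y = 1/2")
    case True
    show ?thesis unfolding True using ends by (simp add: l_def joinpaths_def)
  qed (use that in \<open>simp add: l_def joinpaths_def reversepath_def\<close>)
  have null: "null_loop X l"
  proof -
    have "homotopic_paths X l (B +++ reversepath B)"
      unfolding l_def by (rule homotopic_paths_join[OF hom]) (use B ends in \<open>simp_all add: pathfinish_def\<close>)
    also have "homotopic_paths X \<dots> (linepath (B 0) (B 0))" using homotopic_paths_rinv[OF B] by (simp add: pathstart_def)
    finally show ?thesis using l1[of 0] ends by simp
  qed
  have pl: "path l" "path_image l \<subseteq> X" using null homotopic_paths_imp_path homotopic_paths_imp_subset by blast+
  have m1: "m < 1" using m c by (cases "m = 1") auto
  have lm: "l (m / 2) = A m" "l (1/2) = A 1" using l1[of "m/2"] l1[of "1/2"] m by simp_all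
  show thesis
  proof (rule null_loop_cut[OF null, of "m/2" "1/2" u c])
    show "0 \<le> m/2" "m/2 < 1/2" "1/2 \<le> (1::real)" using m m1 by auto
    show "u \<bullet> l (m/2) < c \<and> c < u \<bullet> l (1/2) \<or> u \<bullet> l (1/2) < c \<and> c < u \<bullet> l (m/2)"
      unfolding lm using c by simp
    fix x y assume xy: "0 \<le> x" "x < y" "y \<le> 1" and ord: "(m / 2 < x \<and> x < 1 / 2) \<noteq> (m / 2 < y \<and> y < 1 / 2)"
      and uc: "u \<bullet> l x = c" "u \<bullet> l y = c" and seg: "closed_segment (l x) (l y) \<subseteq> X"
      and h: "homotopic_paths X (subpath x y l) (linepath (l x) (l y))"
    show thesis
    \<comment> \<open>Exactly one end of the cut lies strictly between the times of
      \<open>A m\<close> and \<open>A 1\<close> on the loop. If it is the later end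
      \<open>y\<close>, then \<open>x\<close> is a time on \<open>A\<close> not after that of
      \<open>A m\<close>, the cut-off subpath of \<open>A\<close> passes through \<open>A m\<close>,
      and tightness would put \<open>A m\<close> on the line.\<close>
    proof (cases "m / 2 < y \<and> y < 1 / 2")
      case True
      then have xm: "x \<le> m / 2" using ord xy by auto
      have lx: "l x = A (2 * x)" "l y = A (2 * y)" using l1 xm m1 True by auto
      have "subpath (2 * x) (2 * y) A z = subpath x y l z" if "z \<in> {0..1}" for z
      proof -
        have "(y - x) * z \<le> (y - x) * 1" by (rule mult_left_mono) (use xy that in auto)
        then have "(y - x) * z + x \<le> 1/2" using True by simp
        from l1[OF this] show ?thesis by (simp add: subpath_def algebra_simps)
      qed
      then have "homotopic_paths X (subpath x y l) (subpath (2 * x) (2 * y) A)"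
        using homotopic_paths_imp_path[OF h] homotopic_paths_imp_subset[OF h] by (intro homotopic_paths_eq) auto
      then have "homotopic_paths X (subpath (2 * x) (2 * y) A) (linepath (A (2 * x)) (A (2 * y)))"
        using h unfolding lx by (meson homotopic_paths_sym homotopic_paths_trans)
      moreover have "0 \<le> 2 * x \<and> 2 * x < 2 * y \<and> 2 * y \<le> 1" using xy True by simp
      ultimately have "A ` {2 * x..2 * y} \<subseteq> closed_segment (A (2 * x)) (A (2 * y))"
        using A seg unfolding tight_def lx by blast
      moreover have "m \<in> {2 * x..2 * y}" using xm True by simp
      ultimately have "u \<bullet> A m = c" using closed_segment_inner_const[OF uc] unfolding lx by blast
      then show thesis using c by simp
    next
      case False
      then have x: "m / 2 < x" "x < 1 / 2" and y: "1/2 \<le> y" using ord xy by auto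
      have lx: "l x = A (2 * x)" "l y = B (2 - 2 * y)" using l1 l2 x y by auto
      have i: "0 \<in> {0..1::real}" "1 \<in> {0..1::real}" "x \<in> {0..1}" "y \<in> {0..1}" using xy by auto
      have pA': "path (subpath 0 (2 * x) A)" using pA x xy by simp
      have s1: "homotopic_paths X (subpath 0 (2 * x) A) (subpath 0 x l)"
      proof (rule homotopic_paths_eq[OF pA'])
        show "path_image (subpath 0 (2 * x) A) \<subseteq> X"
          using path_image_subpath_subset[of 0 "2 * x" A] pA x xy by auto
        fix z :: real assume z: "z \<in> {0..1}"
        have "x * z \<le> x * 1" by (rule mult_left_mono) (use xy z in auto)
        then have "x * z \<le> 1/2" using x by simp
        from l1[OF this] show "subpath 0 (2 * x) A z = subpath 0 x l z" by (simp add: subpath_def algebra_simps)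
      qed
      have s2: "homotopic_paths X (subpath 0 (2 - 2 * y) B) (subpath 1 y l)"
      proof (rule homotopic_paths_eq)
        show "path (subpath 0 (2 - 2 * y) B)" using B y xy by simp
        show "path_image (subpath 0 (2 - 2 * y) B) \<subseteq> X"
          using path_image_subpath_subset[of 0 "2 - 2 * y" B] B y xy by auto
        fix z :: real assume z: "z \<in> {0..1}"
        have "(1 - y) * z \<le> (1 - y) * 1" by (rule mult_left_mono) (use xy z in auto)
        moreover have "(y - 1) * z + 1 = 1 - (1 - y) * z" by (simp add: algebra_simps)
        ultimately have "1/2 \<le> (y - 1) * z + 1" using y by simp
        from l2[OF this] show "subpath 0 (2 - 2 * y) B z = subpath 1 y l z" by (simp add: subpath_def algebra_simps)
      qed
      have "homotopic_paths X (subpath 0 (2 * x) A +++ linepath (A (2 * x)) (B (2 - 2 * y))) (subpath 0 x l +++ subpath x y l)"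
        by (rule homotopic_paths_join[OF s1 homotopic_paths_sym[OF h[unfolded lx]]])
           (simp add: pathfinish_def subpath_def)
      also have "homotopic_paths X \<dots> (subpath 0 y l)" by (rule homotopic_join_subpaths[OF pl i(1,3,4)])
      \<comment> \<open>The loop is null-homotopic, so a point on it may be reached from the end of
        the loop instead of its start, that is, along \<open>B\<close> forwards.\<close>
      also have "homotopic_paths X \<dots> (subpath 1 y l)"
      proof -
        have "homotopic_paths X (subpath 0 1 l +++ subpath 1 y l) (subpath 0 y l)"
          by (rule homotopic_join_subpaths[OF pl i(1,2,4)])
        moreover have "homotopic_paths X (subpath 0 1 l +++ subpath 1 y l) (linepath (l 0) (l 0) +++ subpath 1 y l)"
          by (rule homotopic_paths_join)
             (use null s2 homotopic_paths_imp_path[OF s2] homotopic_paths_imp_subset[OF s2] in \<open>auto simp: pathfinish_def pathstart_def subpath_def\<close>)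
        moreover have "homotopic_paths X (linepath (l 0) (l 0) +++ subpath 1 y l) (subpath 1 y l)"
        proof (rule homotopic_paths_lid')
          show "path (subpath 1 y l)" "path_image (subpath 1 y l) \<subseteq> X"
            using homotopic_paths_imp_path[OF s2] homotopic_paths_imp_subset[OF s2] by auto
          have "l 1 = l 0" using l1[of 0] l2[of 1] ends by simp
          then show "l 0 = pathstart (subpath 1 y l)" by simp
        qed
        ultimately show ?thesis by (meson homotopic_paths_sym homotopic_paths_trans)
      qed
      also have "homotopic_paths X \<dots> (subpath 0 (2 - 2 * y) B)" by (rule homotopic_paths_sym[OF s2])
      finally show thesis
        by (intro cutI[of "2 * x" "2 - 2 * y"]) (use x y xy uc lx in auto)
    qed
  qed
qed

text \<open>The cutting lines approach the tangent at \<open>A m\<close> of the circle about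
  \<open>cc\<close>. The limit cut has both ends on the tangent and in the disc, which share only
  the point \<open>A m\<close>; so its chord is constant. The time \<open>\<sigma>\<close> may
  differ from \<open>m\<close>.\<close>

lemma tight_meets_at_farthest_point:
  fixes X :: "(real^2) set"
  assumes X: "closed X" and A: "tight X A" and B: "path B" "path_image B \<subseteq> X" and hom: "homotopic_paths X A B"
    and m: "m \<in> {0..1}" and far: "\<And>x. x \<in> {0..1} \<Longrightarrow> dist (A x) cc \<le> dist (A m) cc" "\<And>x. x \<in> {0..1} \<Longrightarrow> dist (B x) cc \<le> dist (A m) cc"
    and end1: "dist (A 1) cc < dist (A m) cc"
  obtains \<sigma> \<tau> where "\<sigma> \<in> {0..1}" "\<tau> \<in> {0..1}" "A \<sigma> = A m" "B \<tau> = A m" "homotopic_paths X (subpath 0 \<sigma> A) (subpath 0 \<tau> B)"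
proof -
  have pA: "path A" "path_image A \<subseteq> X" using A by (auto simp: tight_def)
  define u where "u = A m - cc"
  define d where "d = u \<bullet> A m - u \<bullet> A 1"
  have uu: "u \<bullet> (A m - cc) = (norm u)\<^sup>2" by (simp add: u_def power2_norm_eq_inner)
  have nu: "norm u = dist (A m) cc" by (simp add: u_def dist_norm)
  have d: "0 < d"
  proof -
    have "u \<bullet> (A 1 - cc) \<le> norm u * norm (A 1 - cc)" by (rule norm_cauchy_schwarz)
    also have "\<dots> < norm u * norm u"
    proof (rule mult_strict_left_mono)
      show "norm (A 1 - cc) < norm u" using end1 nu by (simp add: dist_norm)
      then show "0 < norm u" using norm_ge_zero le_less_trans by blast
    qed
    finally show ?thesis using uu by (simp add: d_def inner_diff_right power2_eq_square)
  qed
  \<comment> \<open>The summand 2 keeps the level strictly above that of the endpoint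
    \<open>A 1\<close> also for \<open>n = 0\<close>.\<close>
  define c where "c n = u \<bullet> A m - d / (real n + 2)" for n :: nat
  have c: "u \<bullet> A 1 < c n" "c n < u \<bullet> A m" for n
  proof -
    have "d / (real n + 2) < d" using d by (simp add: divide_less_eq)
    then show "u \<bullet> A 1 < c n" by (simp add: c_def d_def)
    show "c n < u \<bullet> A m" using d by (simp add: c_def)
  qed
  have "\<exists>\<sigma> \<tau>. \<sigma> \<in> {0..1} \<and> \<tau> \<in> {0..1} \<and> u \<bullet> A \<sigma> = c n \<and> u \<bullet> B \<tau> = c n \<and>
    homotopic_paths X (subpath 0 \<sigma> A +++ linepath (A \<sigma>) (B \<tau>)) (subpath 0 \<tau> B)" for n
    by (rule tight_meets_at_farthest_point_cut[OF A B hom m c]) blast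
  then obtain S T where ST: "\<And>n. S n \<in> {0..1}" "\<And>n. T n \<in> {0..1}" "\<And>n. u \<bullet> A (S n) = c n" "\<And>n. u \<bullet> B (T n) = c n"
    "\<And>n. homotopic_paths X (subpath 0 (S n) A +++ linepath (A (S n)) (B (T n))) (subpath 0 (T n) B)" by metis
  have comp: "compact ({0..1::real} \<times> {0..1::real})" by (intro compact_Times compact_Icc)
  have "\<forall>n. (S n, T n) \<in> {0..1} \<times> {0..1}" using ST(1,2) by simp
  then obtain z r where z: "z \<in> {0..1} \<times> {0..1}" "strict_mono r" "((\<lambda>n. (S n, T n)) \<circ> r) \<longlonglongrightarrow> z"
    using comp[unfolded compact_def, rule_format, of "\<lambda>n. (S n, T n)"] by blast
  define \<sigma> \<tau> where "\<sigma> = fst z" and "\<tau> = snd z"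
  have st: "\<sigma> \<in> {0..1}" "\<tau> \<in> {0..1}" using z(1) by (auto simp: \<sigma>_def \<tau>_def)
  have lim: "(\<lambda>n. S (r n)) \<longlonglongrightarrow> \<sigma>" "(\<lambda>n. T (r n)) \<longlonglongrightarrow> \<tau>"
    using tendsto_fst[OF z(3)] tendsto_snd[OF z(3)] by (simp_all add: \<sigma>_def \<tau>_def o_def)
  have cA: "continuous_on {0..1} A" and cB: "continuous_on {0..1} B" using pA B by (auto simp: path_def)
  have limA: "(\<lambda>n. A (S (r n))) \<longlonglongrightarrow> A \<sigma>"
    by (rule continuous_on_tendsto_compose[OF cA lim(1) st(1)]) (use ST(1) in auto)
  have limB: "(\<lambda>n. B (T (r n))) \<longlonglongrightarrow> B \<tau>"
    by (rule continuous_on_tendsto_compose[OF cB lim(2) st(2)]) (use ST(2) in auto)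
  have "(\<lambda>n. d / (real n + 2)) \<longlonglongrightarrow> 0"
    using LIMSEQ_ignore_initial_segment[OF lim_const_over_n[of d], of 2] by (simp add: add.commute)
  then have "(\<lambda>n. c n) \<longlonglongrightarrow> u \<bullet> A m - 0" unfolding c_def by (intro tendsto_diff tendsto_const)
  then have limc: "(\<lambda>n. c (r n)) \<longlonglongrightarrow> u \<bullet> A m"
    using LIMSEQ_subseq_LIMSEQ[OF _ z(2), of c] by (simp add: o_def)
  \<comment> \<open>In the disc about \<open>cc\<close> only \<open>A m\<close> lies on the tangent:
    Pythagoras with the legs \<open>u\<close> and \<open>w - A m\<close>.\<close>
  have top: "w = A m" if "dist w cc \<le> dist (A m) cc" "u \<bullet> w = u \<bullet> A m" for w
  proof -
    have "u \<bullet> (w - cc) = (norm u)\<^sup>2" using that(2) uu by (simp add: inner_diff_right)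
    then have "(norm (w - A m))\<^sup>2 = (norm (w - cc))\<^sup>2 - (norm u)\<^sup>2"
      using power2_norm_eq_inner[of "(w - cc) - u"]
      by (simp add: u_def power2_norm_eq_inner inner_diff_left inner_diff_right inner_commute)
    also have "\<dots> \<le> 0" using that(1) nu by (simp add: dist_norm power_mono)
    finally show ?thesis by simp
  qed
  have "(\<lambda>n. u \<bullet> A (S (r n))) \<longlonglongrightarrow> u \<bullet> A \<sigma>" by (intro tendsto_intros limA)
  then have "u \<bullet> A \<sigma> = u \<bullet> A m" using limc ST(3) LIMSEQ_unique by simp
  then have Am: "A \<sigma> = A m" using top far(1) st by blast
  have "(\<lambda>n. u \<bullet> B (T (r n))) \<longlonglongrightarrow> u \<bullet> B \<tau>" by (intro tendsto_intros limB)
  then have "u \<bullet> B \<tau> = u \<bullet> A m" using limc ST(4) LIMSEQ_unique by simp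
  then have Bm: "B \<tau> = A m" using top far(2) st by blast
  have z01: "(0::real) \<in> {0..1}" by simp
  have "homotopic_paths X (subpath 0 \<sigma> A +++ linepath (A \<sigma>) (B \<tau>)) (subpath 0 \<tau> B)"
  proof (rule homotopic_paths_uniform_limit[OF X ST(5)[of "r _"]])
    have "uniform_limit {0..1} (\<lambda>n x. x *\<^sub>R (B (T (r n)) - A (S (r n))) + A (S (r n))) (\<lambda>x. x *\<^sub>R (B \<tau> - A \<sigma>) + A \<sigma>) sequentially"
      by (intro uniform_limit_affine tendsto_intros limA limB)
    then have "uniform_limit {0..1} (\<lambda>n. linepath (A (S (r n))) (B (T (r n)))) (linepath (A \<sigma>) (B \<tau>)) sequentially"
      by (simp add: linepath_def[abs_def] algebra_simps)
    then show "uniform_limit {0..1} (\<lambda>n. subpath 0 (S (r n)) A +++ linepath (A (S (r n))) (B (T (r n)))) (subpath 0 \<sigma> A +++ linepath (A \<sigma>) (B \<tau>)) sequentially"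
      by (intro uniform_limit_joinpaths uniform_limit_subpath[OF uniform_limit_const cA tendsto_const _ lim(1)])
         (use ST(1) st in auto)
    show "uniform_limit {0..1} (\<lambda>n. subpath 0 (T (r n)) B) (subpath 0 \<tau> B) sequentially"
      by (intro uniform_limit_subpath[OF uniform_limit_const cB tendsto_const _ lim(2)]) (use ST(2) st in auto)
  qed
  moreover have "homotopic_paths X (subpath 0 \<sigma> A +++ linepath (A \<sigma>) (B \<tau>)) (subpath 0 \<sigma> A)"
    unfolding Am Bm
  proof (rule homotopic_paths_rid')
    show "path (subpath 0 \<sigma> A)" using pA st by simp
    show "path_image (subpath 0 \<sigma> A) \<subseteq> X" using path_image_subpath_subset[of 0 \<sigma> A] pA st by auto
  qed (use Am in simp)
  ultimately have "homotopic_paths X (subpath 0 \<sigma> A) (subpath 0 \<tau> B)"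
    by (meson homotopic_paths_sym homotopic_paths_trans)
  then show thesis by (rule that[OF st Am Bm])
qed

section \<open>Matching the times of two homotopic tight paths\<close>

lemma path_in_segment_hits:
  fixes A :: "real \<Rightarrow> 'a::euclidean_space"
  assumes A: "path A" "A ` {0..1} \<subseteq> closed_segment (A 0) (A 1)" and w: "w \<in> closed_segment (A 0) (A 1)"
  obtains x where "x \<in> {0..1}" "A x = w"
proof -
  define u where "u = A 1 - A 0"
  have par: "\<exists>k. 0 \<le> k \<and> k \<le> 1 \<and> z = A 0 + k *\<^sub>R u" if "z \<in> closed_segment (A 0) (A 1)" for z
    using that by (auto simp: closed_segment_def u_def algebra_simps)
  obtain k where k: "0 \<le> k" "k \<le> 1" "w = A 0 + k *\<^sub>R u" using par[OF w] by blast
  have e1: "A 1 = A 0 + u" by (simp add: u_def)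
  have "continuous_on {0..1} (\<lambda>x. u \<bullet> A x)" using A(1) unfolding path_def by (intro continuous_intros)
  moreover have "u \<bullet> A 0 \<le> u \<bullet> w" "u \<bullet> w \<le> u \<bullet> A 1"
    unfolding k(3) e1 using k(1,2) by (simp_all add: inner_add_right mult_right_le_one_le mult_left_le_one_le)
  ultimately obtain x where x: "0 \<le> x" "x \<le> 1" "u \<bullet> A x = u \<bullet> w"
    using IVT'[of "\<lambda>x. u \<bullet> A x" 0 "u \<bullet> w" 1] by auto
  then obtain j where j: "A x = A 0 + j *\<^sub>R u" using par A(2) by (metis atLeastAtMost_iff image_subset_iff)
  have "j * (u \<bullet> u) = k * (u \<bullet> u)" using x(3) unfolding j k(3) by (simp add: inner_add_right)
  then have "j *\<^sub>R u = k *\<^sub>R u" by auto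
  then have "A x = w" unfolding j k(3) by simp
  then show thesis using that x by auto
qed

text \<open>Equality of points alone would also record accidental crossings. With homotopic initial
  subpaths, the subpaths between two comparable meeting times are homotopic again and remain tight,
  so the comparison can be repeated between them.\<close>

definition meeting_times :: "(real^2) set \<Rightarrow> (real \<Rightarrow> real^2) \<Rightarrow> (real \<Rightarrow> real^2) \<Rightarrow> (real \<times> real) set" where
  "meeting_times X a b = {z \<in> unit_square. a (fst z) = b (snd z) \<and>
     homotopic_paths X (subpath 0 (fst z) a) (subpath 0 (snd z) b)}"

lemma closed_meeting_times:
  fixes X :: "(real^2) set"
  assumes X: "closed X" and a: "path a" and b: "path b"
  shows "closed (meeting_times X a b)"
  unfolding closed_sequential_limits
proof (intro allI impI)
  fix z l assume "(\<forall>n. z n \<in> meeting_times X a b) \<and> z \<longlonglongrightarrow> l"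
  then have z: "\<And>n. z n \<in> unit_square" "\<And>n. a (fst (z n)) = b (snd (z n))"
    "\<And>n. homotopic_paths X (subpath 0 (fst (z n)) a) (subpath 0 (snd (z n)) b)" and l: "z \<longlonglongrightarrow> l"
    by (auto simp: meeting_times_def)
  have lQ: "l \<in> unit_square" using closed_sequentially[OF unit_square_facts(3) z(1) l] .
  have f: "fst (z n) \<in> {0..1}" "snd (z n) \<in> {0..1}" for n using z(1)[of n] unfolding mem_Times_iff by auto
  have fl: "fst l \<in> {0..1}" "snd l \<in> {0..1}" using lQ unfolding mem_Times_iff by auto
  have lim: "(\<lambda>n. fst (z n)) \<longlonglongrightarrow> fst l" "(\<lambda>n. snd (z n)) \<longlonglongrightarrow> snd l" using l by (auto intro: tendsto_intros)
  have c: "continuous_on {0..1} a" "continuous_on {0..1} b" using a b by (auto simp: path_def)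
  have z0: "(0::real) \<in> {0..1}" by simp
  have "(\<lambda>n. a (fst (z n))) \<longlonglongrightarrow> a (fst l)"
    by (rule continuous_on_tendsto_compose[OF c(1) lim(1) fl(1)]) (use f in auto)
  moreover have "(\<lambda>n. b (snd (z n))) \<longlonglongrightarrow> b (snd l)"
    by (rule continuous_on_tendsto_compose[OF c(2) lim(2) fl(2)]) (use f in auto)
  ultimately have "a (fst l) = b (snd l)" unfolding z(2) by (rule LIMSEQ_unique)
  moreover have "homotopic_paths X (subpath 0 (fst l) a) (subpath 0 (snd l) b)"
    by (rule homotopic_paths_uniform_limit[OF X z(3)
        uniform_limit_subpath[OF uniform_limit_const c(1) tendsto_const z0 lim(1) f(1) z0 fl(1)]
        uniform_limit_subpath[OF uniform_limit_const c(2) tendsto_const z0 lim(2) f(2) z0 fl(2)]])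
  ultimately show "l \<in> meeting_times X a b" using lQ by (simp add: meeting_times_def)
qed

lemma subpath_subpath: "subpath 0 x (subpath s t a) = subpath s ((t - s) * x + s) a"
  by (simp add: subpath_def fun_eq_iff algebra_simps)

text \<open>The homotopies of the initial subpaths yield one between the subpaths from the first
  meeting time to the second. If one of these leaves the segment between the common ends, a farthest
  point serves; otherwise everything happens inside a segment contained in \<open>X\<close>, where
  all paths with the same ends are homotopic and it suffices to find a common point at new
  times.\<close>

lemma meeting_times_gap:
  assumes X: "closed X" and a: "tight X a" and b: "tight X b"
    and J: "(s, t) \<in> meeting_times X a b" "(s', t') \<in> meeting_times X a b"
    and le: "s \<le> s'" "t \<le> t'" and ne: "(s, t) \<noteq> (s', t')"
  obtains \<sigma> \<tau> where "(\<sigma>, \<tau>) \<in> meeting_times X a b" "s \<le> \<sigma>" "\<sigma> \<le> s'" "t \<le> \<tau>" "\<tau> \<le> t'"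
    "(\<sigma>, \<tau>) \<noteq> (s, t)" "(\<sigma>, \<tau>) \<noteq> (s', t')"
proof -
  note gapI = that
  have pa: "path a" "path_image a \<subseteq> X" and pb: "path b" "path_image b \<subseteq> X" using a b by (auto simp: tight_def)
  have i: "0 \<le> s" "s' \<le> 1" "0 \<le> t" "t' \<le> 1" and st: "a s = b t" "a s' = b t'"
    and hs: "homotopic_paths X (subpath 0 s a) (subpath 0 t b)" "homotopic_paths X (subpath 0 s' a) (subpath 0 t' b)"
    using J by (auto simp: meeting_times_def)
  have in01: "0 \<in> {0..1::real}" "s \<in> {0..1}" "s' \<in> {0..1}" "t \<in> {0..1}" "t' \<in> {0..1}" using i le by auto
  let ?A = "subpath s s' a" and ?B = "subpath t t' b"
  have tA: "tight X ?A" and tB: "tight X ?B" using tight_subpath a b i le by blast+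
  have pA: "path ?A" "path_image ?A \<subseteq> X" and pB: "path ?B" "path_image ?B \<subseteq> X" using tA tB by (auto simp: tight_def)
  have ends: "?A 0 = a s" "?A 1 = a s'" "?B 0 = a s" "?B 1 = a s'" using st by (simp_all add: subpath_def)
  have hAB: "homotopic_paths X ?A ?B"
  proof -
    have "homotopic_paths X (subpath s 0 a) (subpath t 0 b)"
      using hs(1) homotopic_paths_reversepath[of X "subpath 0 s a" "subpath 0 t b"]
      by (simp only: reversepath_subpath)
    then have "homotopic_paths X (subpath s 0 a +++ subpath 0 s' a) (subpath t 0 b +++ subpath 0 t' b)"
      by (rule homotopic_paths_join[OF _ hs(2)]) (simp add: pathfinish_def pathstart_def subpath_def)
    moreover have "homotopic_paths X (subpath s 0 a +++ subpath 0 s' a) ?A"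
      by (rule homotopic_join_subpaths[OF pa in01(2,1,3)])
    moreover have "homotopic_paths X (subpath t 0 b +++ subpath 0 t' b) ?B"
      by (rule homotopic_join_subpaths[OF pb in01(4,1,5)])
    ultimately show ?thesis by (meson homotopic_paths_sym homotopic_paths_trans)
  qed
  have finish: thesis if xy: "x \<in> {0..1}" "y \<in> {0..1}" "?A x = ?B y"
      and h: "homotopic_paths X (subpath 0 x ?A) (subpath 0 y ?B)"
      and d: "((s' - s) * x + s, (t' - t) * y + t) \<noteq> (s, t)" "((s' - s) * x + s, (t' - t) * y + t) \<noteq> (s', t')" for x y
  proof -
    define \<sigma> \<tau> where "\<sigma> = (s' - s) * x + s" and "\<tau> = (t' - t) * y + t"
    have k: "0 \<le> (v' - v) * z \<and> (v' - v) * z \<le> v' - v" if "v \<le> v'" "z \<in> {0..1}" for v v' z :: real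
      using that mult_left_mono[of z 1 "v' - v"] by simp
    have b1: "s \<le> \<sigma>" "\<sigma> \<le> s'" "t \<le> \<tau>" "\<tau> \<le> t'"
      using k[OF le(1) xy(1)] k[OF le(2) xy(2)] unfolding \<sigma>_def \<tau>_def by simp_all
    have 01: "\<sigma> \<in> {0..1}" "\<tau> \<in> {0..1}" using b1 i by auto
    have eq: "a \<sigma> = b \<tau>" using xy(3) by (simp add: subpath_def \<sigma>_def \<tau>_def)
    have "homotopic_paths X (subpath 0 s a +++ subpath s \<sigma> a) (subpath 0 t b +++ subpath t \<tau> b)"
      by (rule homotopic_paths_join[OF hs(1) h[unfolded subpath_subpath, folded \<sigma>_def \<tau>_def]])
         (simp add: pathfinish_def pathstart_def subpath_def)
    moreover have "homotopic_paths X (subpath 0 s a +++ subpath s \<sigma> a) (subpath 0 \<sigma> a)"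
      by (rule homotopic_join_subpaths[OF pa in01(1,2) 01(1)])
    moreover have "homotopic_paths X (subpath 0 t b +++ subpath t \<tau> b) (subpath 0 \<tau> b)"
      by (rule homotopic_join_subpaths[OF pb in01(1,4) 01(2)])
    ultimately have "homotopic_paths X (subpath 0 \<sigma> a) (subpath 0 \<tau> b)"
      by (meson homotopic_paths_sym homotopic_paths_trans)
    then have "(\<sigma>, \<tau>) \<in> meeting_times X a b" using 01 eq by (simp add: meeting_times_def)
    then show thesis using gapI[of \<sigma> \<tau>] b1 d unfolding \<sigma>_def \<tau>_def by blast
  qed
  have away: "((s' - s) * x + s, (t' - t) * y + t) \<noteq> (s, t)" "((s' - s) * x + s, (t' - t) * y + t) \<noteq> (s', t')"
    if "?A x \<noteq> a s" "?A x \<noteq> a s'" for x y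
    using that by (auto simp: subpath_def)
  show thesis
  proof (cases "?A ` {0..1} \<union> ?B ` {0..1} \<subseteq> closed_segment (a s) (a s')")
    case True
    then have sA: "?A ` {0..1} \<subseteq> closed_segment (?A 0) (?A 1)" and sB: "?B ` {0..1} \<subseteq> closed_segment (?B 0) (?B 1)"
      unfolding ends by blast+
    \<comment> \<open>By the intermediate value theorem the subpath of \<open>a\<close> covers the
      whole segment.\<close>
    have segX: "closed_segment (a s) (a s') \<subseteq> X"
    proof
      fix w assume w: "w \<in> closed_segment (a s) (a s')"
      obtain x where "x \<in> {0..1}" "?A x = w"
        using path_in_segment_hits[OF pA(1) sA] w unfolding ends by metis
      then show "w \<in> X" using pA(2) unfolding path_image_def by blast
    qed
    have seg: thesis if xy: "x \<in> {0..1}" "y \<in> {0..1}" "?A x = ?B y"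
      and d: "((s' - s) * x + s, (t' - t) * y + t) \<noteq> (s, t)" "((s' - s) * x + s, (t' - t) * y + t) \<noteq> (s', t')" for x y
    proof (rule finish[OF xy _ d])
      show "homotopic_paths X (subpath 0 x ?A) (subpath 0 y ?B)"
      proof (rule homotopic_paths_in_convex[OF convex_closed_segment segX])
        show "path (subpath 0 x ?A)" "path (subpath 0 y ?B)" using pA pB xy by simp_all
        show "path_image (subpath 0 x ?A) \<subseteq> closed_segment (a s) (a s')"
          using path_image_subpath_subset[OF in01(1) xy(1), of ?A] True unfolding path_image_def by blast
        show "path_image (subpath 0 y ?B) \<subseteq> closed_segment (a s) (a s')"
          using path_image_subpath_subset[OF in01(1) xy(2), of ?B] True unfolding path_image_def by blast
        show "pathstart (subpath 0 y ?B) = pathstart (subpath 0 x ?A)"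
          unfolding pathstart_subpath ends ..
        show "pathfinish (subpath 0 y ?B) = pathfinish (subpath 0 x ?A)"
          unfolding pathfinish_subpath using xy(3) by simp
      qed
    qed
    show thesis
    proof (cases "a s = a s'")
      case eq: True
      then have const: "?A x = a s" "?B x = a s" if "x \<in> {0..1}" for x
      proof -
        have "?A x \<in> closed_segment (a s) (a s')" "?B x \<in> closed_segment (a s) (a s')" using True that by blast+
        then show "?A x = a s" "?B x = a s" unfolding eq by simp_all
      qed
      show thesis
      \<comment> \<open>Both subpaths are constant here. If both times advance, the corner
        \<open>(s', t)\<close> is a new pair; if only one does, the midpoint in that coordinate
        gives one.\<close>
      proof (cases "s < s' \<and> t < t'")
        case True
        show thesis by (rule seg[of 1 0]) (use True const in auto)
      next
        case False
        then have d: "s < s' \<or> t < t'" using le ne by auto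
        have h: "(v' - v) * (1/2) + v \<noteq> v \<and> (v' - v) * (1/2) + v \<noteq> v'" if "v < v'" for v v' :: real
          using that by (simp add: field_simps)
        show thesis
          by (rule seg[of "1/2" "1/2"]) (use const[of "1/2"] d h[of s s'] h[of t t'] in \<open>simp, simp, simp, unfold prod.inject, blast+\<close>)
      qed
    next
      case ne2: False
      define w where "w = midpoint (a s) (a s')"
      have w: "w \<in> closed_segment (a s) (a s')" by (simp add: w_def)
      have wn: "w \<noteq> a s" "w \<noteq> a s'" using ne2 by (auto simp: w_def)
      obtain x where x: "x \<in> {0..1}" "?A x = w" using path_in_segment_hits[OF pA(1) sA] w unfolding ends by metis
      obtain y where y: "y \<in> {0..1}" "?B y = w" using path_in_segment_hits[OF pB(1) sB] w unfolding ends by metis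
      have n: "?A x \<noteq> a s" "?A x \<noteq> a s'" using x(2) wn by simp_all
      show thesis by (rule seg[OF x(1) y(1) _ away[OF n]]) (use x y in simp)
    qed
  next
    case False
    then obtain w where w: "w \<in> ?A ` {0..1} \<union> ?B ` {0..1}" "w \<notin> closed_segment (a s) (a s')" by blast
    obtain cc where cc: "dist (a s) cc < dist w cc" "dist (a s') cc < dist w cc"
      using ball_separating_point_from_segment[OF w(2)] by blast
    have "compact (?A ` {0..1} \<union> ?B ` {0..1})"
      using pA(1) pB(1) unfolding path_def by (intro compact_Un compact_continuous_image compact_Icc)
    moreover have "continuous_on (?A ` {0..1} \<union> ?B ` {0..1}) (\<lambda>z. dist z cc)" by (intro continuous_intros)
    ultimately obtain v where v: "v \<in> ?A ` {0..1} \<union> ?B ` {0..1}" "\<forall>z\<in>?A ` {0..1} \<union> ?B ` {0..1}. dist z cc \<le> dist v cc"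
      using continuous_attains_sup[of "?A ` {0..1} \<union> ?B ` {0..1}"] w(1) by blast
    have vw: "dist (a s) cc < dist v cc" "dist (a s') cc < dist v cc" using cc v(2) w(1) by (meson less_le_trans)+
    then have vn: "v \<noteq> a s" "v \<noteq> a s'" by auto
    have far: "dist (?A x) cc \<le> dist v cc" "dist (?B x) cc \<le> dist v cc" if "x \<in> {0..1}" for x
      using v(2) that by blast+
    obtain x y where xy: "x \<in> {0..1}" "y \<in> {0..1}" "?A x = v" "?B y = v" "homotopic_paths X (subpath 0 x ?A) (subpath 0 y ?B)"
    proof (cases "v \<in> ?A ` {0..1}")
      case True
      then obtain m where m: "m \<in> {0..1}" "v = ?A m" by blast
      show thesis
        by (rule tight_meets_at_farthest_point[OF X tA pB hAB m(1), of cc])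
           (use far vw that m ends in auto)
    next
      case False
      then obtain m where m: "m \<in> {0..1}" "v = ?B m" using v(1) by blast
      show thesis
      proof (rule tight_meets_at_farthest_point[OF X tB pA homotopic_paths_sym[OF hAB] m(1)])
        show "dist (?B x) cc \<le> dist (?B m) cc" "dist (?A x) cc \<le> dist (?B m) cc" if "x \<in> {0..1}" for x
          using far[OF that] m(2) by simp_all
        show "dist (?B 1) cc < dist (?B m) cc" using vw(2) m(2) ends by simp
        fix \<sigma> \<tau>
        assume h: "\<sigma> \<in> {0..1}" "\<tau> \<in> {0..1}" "?B \<sigma> = ?B m" "?A \<tau> = ?B m" "homotopic_paths X (subpath 0 \<sigma> ?B) (subpath 0 \<tau> ?A)"
        show thesis by (rule that[OF h(2,1) _ _ homotopic_paths_sym[OF h(5)]]) (use h m(2) in simp_all)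
      qed
    qed
    have n: "?A x \<noteq> a s" "?A x \<noteq> a s'" using xy(3) vn by simp_all
    show thesis by (rule finish[OF xy(1,2) _ xy(5) away[OF n]]) (use xy in simp)
  qed
qed

text \<open>The coordinate sum maps a maximal chain of the set bijectively onto the interval from 0 to 2.\<close>
lemma monotone_curve_in_gapless_set:
  fixes J :: "(real \<times> real) set"
  assumes J: "closed J" "J \<subseteq> unit_square" "(0,0) \<in> J" "(1,1) \<in> J"
    and gap: "\<And>s t s' t'. (s, t) \<in> J \<Longrightarrow> (s', t') \<in> J \<Longrightarrow> s \<le> s' \<Longrightarrow> t \<le> t' \<Longrightarrow> (s, t) \<noteq> (s', t') \<Longrightarrow>
      \<exists>\<sigma> \<tau>. (\<sigma>, \<tau>) \<in> J \<and> s \<le> \<sigma> \<and> \<sigma> \<le> s' \<and> t \<le> \<tau> \<and> \<tau> \<le> t' \<and> (\<sigma>, \<tau>) \<noteq> (s, t) \<and> (\<sigma>, \<tau>) \<noteq> (s', t')"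
  obtains \<phi> \<psi> :: "real \<Rightarrow> real" where "mono_on {0..1} \<phi>" "\<phi> ` {0..1} = {0..1}" "mono_on {0..1} \<psi>" "\<psi> ` {0..1} = {0..1}"
    "\<And>x. x \<in> {0..1} \<Longrightarrow> (\<phi> x, \<psi> x) \<in> J"
proof -
  define le :: "real \<times> real \<Rightarrow> real \<times> real \<Rightarrow> bool" where "le x y \<longleftrightarrow> fst x \<le> fst y \<and> snd x \<le> snd y" for x y
  define \<C> where "\<C> = {C. C \<subseteq> J \<and> (\<forall>x\<in>C. \<forall>y\<in>C. le x y \<or> le y x)}"
  have "\<exists>M\<in>\<C>. \<forall>Y\<in>\<C>. M \<subseteq> Y \<longrightarrow> Y = M"
  proof (rule subset_Zorn')
    fix K assume K: "subset.chain \<C> K"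
    show "\<Union>K \<in> \<C>"
      unfolding \<C>_def
    proof (intro CollectI conjI ballI)
      show "\<Union>K \<subseteq> J" using K unfolding \<C>_def subset_chain_def by blast
      fix x y assume "x \<in> \<Union>K" "y \<in> \<Union>K"
      then obtain C D where "C \<in> K" "D \<in> K" "x \<in> C" "y \<in> D" by blast
      moreover from this have "C \<subseteq> D \<or> D \<subseteq> C" "C \<in> \<C>" "D \<in> \<C>" using K unfolding subset_chain_def by blast+
      ultimately show "le x y \<or> le y x" unfolding \<C>_def by blast
    qed
  qed
  then obtain C where CC: "C \<in> \<C>" and Cmax: "\<And>Y. Y \<in> \<C> \<Longrightarrow> C \<subseteq> Y \<Longrightarrow> Y = C" by blast
  have C: "C \<subseteq> J" "\<And>x y. x \<in> C \<Longrightarrow> y \<in> C \<Longrightarrow> le x y \<or> le y x" using CC unfolding \<C>_def by blast+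
  have add: "z \<in> C" if "z \<in> J" "\<And>c. c \<in> C \<Longrightarrow> le c z \<or> le z c" for z
  proof -
    have "le z z" by (simp add: le_def)
    then have "insert z C \<in> \<C>" unfolding \<C>_def using that C by blast
    then show ?thesis using Cmax by blast
  qed
  have C01: "(0,0) \<in> C" "(1,1) \<in> C"
    by (rule add; use J C(1) in \<open>auto simp: le_def\<close>)+
  \<comment> \<open>Comparability with a fixed point is a closed condition, so the closure of a
    chain is a chain and the maximal chain \<open>C\<close> is closed.\<close>
  have closedle: "closed {x. le x y \<or> le y x}" for y
    unfolding le_def by (intro closed_Collect_disj closed_Collect_conj closed_Collect_le continuous_intros)
  have cl1: "le x y \<or> le y x" if "x \<in> closure C" "y \<in> C" for x y
    using closure_minimal[OF _ closedle[of y], of C] C(2) that by blast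
  have "le x y \<or> le y x" if "x \<in> closure C" "y \<in> closure C" for x y
    using closure_minimal[OF _ closedle[of y], of C] cl1 that by blast
  moreover have "closure C \<subseteq> J" using closure_minimal[OF C(1) J(1)] .
  ultimately have "closure C \<in> \<C>" unfolding \<C>_def by blast
  then have "closure C = C" using Cmax closure_subset by blast
  then have "closed C" by (metis closed_closure)
  then have compC: "compact C"
    using C(1) J(2) unit_square_facts(2) by (metis compact_Int_closed inf.absorb_iff2 subset_trans)
  define \<Sigma> :: "real \<times> real \<Rightarrow> real" where "\<Sigma> z = fst z + snd z" for z
  have leS: "le x y \<Longrightarrow> \<Sigma> x \<le> \<Sigma> y" and leeq: "le x y \<Longrightarrow> \<Sigma> y \<le> \<Sigma> x \<Longrightarrow> x = y" for x y
    by (auto simp: le_def \<Sigma>_def prod_eq_iff)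
  have contS: "continuous_on S \<Sigma>" for S unfolding \<Sigma>_def[abs_def] by (intro continuous_intros)
  \<comment> \<open>If the level \<open>r\<close> is missed, the highest point \<open>P\<close> of
    the chain below it and the lowest point \<open>Q\<close> above it are comparable. The gap
    condition gives a point \<open>R\<close> between them that is comparable with the whole chain,
    so maximality puts it into \<open>C\<close>, although its sum lies strictly between those of
    \<open>P\<close> and \<open>Q\<close>.\<close>
  have surj: "\<exists>z\<in>C. \<Sigma> z = r" if r: "0 \<le> r" "r \<le> 2" for r
  proof (rule ccontr)
    assume no: "\<not> (\<exists>z\<in>C. \<Sigma> z = r)"
    have "closed {z. \<Sigma> z \<le> r}" "closed {z. r \<le> \<Sigma> z}"
      unfolding \<Sigma>_def by (intro closed_Collect_le continuous_intros)+
    then have comp: "compact (C \<inter> {z. \<Sigma> z \<le> r})" "compact (C \<inter> {z. r \<le> \<Sigma> z})" using compC compact_Int_closed by blast+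
    have "(0,0) \<in> C \<inter> {z. \<Sigma> z \<le> r}" "(1,1) \<in> C \<inter> {z. r \<le> \<Sigma> z}" using C01 r by (auto simp: \<Sigma>_def)
    then obtain P Q where P: "P \<in> C" "\<Sigma> P \<le> r" "\<And>z. z \<in> C \<Longrightarrow> \<Sigma> z \<le> r \<Longrightarrow> \<Sigma> z \<le> \<Sigma> P"
      and Q: "Q \<in> C" "r \<le> \<Sigma> Q" "\<And>z. z \<in> C \<Longrightarrow> r \<le> \<Sigma> z \<Longrightarrow> \<Sigma> Q \<le> \<Sigma> z"
      using continuous_attains_sup[OF comp(1) _ contS] continuous_attains_inf[OF comp(2) _ contS] by blast
    have lt: "\<Sigma> P < r" "r < \<Sigma> Q" using P(1,2) Q(1,2) no by (metis order_le_less)+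
    then have PQ: "le P Q" "P \<noteq> Q" using C(2)[OF P(1) Q(1)] leS by fastforce+
    obtain s t s' t' where PQ': "P = (s, t)" "Q = (s', t')" by (cases P; cases Q)
    have "\<exists>\<sigma> \<tau>. (\<sigma>, \<tau>) \<in> J \<and> s \<le> \<sigma> \<and> \<sigma> \<le> s' \<and> t \<le> \<tau> \<and> \<tau> \<le> t' \<and> (\<sigma>, \<tau>) \<noteq> (s, t) \<and> (\<sigma>, \<tau>) \<noteq> (s', t')"
      by (rule gap) (use P(1) Q(1) C(1) PQ in \<open>auto simp: PQ' le_def\<close>)
    then obtain R where R: "R \<in> J" "le P R" "le R Q" "R \<noteq> P" "R \<noteq> Q" unfolding PQ' le_def by fastforce
    have trans: "le x y \<Longrightarrow> le y z \<Longrightarrow> le x z" for x y z by (auto simp: le_def)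
    have "R \<in> C"
    proof (rule add[OF R(1)])
      fix c assume c: "c \<in> C"
      show "le c R \<or> le R c"
      proof (cases "\<Sigma> c \<le> r")
        case True
        then have "le c P" using C(2)[OF c P(1)] leeq[of P c] P(3)[OF c] by blast
        then show ?thesis using trans R(2) by blast
      next
        case False
        then have "le Q c" using C(2)[OF c Q(1)] leeq[of c Q] Q(3)[OF c] by force
        then show ?thesis using trans R(3) by blast
      qed
    qed
    then show False
      using P(3)[of R] Q(3)[of R] leeq[OF R(2)] leeq[OF R(3)] R(4,5) by (metis linear)
  qed
  have "\<forall>r\<in>{0..1}. \<exists>z. z \<in> C \<and> \<Sigma> z = 2 * r"
  proof
    fix r :: real assume "r \<in> {0..1}"
    then have "0 \<le> 2 * r" "2 * r \<le> 2" by auto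
    from surj[OF this] show "\<exists>z. z \<in> C \<and> \<Sigma> z = 2 * r" by blast
  qed
  from bchoice[OF this] obtain \<rho> where \<rho>: "\<And>r. r \<in> {0..1} \<Longrightarrow> \<rho> r \<in> C" "\<And>r. r \<in> {0..1} \<Longrightarrow> \<Sigma> (\<rho> r) = 2 * r" by blast
  have mono: "le (\<rho> x) (\<rho> y)" if xy: "x \<in> {0..1}" "y \<in> {0..1}" "x \<le> y" for x y
    using C(2)[OF \<rho>(1)[OF xy(1)] \<rho>(1)[OF xy(2)]]
  proof
    assume "le (\<rho> y) (\<rho> x)"
    moreover have "\<Sigma> (\<rho> x) \<le> \<Sigma> (\<rho> y)" using \<rho>(2) xy by simp
    ultimately have "\<rho> y = \<rho> x" by (rule leeq)
    then show ?thesis by (simp add: le_def)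
  qed
  have ends: "\<rho> 0 = (0,0)" "\<rho> 1 = (1,1)"
  proof -
    have "le (0,0) (\<rho> 0)" "le (\<rho> 1) (1,1)" using \<rho>(1)[of 0] \<rho>(1)[of 1] C(1) J(2) by (auto simp: le_def)
    then show "\<rho> 0 = (0,0)" "\<rho> 1 = (1,1)" using leeq[of "(0,0)" "\<rho> 0"] leeq[of "\<rho> 1" "(1,1)"] \<rho>(2)[of 0] \<rho>(2)[of 1]
      by (auto simp: \<Sigma>_def)
  qed
  have img: "f ` {0..1} = {0..1}" if f: "f 0 = 0" "f 1 = 1" and m: "\<And>x y. x \<in> {0..1} \<Longrightarrow> y \<in> {0..1} \<Longrightarrow> x \<le> y \<Longrightarrow> f x \<le> f y \<and> f y - f x \<le> 2 * (y - x)"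
    for f :: "real \<Rightarrow> real"
  proof
    show "f ` {0..1} \<subseteq> {0..1}" using m[of 0] m[of _ 1] f by fastforce
    have "continuous_on {0..1} f"
      unfolding continuous_on_iff
    proof (intro ballI allI impI)
      fix x e :: real assume x: "x \<in> {0..1}" and e: "0 < e"
      have "dist (f y) (f x) < e" if "y \<in> {0..1}" "dist y x < e/2" for y
      proof -
        have "\<bar>f y - f x\<bar> \<le> 2 * \<bar>y - x\<bar>" using m[of x y] m[of y x] x that(1) by (cases "x \<le> y") auto
        then show ?thesis using that(2) by (simp add: dist_real_def)
      qed
      then show "\<exists>d>0. \<forall>y\<in>{0..1}. dist y x < d \<longrightarrow> dist (f y) (f x) < e" using e by (intro exI[of _ "e/2"]) auto
    qed
    then have "\<exists>x. 0 \<le> x \<and> x \<le> 1 \<and> f x = y" if "y \<in> {0..1}" for y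
      using IVT'[of f 0 y 1] f that by auto
    then show "{0..1} \<subseteq> f ` {0..1}" by (force simp: image_iff)
  qed
  \<comment> \<open>Both coordinates of \<open>\<rho>\<close> increase and their sum has slope 2, so
    neither grows faster than that; this gives continuity and hence surjectivity.\<close>
  have lip: "fst (\<rho> x) \<le> fst (\<rho> y) \<and> fst (\<rho> y) - fst (\<rho> x) \<le> 2 * (y - x)" "snd (\<rho> x) \<le> snd (\<rho> y) \<and> snd (\<rho> y) - snd (\<rho> x) \<le> 2 * (y - x)"
    if "x \<in> {0..1}" "y \<in> {0..1}" "x \<le> y" for x y
    using mono[OF that] \<rho>(2)[OF that(1)] \<rho>(2)[OF that(2)] by (auto simp: le_def \<Sigma>_def)
  show thesis
  proof (rule that[of "\<lambda>x. fst (\<rho> x)" "\<lambda>x. snd (\<rho> x)"])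
    show "mono_on {0..1} (\<lambda>x. fst (\<rho> x))" "mono_on {0..1} (\<lambda>x. snd (\<rho> x))"
      by (rule mono_onI; use lip in blast)+
    show "(\<lambda>x. fst (\<rho> x)) ` {0..1} = {0..1}" by (rule img) (use ends lip(1) in auto)
    show "(\<lambda>x. snd (\<rho> x)) ` {0..1} = {0..1}" by (rule img) (use ends lip(2) in auto)
    show "(fst (\<rho> x), snd (\<rho> x)) \<in> J" if "x \<in> {0..1}" for x using \<rho>(1)[OF that] C(1) by auto
  qed
qed

section \<open>Uniqueness up to reparametrization and global minimality\<close>

lemma tight_unique:
  assumes X: "closed X" and a: "tight X a" and b: "tight X b" and hom: "homotopic_paths X a b"
  shows "is_reparametrization a b"
proof -
  have pa: "path a" "path_image a \<subseteq> X" and pb: "path b" "path_image b \<subseteq> X" using a b by (auto simp: tight_def)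
  have ends: "a 0 = b 0" "a 1 = b 1"
    using homotopic_paths_imp_pathstart[OF hom] homotopic_paths_imp_pathfinish[OF hom] by (simp_all add: pathstart_def pathfinish_def)
  let ?J = "meeting_times X a b"
  have "a 0 \<in> X" using pa(2) unfolding path_image_def by auto
  then have "homotopic_paths X (subpath 0 0 a) (subpath 0 0 b)"
    using ends by (simp add: subpath_refl)
  then have J0: "(0,0) \<in> ?J" using ends by (simp add: meeting_times_def)
  have J1: "(1,1) \<in> ?J" using ends hom by (simp add: meeting_times_def)
  have JQ: "?J \<subseteq> unit_square" by (auto simp: meeting_times_def)
  show ?thesis
  proof (rule monotone_curve_in_gapless_set[OF closed_meeting_times[OF X pa(1) pb(1)] JQ J0 J1])
    fix s t s' t'
    assume J: "(s, t) \<in> ?J" "(s', t') \<in> ?J" "s \<le> s'" "t \<le> t'" "(s, t) \<noteq> (s', t')"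
    show "\<exists>\<sigma> \<tau>. (\<sigma>, \<tau>) \<in> ?J \<and> s \<le> \<sigma> \<and> \<sigma> \<le> s' \<and> t \<le> \<tau> \<and> \<tau> \<le> t' \<and> (\<sigma>, \<tau>) \<noteq> (s, t) \<and> (\<sigma>, \<tau>) \<noteq> (s', t')"
      by (rule meeting_times_gap[OF X a b J]) blast
  next
    fix \<phi> \<psi> :: "real \<Rightarrow> real"
    assume r: "mono_on {0..1} \<phi>" "\<phi> ` {0..1} = {0..1}" "mono_on {0..1} \<psi>" "\<psi> ` {0..1} = {0..1}"
      "\<And>x. x \<in> {0..1} \<Longrightarrow> (\<phi> x, \<psi> x) \<in> ?J"
    have "a (\<phi> x) = b (\<psi> x)" if "x \<in> {0..1}" for x using r(5)[OF that] by (simp add: meeting_times_def)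
    then show "is_reparametrization a b"
      unfolding is_reparametrization_def by (intro exI[of _ \<phi>] exI[of _ \<psi>] conjI ballI r(1-4))
  qed
qed

text \<open>Since \<open>\<phi>\<close> need not be injective, a right inverse
  \<open>\<theta>\<close> is chosen. It is automatically monotone, although it may jump, and the
  composition of \<open>\<psi>\<close> with it is a time change that \<open>osc_le_reparam\<close>
  admits.\<close>

lemma osc_le_if_reparametrization:
  assumes "is_reparametrization a b" "path b"
  shows "osc a P \<le> osc b P"
proof -
  obtain \<phi> \<psi> :: "real \<Rightarrow> real" where r: "mono_on {0..1} \<phi> \<and> \<phi> ` {0..1} = {0..1} \<and> mono_on {0..1} \<psi> \<and>
    \<psi> ` {0..1} = {0..1} \<and> (\<forall>t\<in>{0..1}. a (\<phi> t) = b (\<psi> t))"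
    using assms(1) unfolding is_reparametrization_def by (elim exE) (rule that)
  then have \<phi>: "mono_on {0..1} \<phi>" "\<phi> ` {0..1} = {0..1}" and \<psi>: "mono_on {0..1} \<psi>" "\<psi> ` {0..1} = {0..1}" by simp_all
  have eq: "a (\<phi> t) = b (\<psi> t)" if "t \<in> {0..1}" for t using r that by blast
  have "\<forall>x\<in>{0..1}. \<exists>t. t \<in> {0..1} \<and> \<phi> t = x" using \<phi>(2) by (metis image_iff)
  from bchoice[OF this] obtain \<theta> where \<theta>: "\<And>x. x \<in> {0..1} \<Longrightarrow> \<theta> x \<in> {0..1} \<and> \<phi> (\<theta> x) = x" by blast
  show ?thesis
  proof (rule osc_le_reparam[OF assms(2), of "\<lambda>x. \<psi> (\<theta> x)"])
    show "mono_on {0..1} (\<lambda>x. \<psi> (\<theta> x))"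
    proof (rule mono_onI)
      fix x y :: real assume xy: "x \<in> {0..1}" "y \<in> {0..1}" "x \<le> y"
      have "\<theta> x \<le> \<theta> y"
      proof (rule ccontr)
        assume "\<not> \<theta> x \<le> \<theta> y"
        then have "\<phi> (\<theta> y) \<le> \<phi> (\<theta> x)"
          using mono_onD[OF \<phi>(1), of "\<theta> y" "\<theta> x"] \<theta>[OF xy(1)] \<theta>[OF xy(2)] by simp
        then have "x = y" using \<theta>[OF xy(1)] \<theta>[OF xy(2)] xy(3) by simp
        then show False using \<open>\<not> \<theta> x \<le> \<theta> y\<close> by simp
      qed
      then show "\<psi> (\<theta> x) \<le> \<psi> (\<theta> y)" using mono_onD[OF \<psi>(1), of "\<theta> x" "\<theta> y"] \<theta>[OF xy(1)] \<theta>[OF xy(2)] by simp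
    qed
    show "\<psi> (\<theta> t) \<in> {0..1}" if "t \<in> {0..1}" for t using \<theta>[OF that] \<psi>(2) by blast
    show "gPQ P (a t) = gPQ P (b (\<psi> (\<theta> t)))" if "t \<in> {0..1}" for t using \<theta>[OF that] eq[of "\<theta> t"] by simp
  qed
qed

theorem theorem4p8:
  fixes X :: "(real^2) set" and L :: "nat \<Rightarrow> linepair" and p :: "real \<Rightarrow> real^2"
  assumes "compact X" and "connected X" and "X \<noteq> {}"
    and "dense_linepair_seq L"
    and "path p" and "path_image p \<subseteq> X"
  shows "(\<exists>\<gamma>. homotopic_paths X p \<gamma> \<and> osc_geodesic L X \<gamma>) \<and>
         (\<forall>\<gamma>1 \<gamma>2. homotopic_paths X p \<gamma>1 \<and> osc_geodesic L X \<gamma>1 \<and>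
                  homotopic_paths X p \<gamma>2 \<and> osc_geodesic L X \<gamma>2 \<longrightarrow> is_reparametrization \<gamma>1 \<gamma>2)"
proof (intro conjI allI impI)
  note X = assms(1) and L = assms(4) and Xc = compact_imp_closed[OF assms(1)]
  obtain \<gamma> where \<gamma>: "homotopic_paths X p \<gamma>" "tight X \<gamma>"
    using tight_representative[OF X L assms(5,6)] by metis
  have p\<gamma>: "path \<gamma>" "path_image \<gamma> \<subseteq> X" using \<gamma>(2) by (auto simp: tight_def)
  \<comment> \<open>A competitor need not lie in the restricted class from which
    \<open>\<gamma>\<close> was obtained. It is compared through its own tight representative
    \<open>q\<close>, of which \<open>\<gamma>\<close> is a reparametrization.\<close>
  have "Tfun L \<gamma> \<le> Tfun L \<beta>" if \<beta>: "homotopic_paths X \<gamma> \<beta>" for \<beta>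
  proof -
    have p\<beta>: "path \<beta>" "path_image \<beta> \<subseteq> X"
      using \<beta> homotopic_paths_imp_path homotopic_paths_imp_subset by blast+
    obtain q where q: "homotopic_paths X \<beta> q" "tight X q" "\<And>i. osc q (L i) \<le> osc \<beta> (L i)"
      using tight_representative[OF X L p\<beta>] by metis
    have pq: "path q" using q(2) by (simp add: tight_def)
    have "is_reparametrization \<gamma> q"
      by (rule tight_unique[OF Xc \<gamma>(2) q(2) homotopic_paths_trans[OF \<beta> q(1)]])
    then have "osc \<gamma> (L i) \<le> osc \<beta> (L i)" for i
      using osc_le_if_reparametrization[OF _ pq] q(3) order_trans by blast
    then show ?thesis by (rule Tfun_mono[OF p\<gamma>(1) p\<beta>(1)])
  qed
  then show "\<exists>\<gamma>. homotopic_paths X p \<gamma> \<and> osc_geodesic L X \<gamma>"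
    using \<gamma>(1) p\<gamma> unfolding osc_geodesic_def by blast
  have tight: "tight X g" if "osc_geodesic L X g" for g
  proof (rule ccontr)
    assume nt: "\<not> tight X g"
    have g: "path g" "path_image g \<subseteq> X" using that by (auto simp: osc_geodesic_def)
    show False
      by (rule shorten_if_not_tight[OF L g nt]) (use that in \<open>fastforce simp: osc_geodesic_def\<close>)
  qed
  fix \<gamma>1 \<gamma>2
  assume g: "homotopic_paths X p \<gamma>1 \<and> osc_geodesic L X \<gamma>1 \<and> homotopic_paths X p \<gamma>2 \<and> osc_geodesic L X \<gamma>2"
  then have "homotopic_paths X \<gamma>1 \<gamma>2" by (meson homotopic_paths_sym homotopic_paths_trans)
  then show "is_reparametrization \<gamma>1 \<gamma>2" using g by (intro tight_unique[OF Xc] tight) simp_all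
qed

end
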